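(* Let $(M,\omega,\tau)$ be a real symplectic manifold of dimension $2n$ such that the fixed point set $L=\mathrm{Fix}(\tau)$ is nonempty. Let $\Lambda\in(0,+\infty]$ and $m\in\mathbb{N}\cup\{0\}$. Then the following two claims are equivalent. (i) Every Hamiltonian diffeomorphism $\phi$ on $M$ generated by a Hamiltonian function $H\in C_0^\infty([0,1]\times M)$ with $\|H\|<\Lambda$ satisfies $\sharp(L\cap\phi(L))\ge m$. (ii) Every $1$-periodic in time and symmetric $H\in C_0^\infty(\mathbb{R}/\mathbb{Z}\times M)$ with $\|H\|<2\Lambda$ satisfies $\sharp\mathcal{P}(H,\tau)\ge m$.
   Context: A real symplectic manifold $(M,\omega,\tau)$ is a symplectic manifold $(M,\omega)$ together with a smooth map $\tau:M\to M$ satisfying $\tau^2=\mathrm{id}_M$ and $\tau^*\omega=-\omega$. $C_0^\infty$ denotes smooth compactly supported real functions. For a time-dependent Hamiltonian $H_t(x)=H(t,x)$, the vector field $X_{H_t}$ is defined by $\omega(X_{H_t},\cdot)=-dH_t$, and $\phi^H_t$ is its flow, $\frac{d}{dt}\phi^H_t=X_{H_t}\circ\phi^H_t$, $\phi^H_0=\mathrm{id}_M$; the Hamiltonian diffeomorphism generated by $H$ is $\phi^H_1$. The Hofer norm is $\|H\|=\int_0^1[\sup_x H_t(x)-\inf_x H_t(x)]\,dt$. Functions on $\mathbb{R}/\mathbb{Z}\times M$ are identified with functions on $\mathbb{R}\times M$ that are $1$-periodic in $t$. $H$ is $1$-periodic in time and symmetric if $H(t+1,x)=H(t,x)$ and $H(t,x)=H(-t,\tau(x))$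 for all $(t,x)\in\mathbb{R}\times M$. $\mathcal{P}(H,\tau)$ is the set of all $1$-periodic solutions $x:\mathbb{R}\to M$ of $\dot x(t)=X_{H_t}(x(t))$ satisfying $x(-t)=\tau(x(t))$ for all $t\in\mathbb{R}$. $\sharp$ denotes cardinality. *)

theory Defs
  imports "HOL-Analysis.Analysis" "HOL-Library.Extended_Nat" "HOL-Library.Extended_Real"
begin

section \<open>Smooth functions\<close>

primrec Ck_on ::
    "nat \<Rightarrow> 'a::euclidean_space set \<Rightarrow> ('a \<Rightarrow> 'b::real_normed_vector) \<Rightarrow> bool"
where
  "Ck_on 0 U f \<longleftrightarrow> continuous_on U f"
| "Ck_on (Suc k) U f \<longleftrightarrow>
     (\<forall>x\<in>U. f differentiable (at x)) \<and> (\<forall>v. Ck_on k U (\<lambda>x. frechet_derivative f (at x) v))"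

text \<open>\<open>Ck_on\<close> is meant for open sets. On an arbitrary set, such as the product of
  \<open>{0..1}\<close> with an open set, a function is smooth if locally it is the restriction of a
  smooth function defined on an open set.\<close>

definition smooth_on ::
    "'a::euclidean_space set \<Rightarrow> ('a \<Rightarrow> 'b::real_normed_vector) \<Rightarrow> bool"
where
  "smooth_on S f \<longleftrightarrow>
     (\<forall>x\<in>S. \<exists>U g. open U \<and> x \<in> U \<and> (\<forall>k. Ck_on k U g) \<and> (\<forall>y\<in>S \<inter> U. g y = f y))"


section \<open>Smooth manifolds\<close>

text \<open>A chart is a pair of an open set and a map that is relevant only on that set. The
  manifold is the whole type \<open>'a\<close>; its smooth structure is given by an atlas, which need not
  be maximal.\<close>

type_synonym ('a, 'e) chart = "'a set \<times> ('a \<Rightarrow> 'e)"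

definition chart_dom :: "('a, 'e) chart \<Rightarrow> 'a set"
  where "chart_dom c = fst c"

definition chart_map :: "('a, 'e) chart \<Rightarrow> 'a \<Rightarrow> 'e"
  where "chart_map c = snd c"

definition chart_inv :: "('a, 'e) chart \<Rightarrow> 'e \<Rightarrow> 'a"
  where "chart_inv c = inv_into (fst c) (snd c)"

definition chart_img :: "('a, 'e) chart \<Rightarrow> 'e set"
  where "chart_img c = chart_map c ` chart_dom c"

definition charts_at :: "('a, 'e) chart set \<Rightarrow> 'a \<Rightarrow> ('a, 'e) chart set"
  where "charts_at A p = {c \<in> A. p \<in> chart_dom c}"

locale smooth_manifold =
  fixes A :: "('a::{t2_space,second_countable_topology}, 'e::euclidean_space) chart set"
  assumes chart_open: "c \<in> A \<Longrightarrow> open (chart_dom c) \<and> open (chart_img c)"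
    and chart_homeo:
      "c \<in> A \<Longrightarrow> homeomorphism (chart_dom c) (chart_img c) (chart_map c) (chart_inv c)"
    and chart_cover: "(\<Union>c\<in>A. chart_dom c) = UNIV"
    and chart_compat: "c \<in> A \<Longrightarrow> d \<in> A \<Longrightarrow>
      smooth_on (chart_map c ` (chart_dom c \<inter> chart_dom d)) (chart_map d \<circ> chart_inv c)"

text \<open>A map \<open>F\<close> between manifolds with atlases \<open>A\<close> and \<open>B\<close>.\<close>

definition smooth_map ::
    "('a::topological_space, 'e::euclidean_space) chart set
      \<Rightarrow> ('b::topological_space, 'f::euclidean_space) chart set \<Rightarrow> ('a \<Rightarrow> 'b) \<Rightarrow> bool"
where
  "smooth_map A B F \<longleftrightarrow> continuous_on UNIV F \<and>
     (\<forall>c\<in>A. \<forall>d\<in>B. smooth_on (chart_map c ` (chart_dom c \<inter> F -` chart_dom d))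
        (chart_map d \<circ> F \<circ> chart_inv c))"


section \<open>Tangent vectors and differentials\<close>

text \<open>A tangent vector at \<open>p\<close> is a family of coordinate vectors, one for each chart around
  \<open>p\<close>, which transform into each other under the derivatives of the chart transitions. It is
  extended by 0 to all other pairs of the chart type, so that equality of tangent vectors is
  equality of functions.\<close>

type_synonym ('a, 'e) tangent = "('a, 'e) chart \<Rightarrow> 'e"

definition tangent_space ::
    "('a, 'e::euclidean_space) chart set \<Rightarrow> 'a \<Rightarrow> ('a, 'e) tangent set"
where
  "tangent_space A p = {v.
     (\<forall>c\<in>charts_at A p. \<forall>d\<in>charts_at A p.
        v d = frechet_derivative (chart_map d \<circ> chart_inv c) (at (chart_map c p)) (v c)) \<and>
     (\<forall>c. c \<notin> charts_at A p \<longrightarrow> v c = 0)}"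

text \<open>The tangent vector at \<open>p\<close> with coordinate vector \<open>u\<close> in the chart \<open>c\<close>.\<close>

definition coord_vector ::
    "('a, 'e::euclidean_space) chart set \<Rightarrow> ('a, 'e) chart \<Rightarrow> 'a \<Rightarrow> 'e \<Rightarrow> ('a, 'e) tangent"
where
  "coord_vector A c p u = (\<lambda>d. if d \<in> charts_at A p
     then frechet_derivative (chart_map d \<circ> chart_inv c) (at (chart_map c p)) u else 0)"

text \<open>The two differentials below do not depend on the choice of the chart \<open>c\<close>.\<close>

definition map_differential ::
    "('a, 'e::euclidean_space) chart set \<Rightarrow> ('b, 'f::euclidean_space) chart set
      \<Rightarrow> ('a \<Rightarrow> 'b) \<Rightarrow> 'a \<Rightarrow> ('a, 'e) tangent \<Rightarrow> ('b, 'f) tangent"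
where
  "map_differential A B F p v = (\<lambda>d. if d \<in> charts_at B (F p)
     then let c = (SOME c. c \<in> charts_at A p) in
       frechet_derivative (chart_map d \<circ> F \<circ> chart_inv c) (at (chart_map c p)) (v c)
     else 0)"

definition fun_differential ::
    "('a, 'e::euclidean_space) chart set \<Rightarrow> ('a \<Rightarrow> real) \<Rightarrow> 'a \<Rightarrow> ('a, 'e) tangent \<Rightarrow> real"
where
  "fun_differential A f p v = (let c = (SOME c. c \<in> charts_at A p) in
     frechet_derivative (f \<circ> chart_inv c) (at (chart_map c p)) (v c))"


section \<open>Symplectic and real symplectic manifolds\<close>

type_synonym ('a, 'e) two_form = "'a \<Rightarrow> ('a, 'e) tangent \<Rightarrow> ('a, 'e) tangent \<Rightarrow> real"

text \<open>The coordinate expression of a 2-form in the chart \<open>c\<close>, at the point with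
  coordinates \<open>z\<close>.\<close>

definition form_rep ::
    "('a, 'e::euclidean_space) chart set \<Rightarrow> ('a, 'e) two_form \<Rightarrow> ('a, 'e) chart
      \<Rightarrow> 'e \<Rightarrow> 'e \<Rightarrow> 'e \<Rightarrow> real"
where
  "form_rep A \<omega> c z u v = \<omega> (chart_inv c z)
     (coord_vector A c (chart_inv c z) u) (coord_vector A c (chart_inv c z) v)"

text \<open>Closedness is \<open>d\<omega> = 0\<close> evaluated on constant coordinate vector fields, whose Lie
  brackets vanish.\<close>

locale symplectic_manifold = smooth_manifold A
  for A :: "('a::{t2_space,second_countable_topology}, 'e::euclidean_space) chart set" +
  fixes \<omega> :: "('a, 'e) two_form"
  assumes form_linear:
      "\<lbrakk>u \<in> tangent_space A p; v \<in> tangent_space A p; w \<in> tangent_space A p\<rbrakk> \<Longrightarrow>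
        \<omega> p (\<lambda>c. a *\<^sub>R u c + b *\<^sub>R v c) w = a * \<omega> p u w + b * \<omega> p v w"
    and form_skew:
      "\<lbrakk>u \<in> tangent_space A p; v \<in> tangent_space A p\<rbrakk> \<Longrightarrow> \<omega> p v u = - \<omega> p u v"
    and form_smooth:
      "c \<in> A \<Longrightarrow> smooth_on (chart_img c) (\<lambda>z. form_rep A \<omega> c z x y)"
    and form_closed:
      "\<lbrakk>c \<in> A; z \<in> chart_img c\<rbrakk> \<Longrightarrow>
        frechet_derivative (\<lambda>z. form_rep A \<omega> c z y1 y2) (at z) y0
        + frechet_derivative (\<lambda>z. form_rep A \<omega> c z y2 y0) (at z) y1
        + frechet_derivative (\<lambda>z. form_rep A \<omega> c z y0 y1) (at z) y2 = 0"
    and form_nondegenerate: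
      "\<lbrakk>u \<in> tangent_space A p; \<forall>v\<in>tangent_space A p. \<omega> p u v = 0\<rbrakk> \<Longrightarrow> u = (\<lambda>c. 0)"

locale real_symplectic_manifold = symplectic_manifold A \<omega>
  for A :: "('a::{t2_space,second_countable_topology}, 'e::euclidean_space) chart set"
    and \<omega> :: "('a, 'e) two_form" +
  fixes \<tau> :: "'a \<Rightarrow> 'a"
  assumes involution_smooth: "smooth_map A A \<tau>"
    and involution: "\<tau> \<circ> \<tau> = id"
    and involution_antisymplectic:
      "\<lbrakk>u \<in> tangent_space A p; v \<in> tangent_space A p\<rbrakk> \<Longrightarrow>
        \<omega> (\<tau> p) (map_differential A A \<tau> p u) (map_differential A A \<tau> p v) = - \<omega> p u v"

definition fixed_set :: "('a \<Rightarrow> 'a) \<Rightarrow> 'a set"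
  where "fixed_set \<tau> = {x. \<tau> x = x}"


section \<open>Hamiltonian functions and their dynamics\<close>

text \<open>Smoothness of \<open>H\<close> on \<open>T \<times> M\<close>.\<close>

definition smooth_hamiltonian_on ::
    "('a, 'e::euclidean_space) chart set \<Rightarrow> real set \<Rightarrow> (real \<Rightarrow> 'a \<Rightarrow> real) \<Rightarrow> bool"
where
  "smooth_hamiltonian_on A T H \<longleftrightarrow>
     (\<forall>c\<in>A. smooth_on (T \<times> chart_img c) (\<lambda>(t, z). H t (chart_inv c z)))"

text \<open>For a function that is 1-periodic in time, this says that the support in the product
  of the circle with \<open>M\<close> is compact, since \<open>{0..1}\<close> maps onto the circle.\<close>

definition compact_support_01 :: "(real \<Rightarrow> 'a::topological_space \<Rightarrow> real) \<Rightarrow> bool"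
  where "compact_support_01 H \<longleftrightarrow> compact (closure {(t, x). t \<in> {0..1} \<and> H t x \<noteq> 0})"

text \<open>\<open>H \<in> C\<^sub>0\<^sup>\<infinity>([0,1] \<times> M)\<close>: only the values at times in \<open>{0..1}\<close> matter.\<close>

definition C0_infinity_interval ::
    "('a::topological_space, 'e::euclidean_space) chart set \<Rightarrow> (real \<Rightarrow> 'a \<Rightarrow> real) set"
where
  "C0_infinity_interval A = {H. smooth_hamiltonian_on A {0..1} H \<and> compact_support_01 H}"

text \<open>\<open>H \<in> C\<^sub>0\<^sup>\<infinity>(\<real>/\<int> \<times> M)\<close>, as 1-periodic functions.\<close>

definition C0_infinity_circle ::
    "('a::topological_space, 'e::euclidean_space) chart set \<Rightarrow> (real \<Rightarrow> 'a \<Rightarrow> real) set"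
where
  "C0_infinity_circle A = {H. smooth_hamiltonian_on A UNIV H \<and>
     (\<forall>t x. H (t + 1) x = H t x) \<and> compact_support_01 H}"

definition periodic_symmetric :: "('a \<Rightarrow> 'a) \<Rightarrow> (real \<Rightarrow> 'a \<Rightarrow> real) \<Rightarrow> bool"
where
  "periodic_symmetric \<tau> H \<longleftrightarrow>
     (\<forall>t x. H (t + 1) x = H t x) \<and> (\<forall>t x. H t x = H (- t) (\<tau> x))"

definition hofer_norm :: "(real \<Rightarrow> 'a \<Rightarrow> real) \<Rightarrow> real"
  where "hofer_norm H = integral {0..1} (\<lambda>t. (SUP x. H t x) - (INF x. H t x))"

definition hamiltonian_vector_field ::
    "('a, 'e::euclidean_space) chart set \<Rightarrow> ('a, 'e) two_form \<Rightarrow> ('a \<Rightarrow> real)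
      \<Rightarrow> 'a \<Rightarrow> ('a, 'e) tangent"
where
  "hamiltonian_vector_field A \<omega> f p = (THE v. v \<in> tangent_space A p \<and>
     (\<forall>w\<in>tangent_space A p. \<omega> p v w = - fun_differential A f p w))"

text \<open>\<open>\<gamma>\<close> solves \<open>\<gamma>'(t) = X t (\<gamma> t)\<close> on the time interval \<open>T\<close>, one-sided at end points.
  Continuity is required separately because a chart map is arbitrary outside its domain.\<close>

definition solves_ode ::
    "('a::topological_space, 'e::euclidean_space) chart set
      \<Rightarrow> (real \<Rightarrow> 'a \<Rightarrow> ('a, 'e) tangent) \<Rightarrow> real set \<Rightarrow> (real \<Rightarrow> 'a) \<Rightarrow> bool"
where
  "solves_ode A X T \<gamma> \<longleftrightarrow> continuous_on T \<gamma> \<and>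
     (\<forall>t\<in>T. \<forall>c\<in>charts_at A (\<gamma> t).
        ((\<lambda>s. chart_map c (\<gamma> s)) has_vector_derivative X t (\<gamma> t) c) (at t within T))"

definition hamiltonian_flow ::
    "('a::topological_space, 'e::euclidean_space) chart set \<Rightarrow> ('a, 'e) two_form
      \<Rightarrow> (real \<Rightarrow> 'a \<Rightarrow> real) \<Rightarrow> (real \<Rightarrow> 'a \<Rightarrow> 'a) \<Rightarrow> bool"
where
  "hamiltonian_flow A \<omega> H \<Phi> \<longleftrightarrow> \<Phi> 0 = id \<and>
     (\<forall>p. solves_ode A (\<lambda>t. hamiltonian_vector_field A \<omega> (H t)) {0..1} (\<lambda>t. \<Phi> t p))"

text \<open>\<open>\<phi>\<close> is the time-1 map of the flow of \<open>H\<close>.\<close>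

definition generated_by ::
    "('a::topological_space, 'e::euclidean_space) chart set \<Rightarrow> ('a, 'e) two_form
      \<Rightarrow> (real \<Rightarrow> 'a \<Rightarrow> real) \<Rightarrow> ('a \<Rightarrow> 'a) \<Rightarrow> bool"
where
  "generated_by A \<omega> H \<phi> \<longleftrightarrow> (\<exists>\<Phi>. hamiltonian_flow A \<omega> H \<Phi> \<and> \<phi> = \<Phi> 1)"

definition symmetric_orbits ::
    "('a::topological_space, 'e::euclidean_space) chart set \<Rightarrow> ('a, 'e) two_form
      \<Rightarrow> (real \<Rightarrow> 'a \<Rightarrow> real) \<Rightarrow> ('a \<Rightarrow> 'a) \<Rightarrow> (real \<Rightarrow> 'a) set"
where
  "symmetric_orbits A \<omega> H \<tau> = {x.
     solves_ode A (\<lambda>t. hamiltonian_vector_field A \<omega> (H t)) UNIV x \<and>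
     (\<forall>t. x (t + 1) = x t) \<and> (\<forall>t. x (- t) = \<tau> (x t))}"

definition ecard :: "'a set \<Rightarrow> enat"
  where "ecard S = (if finite S then enat (card S) else \<infinity>)"

end

theory Submission
  imports Defs
begin

text \<open>
  Let \<open>L\<close> be the fixed set of the antisymplectic involution \<open>\<tau>\<close>. If \<open>H\<close> is periodic and symmetric, then
  \<open>\<tau>\<close> maps the flow lines of \<open>H\<close> to flow lines run backwards. A 1-periodic solution with
  \<open>x (- t) = \<tau> (x t)\<close> meets \<open>L\<close> at the times 0 and 1/2, and conversely a flow line over
  \<open>{0..1 / 2}\<close> with both ends in \<open>L\<close> closes up, by reflection, to such a solution. Hence
  symmetric orbits of \<open>H\<close> correspond to points of \<open>L \<inter> \<psi> ` L\<close>, where \<open>\<psi>\<close> is the time-1/2 map of \<open>H\<close>.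

  The symmetry makes both halves of the period contribute equally to the Hofer norm, so \<open>\<psi>\<close> is generated, after
  rescaling of time, by a Hamiltonian of half the norm; this gives one implication
  (\<open>symmetric_orbits_from_intersections\<close>). For the other one
  (\<open>intersections_from_symmetric_orbits\<close>), a Hamiltonian on \<open>{0..1}\<close> is reparametrised so that
  it runs during the first half of the period and vanishes to infinite order at the ends; the
  symmetry then dictates a smooth continuation to the second half, of twice the norm. The
  reparametrisation is provided by \<open>symmetric_time_cutoff\<close>.

  The correspondence needs the flow of a compactly supported Hamiltonian to exist
  (\<open>hamiltonian_flow_exists\<close>) and its orbits to be determined by one value
  (\<open>solution_unique\<close>). Both follow from the local Lipschitz property of the
  Hamiltonian vector field in charts (\<open>hamiltonian_field_locally_lipschitz\<close>) by Picard iteration, by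
  compactness of the support and by the Hausdorff property.
\<close>

section \<open>Calculus of smooth functions\<close>

lemma Ck_on_subset: "Ck_on k U f \<Longrightarrow> V \<subseteq> U \<Longrightarrow> Ck_on k V f"
  by (induction k arbitrary: f) (auto intro: continuous_on_subset)

text \<open>On an open set the derivatives of a function depend on its values on that set only, so the
  induction never leaves the set.\<close>

lemma Ck_on_cong:
  assumes "open U" "\<And>x. x \<in> U \<Longrightarrow> f x = g x" "Ck_on k U f"
  shows "Ck_on k U g"
  using assms(2,3)
proof (induction k arbitrary: f g)
  case 0
  then show ?case by (metis Ck_on.simps(1) continuous_on_cong)
next
  case (Suc k)
  have d: "f differentiable at x" if "x \<in> U" for x
    using Suc.prems(2) that by auto
  have "g differentiable at x" if "x \<in> U" for x
    using d[OF that] Suc.prems(1) that \<open>open U\<close>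
    by (metis differentiable_def has_derivative_transform_within_open)
  moreover have "Ck_on k U (\<lambda>x. frechet_derivative g (at x) v)" for v
  proof (rule Suc.IH)
    show "Ck_on k U (\<lambda>x. frechet_derivative f (at x) v)"
      using Suc.prems(2) by auto
    show "frechet_derivative f (at x) v = frechet_derivative g (at x) v" if "x \<in> U" for x
      using frechet_derivative_transform_within_open[OF d[OF that] \<open>open U\<close> that] Suc.prems(1) by simp
  qed
  ultimately show ?case by simp
qed

lemma Ck_on_local:
  assumes "\<And>x. x \<in> U \<Longrightarrow> \<exists>V. open V \<and> x \<in> V \<and> Ck_on k V f"
  shows "Ck_on k U f"
  using assms
proof (induction k arbitrary: f)
  case 0
  have "continuous (at x) f" if "x \<in> U" for x
    using 0[OF that] by (auto simp: continuous_on_eq_continuous_at)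
  then show ?case by (simp add: continuous_at_imp_continuous_on)
next
  case (Suc k)
  have "f differentiable at x" if "x \<in> U" for x using Suc.prems[OF that] by auto
  moreover have "Ck_on k U (\<lambda>x. frechet_derivative f (at x) v)" for v
    by (rule Suc.IH) (metis Suc.prems Ck_on.simps(2))
  ultimately show ?case by simp
qed

lemma Ck_on_SucD: "Ck_on (Suc k) U f \<Longrightarrow> Ck_on k U f"
proof (induction k arbitrary: f)
  case 0
  then show ?case
    by (auto intro!: continuous_at_imp_continuous_on differentiable_imp_continuous_within)
next
  case (Suc k)
  have "Ck_on k U (\<lambda>x. frechet_derivative f (at x) v)" for v
    using Suc.prems by (intro Suc.IH) (metis Ck_on.simps(2))
  then show ?case using Suc.prems by simp
qed

text \<open>The working rule for the lemmas below: exhibit a derivative and show that its directional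
  derivatives are of class one less, without mentioning the choice operator behind
  \<^const>\<open>frechet_derivative\<close>.\<close>

lemma Ck_on_Suc_I:
  assumes "open U" "\<And>x. x \<in> U \<Longrightarrow> (f has_derivative f' x) (at x)" "\<And>v. Ck_on k U (\<lambda>x. f' x v)"
  shows "Ck_on (Suc k) U f"
proof -
  have "frechet_derivative f (at x) = f' x" if "x \<in> U" for x
    using assms(2)[OF that] frechet_derivative_at by metis
  then have "Ck_on k U (\<lambda>x. frechet_derivative f (at x) v)" for v
    by (intro Ck_on_cong[OF \<open>open U\<close> _ assms(3)[of v]]) auto
  then show ?thesis using assms(2) by (auto simp: differentiable_def)
qed

lemma Ck_on_has_derivative:
  "Ck_on (Suc k) U f \<Longrightarrow> x \<in> U \<Longrightarrow> (f has_derivative frechet_derivative f (at x)) (at x)"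
  by (simp add: frechet_derivative_works)

lemma Ck_on_const: "Ck_on k U (\<lambda>x. c)"
  by (induction k arbitrary: c) auto

lemma Ck_on_linear:
  assumes "bounded_linear L" "open U"
  shows "Ck_on k U L"
proof (cases k)
  case 0
  then show ?thesis by (simp add: assms(1) linear_continuous_on)
next
  case (Suc j)
  show ?thesis unfolding Suc
    by (rule Ck_on_Suc_I[OF assms(2) bounded_linear_imp_has_derivative[OF assms(1)]])
      (rule Ck_on_const)
qed

lemma Ck_on_bounded_linear:
  assumes "bounded_linear L" "open U" "Ck_on k U f"
  shows "Ck_on k U (\<lambda>x. L (f x))"
  using assms(3)
proof (induction k arbitrary: f)
  case 0
  then show ?case using bounded_linear.continuous_on[OF assms(1)] by simp
next
  case (Suc k)
  show ?case
    by (rule Ck_on_Suc_I[OF assms(2) bounded_linear.has_derivative[OF assms(1) Ck_on_has_derivative[OF Suc.prems]]])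
      (use Suc in auto)
qed

lemma Ck_on_add:
  assumes "open U" "Ck_on k U f" "Ck_on k U g"
  shows "Ck_on k U (\<lambda>x. f x + g x)"
  using assms(2,3)
proof (induction k arbitrary: f g)
  case 0
  then show ?case by (simp add: continuous_on_add)
next
  case (Suc k)
  show ?case
    by (rule Ck_on_Suc_I[OF assms(1) has_derivative_add[OF Ck_on_has_derivative[OF Suc.prems(1)]
        Ck_on_has_derivative[OF Suc.prems(2)]]])
      (use Suc in auto)
qed

lemma Ck_on_sum:
  assumes "open U" "\<And>i. i \<in> I \<Longrightarrow> Ck_on k U (f i)"
  shows "Ck_on k U (\<lambda>x. \<Sum>i\<in>I. f i x)"
  using assms(2) by (induction I rule: infinite_finite_induct)
    (auto intro: Ck_on_const Ck_on_add[OF assms(1)])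

lemma Ck_on_Pair:
  assumes "open U" "Ck_on k U f" "Ck_on k U g"
  shows "Ck_on k U (\<lambda>x. (f x, g x))"
  using assms(2,3)
proof (induction k arbitrary: f g)
  case 0
  then show ?case by (simp add: continuous_on_Pair)
next
  case (Suc k)
  show ?case
    by (rule Ck_on_Suc_I[OF assms(1) has_derivative_Pair[OF Ck_on_has_derivative[OF Suc.prems(1)]
        Ck_on_has_derivative[OF Suc.prems(2)]]])
      (use Suc in auto)
qed

lemma Ck_on_scaleR:
  fixes f :: "'a::euclidean_space \<Rightarrow> real"
  assumes "open U" "Ck_on k U f" "Ck_on k U g"
  shows "Ck_on k U (\<lambda>x. f x *\<^sub>R g x)"
  using assms(2,3)
proof (induction k arbitrary: f g)
  case 0
  then show ?case by (simp add: continuous_on_scaleR)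
next
  case (Suc k)
  show ?case
    by (rule Ck_on_Suc_I[OF assms(1) has_derivative_scaleR[OF Ck_on_has_derivative[OF Suc.prems(1)]
        Ck_on_has_derivative[OF Suc.prems(2)]]])
      (use Suc Ck_on_SucD[OF Suc.prems(1)] Ck_on_SucD[OF Suc.prems(2)] in \<open>auto intro!: Ck_on_add[OF assms(1)]\<close>)
qed

text \<open>The chain rule expresses a directional derivative of \<open>g \<circ> f\<close> as \<open>Dg (f x) (Df x v)\<close>. Both
  factors vary with \<open>x\<close>, while the induction hypothesis speaks of \<open>Dg\<close> in a fixed direction;
  expanding \<open>Df x v\<close> in the standard basis turns it into a finite sum of products.\<close>

lemma Ck_on_compose:
  fixes f :: "'a::euclidean_space \<Rightarrow> 'b::euclidean_space"
  assumes "open U" "open V" "f ` U \<subseteq> V" "Ck_on k U f" "Ck_on k V g"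
  shows "Ck_on k U (\<lambda>x. g (f x))"
  using assms(4,5)
proof (induction k arbitrary: g)
  case 0
  then show ?case using assms(3) by (auto intro: continuous_on_compose2)
next
  case (Suc k)
  have g: "(g has_derivative frechet_derivative g (at (f x))) (at (f x))" if "x \<in> U" for x
    using Suc.prems(2) that assms(3) by (intro Ck_on_has_derivative) auto
  have lin: "frechet_derivative g (at (f x)) w
      = (\<Sum>b\<in>Basis. (w \<bullet> b) *\<^sub>R frechet_derivative g (at (f x)) b)"
    if "x \<in> U" for x w
  proof -
    interpret bounded_linear "frechet_derivative g (at (f x))"
      using g[OF that] by (rule has_derivative_bounded_linear)
    have "frechet_derivative g (at (f x)) (\<Sum>b\<in>Basis. (w \<bullet> b) *\<^sub>R b)
        = (\<Sum>b\<in>Basis. (w \<bullet> b) *\<^sub>R frechet_derivative g (at (f x)) b)"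
      by (simp add: sum scaleR)
    then show ?thesis by (simp add: euclidean_representation)
  qed
  have D: "((\<lambda>x. g (f x)) has_derivative
      (\<lambda>v. \<Sum>b\<in>Basis. (frechet_derivative f (at x) v \<bullet> b) *\<^sub>R frechet_derivative g (at (f x)) b)) (at x)"
    if "x \<in> U" for x
    using has_derivative_compose[OF Ck_on_has_derivative[OF Suc.prems(1) that] g[OF that]]
    by (simp add: lin[OF that, symmetric])
  have "Ck_on k U (\<lambda>x. \<Sum>b\<in>Basis. (frechet_derivative f (at x) v \<bullet> b) *\<^sub>R
      frechet_derivative g (at (f x)) b)" for v
  proof (intro Ck_on_sum Ck_on_scaleR \<open>open U\<close>)
    fix b :: 'b
    show "Ck_on k U (\<lambda>x. frechet_derivative f (at x) v \<bullet> b)"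
      using Suc.prems(1) by (intro Ck_on_bounded_linear[OF bounded_linear_inner_left \<open>open U\<close>]) auto
    show "Ck_on k U (\<lambda>x. frechet_derivative g (at (f x)) b)"
      using Suc.prems(2) by (intro Suc.IH Ck_on_SucD[OF Suc.prems(1)]) simp
  qed
  then show ?case by (intro Ck_on_Suc_I[OF \<open>open U\<close> D])
qed

lemma smooth_onD:
  assumes "smooth_on S f" "x \<in> S"
  shows "\<exists>U g. open U \<and> x \<in> U \<and> (\<forall>k. Ck_on k U g) \<and> (\<forall>y\<in>S \<inter> U. g y = f y)"
  using assms unfolding smooth_on_def by blast

lemma smooth_on_open_iff: "open S \<Longrightarrow> smooth_on S f \<longleftrightarrow> (\<forall>k. Ck_on k S f)"
proof
  assume S: "open S" and f: "smooth_on S f"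
  show "\<forall>k. Ck_on k S f"
  proof (intro allI Ck_on_local)
    fix k x assume x: "x \<in> S"
    obtain U g where U: "open U" "x \<in> U" "\<forall>k. Ck_on k U g" "\<forall>y\<in>S \<inter> U. g y = f y"
    using smooth_onD[OF f x] by (elim exE conjE) (rule that)
    have "Ck_on k (S \<inter> U) f"
      by (rule Ck_on_cong[OF open_Int[OF S U(1)] _ Ck_on_subset[OF U(3)[rule_format]]]) (simp_all add: U(4))
    then show "\<exists>V. open V \<and> x \<in> V \<and> Ck_on k V f"
      using S U \<open>x \<in> S\<close> by (intro exI[of _ "S \<inter> U"]) auto
  qed
next
  assume "open S" "\<forall>k. Ck_on k S f"
  then show "smooth_on S f" unfolding smooth_on_def by blast
qed

lemma smooth_on_subset:
  assumes "smooth_on S f" "T \<subseteq> S"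
  shows "smooth_on T f"
  unfolding smooth_on_def
proof
  fix x assume "x \<in> T"
  from smooth_onD[OF assms(1) subsetD[OF assms(2) this]]
  show "\<exists>U g. open U \<and> x \<in> U \<and> (\<forall>k. Ck_on k U g) \<and> (\<forall>y\<in>T \<inter> U. g y = f y)"
    by (elim exE conjE, intro exI conjI) (use assms(2) in \<open>assumption | auto\<close>)+
qed

lemma smooth_on_local:
  assumes "\<And>x. x \<in> S \<Longrightarrow> \<exists>V. open V \<and> x \<in> V \<and> smooth_on (S \<inter> V) f"
  shows "smooth_on S f"
  unfolding smooth_on_def
proof
  fix x assume x: "x \<in> S"
  then obtain V where V: "open V" "x \<in> V" "smooth_on (S \<inter> V) f" using assms by blast
  obtain U g where U: "open U" "x \<in> U" "\<forall>k. Ck_on k U g" "\<forall>y\<in>(S \<inter> V) \<inter> U. g y = f y"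
    using smooth_onD[OF V(3), of x, OF IntI[OF x V(2)]] by (elim exE conjE) (rule that)
  then show "\<exists>U g. open U \<and> x \<in> U \<and> (\<forall>k. Ck_on k U g) \<and> (\<forall>y\<in>S \<inter> U. g y = f y)"
    using V Ck_on_subset[OF U(3)[rule_format], of "U \<inter> V"] by (intro exI[of _ "U \<inter> V"] exI[of _ g]) auto
qed

lemma smooth_on_cong: "(\<And>x. x \<in> S \<Longrightarrow> f x = g x) \<Longrightarrow> smooth_on S f \<Longrightarrow> smooth_on S g"
  unfolding smooth_on_def by simp

lemma smooth_on_imp_continuous_on: "smooth_on S f \<Longrightarrow> continuous_on S f"
  unfolding continuous_on_eq_continuous_within
proof
  fix x assume f: "smooth_on S f" and x: "x \<in> S"
  obtain U g where U: "open U" "x \<in> U" "\<forall>k. Ck_on k U g" "\<forall>y\<in>S \<inter> U. g y = f y"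
    using smooth_onD[OF f x] by (elim exE conjE) (rule that)
  have "continuous (at x within S) g"
    using U(3)[rule_format, of 0] U(1,2) by (simp add: continuous_on_eq_continuous_at continuous_at_imp_continuous_at_within)
  moreover have "\<forall>\<^sub>F y in at x within S. g y = f y"
    using U x by (auto simp: eventually_at_filter intro!: eventually_nhds[THEN iffD2] exI[of _ U])
  ultimately show "continuous (at x within S) f"
    using U(2,4) x by (auto simp: continuous_within elim: Lim_transform_eventually)
qed

lemma smooth_on_compose:
  fixes f :: "'a::euclidean_space \<Rightarrow> 'b::euclidean_space"
  assumes f: "smooth_on S f" and g: "smooth_on T g" and "f ` S \<subseteq> T"
  shows "smooth_on S (\<lambda>x. g (f x))"
  unfolding smooth_on_def
proof
  fix x assume x: "x \<in> S"
  obtain U f' where U: "open U" "x \<in> U" "\<forall>k. Ck_on k U f'" "\<forall>y\<in>S \<inter> U. f' y = f y"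
    using smooth_onD[OF f x] by (elim exE conjE) (rule that)
  obtain V g' where V: "open V" "f x \<in> V" "\<forall>k. Ck_on k V g'" "\<forall>y\<in>T \<inter> V. g' y = g y"
    using smooth_onD[OF g, of "f x", OF subsetD[OF assms(3) imageI[OF x]]] by (elim exE conjE) (rule that)
  define W where "W = U \<inter> f' -` V"
  have W: "open W"
    unfolding W_def Int_commute[of U] using U(1) V(1) U(3)[rule_format, of 0]
    by (simp add: continuous_on_open_vimage)
  have "Ck_on k W (\<lambda>x. g' (f' x))" for k
    by (rule Ck_on_compose[OF W V(1) _ _ V(3)[rule_format]]) (auto simp: W_def intro!: Ck_on_subset[OF U(3)[rule_format]])
  then show "\<exists>U h. open U \<and> x \<in> U \<and> (\<forall>k. Ck_on k U h) \<and> (\<forall>y\<in>S \<inter> U. h y = g (f y))"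
    using W U(2,4) V(2,4) x assms(3)
    by (intro exI[of _ W] exI[of _ "\<lambda>x. g' (f' x)"]) (auto simp: W_def image_subset_iff)
qed

text \<open>Smoothness on an arbitrary set means local smooth extendability. Any operation that preserves
  the classes \<open>C\<^sup>k\<close> on open sets can be applied to two extensions on the intersection of their
  domains, which yields the closure properties on arbitrary sets.\<close>

lemma smooth_on_binary:
  fixes S :: "'a::euclidean_space set"
  assumes F: "\<And>(U :: 'a set) k f' g'. open U \<Longrightarrow> Ck_on k U f' \<Longrightarrow> Ck_on k U g' \<Longrightarrow> Ck_on k U (\<lambda>x. F (f' x) (g' x))"
    and f: "smooth_on S f" and g: "smooth_on S g"
  shows "smooth_on S (\<lambda>x. F (f x) (g x))"
  unfolding smooth_on_def
proof
  fix x assume x: "x \<in> S"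
  obtain U f' where U: "open U" "x \<in> U" "\<forall>k. Ck_on k U f'" "\<forall>y\<in>S \<inter> U. f' y = f y"
    using smooth_onD[OF f x] by (elim exE conjE) (rule that)
  obtain V g' where V: "open V" "x \<in> V" "\<forall>k. Ck_on k V g'" "\<forall>y\<in>S \<inter> V. g' y = g y"
    using smooth_onD[OF g x] by (elim exE conjE) (rule that)
  have "Ck_on k (U \<inter> V) (\<lambda>x. F (f' x) (g' x))" for k
    by (rule F[OF open_Int[OF U(1) V(1)] Ck_on_subset[OF U(3)[rule_format]] Ck_on_subset[OF V(3)[rule_format]]]) auto
  then show "\<exists>U h. open U \<and> x \<in> U \<and> (\<forall>k. Ck_on k U h) \<and> (\<forall>y\<in>S \<inter> U. h y = F (f y) (g y))"
    using U V by (intro exI[of _ "U \<inter> V"] exI[of _ "\<lambda>x. F (f' x) (g' x)"]) auto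
qed

lemma smooth_on_add:
  assumes "smooth_on S f" "smooth_on S g"
  shows "smooth_on S (\<lambda>x. f x + g x)"
  by (rule smooth_on_binary[where F = "(+)", OF _ assms]) (rule Ck_on_add)

lemma smooth_on_Pair:
  assumes "smooth_on S f" "smooth_on S g"
  shows "smooth_on S (\<lambda>x. (f x, g x))"
  by (rule smooth_on_binary[where F = Pair, OF _ assms]) (rule Ck_on_Pair)

lemma smooth_on_mult:
  fixes f g :: "'a::euclidean_space \<Rightarrow> real"
  assumes "smooth_on S f" "smooth_on S g"
  shows "smooth_on S (\<lambda>x. f x * g x)"
  by (rule smooth_on_binary[where F = "(*)", OF _ assms])
    (rule Ck_on_scaleR[where 'b = real, unfolded real_scaleR_def])

lemma smooth_on_bounded_linear: "bounded_linear L \<Longrightarrow> smooth_on S L"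
  by (rule smooth_on_subset[of UNIV]) (auto simp: smooth_on_open_iff intro: Ck_on_linear)

lemma smooth_on_const: "smooth_on S (\<lambda>x. c)"
  by (rule smooth_on_subset[of UNIV]) (auto simp: smooth_on_open_iff Ck_on_const)

lemma smooth_on_realI:
  fixes f :: "real \<Rightarrow> real"
  assumes "open S" "\<And>t. t \<in> S \<Longrightarrow> (f has_real_derivative f' t) (at t)" "smooth_on S f'"
  shows "smooth_on S f"
proof -
  have *: "Ck_on k S (\<lambda>t. f' t * v)" for k v
    by (rule Ck_on_bounded_linear[OF bounded_linear_mult_left assms(1)])
      (use assms(1,3) in \<open>simp add: smooth_on_open_iff\<close>)
  have "Ck_on (Suc k) S f" for k
    by (rule Ck_on_Suc_I[OF assms(1) assms(2)[unfolded has_field_derivative_def] *])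
  then have "Ck_on k S f" for k by (rule Ck_on_SucD)
  then show ?thesis by (simp add: smooth_on_open_iff assms(1))
qed

section \<open>Differentials in charts\<close>

text \<open>The matrix, in the charts \<open>c\<close> and \<open>d\<close>, of the differential of \<open>F\<close> at \<open>p\<close>. For \<open>F = id\<close> it is the
  derivative of the change of coordinates, so that one chain rule covers both the transformation
  law of tangent vectors and the differential of the involution.\<close>

definition rep_deriv ::
    "('a, 'e::euclidean_space) chart \<Rightarrow> ('a, 'e) chart \<Rightarrow> ('a \<Rightarrow> 'a) \<Rightarrow> 'a \<Rightarrow> 'e \<Rightarrow> 'e"
  where "rep_deriv c d F p =
    frechet_derivative (chart_map d \<circ> F \<circ> chart_inv c) (at (chart_map c p))"

context smooth_manifold
begin

lemma charts_at_iff: "c \<in> charts_at A p \<longleftrightarrow> c \<in> A \<and> p \<in> chart_dom c"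
  by (simp add: charts_at_def)

lemma charts_at_nonempty: "\<exists>c. c \<in> charts_at A p"
  using chart_cover unfolding charts_at_iff by blast

lemma some_chart: "(SOME c. c \<in> charts_at A p) \<in> charts_at A p"
  using charts_at_nonempty by (rule someI_ex)

lemma chart_inv_map: "c \<in> A \<Longrightarrow> x \<in> chart_dom c \<Longrightarrow> chart_inv c (chart_map c x) = x"
  using chart_homeo by (simp add: homeomorphism_def)

lemma chart_map_inv: "c \<in> A \<Longrightarrow> z \<in> chart_img c \<Longrightarrow> chart_map c (chart_inv c z) = z"
  using chart_homeo by (simp add: homeomorphism_def)

lemma chart_map_in: "x \<in> chart_dom c \<Longrightarrow> chart_map c x \<in> chart_img c"
  by (simp add: chart_img_def)

lemma chart_inv_in: "c \<in> A \<Longrightarrow> z \<in> chart_img c \<Longrightarrow> chart_inv c z \<in> chart_dom c"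
  using chart_homeo unfolding homeomorphism_def by blast

lemma continuous_on_chart_map: "c \<in> A \<Longrightarrow> continuous_on (chart_dom c) (chart_map c)"
  using chart_homeo by (simp add: homeomorphism_def)

lemma continuous_on_chart_inv: "c \<in> A \<Longrightarrow> continuous_on (chart_img c) (chart_inv c)"
  using chart_homeo by (simp add: homeomorphism_def)

lemma chart_image_eq: "c \<in> A \<Longrightarrow> chart_map c ` (chart_dom c \<inter> V) = chart_img c \<inter> chart_inv c -` V"
  by (auto simp: chart_inv_map chart_map_in intro: chart_inv_in)
    (metis IntI chart_inv_in chart_map_inv image_eqI)

lemma open_chart_image:
  assumes "c \<in> A" "open V"
  shows "open (chart_map c ` (chart_dom c \<inter> V))"
  unfolding chart_image_eq[OF assms(1)] Int_commute[of "chart_img c"]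
  using continuous_on_chart_inv[OF assms(1)] chart_open[OF assms(1)] assms(2)
  by (simp add: continuous_on_open_vimage)

lemma smooth_map_id: "smooth_map A A id"
  unfolding smooth_map_def using chart_compat by simp

lemma rep_smooth:
  assumes "smooth_map A A F" "c \<in> A" "d \<in> A"
  shows "open (chart_map c ` (chart_dom c \<inter> F -` chart_dom d))"
    and "Ck_on k (chart_map c ` (chart_dom c \<inter> F -` chart_dom d)) (chart_map d \<circ> F \<circ> chart_inv c)"
proof -
  have "open (F -` chart_dom d)"
    using assms chart_open[of d] by (auto simp: smooth_map_def intro: open_vimage)
  then show *: "open (chart_map c ` (chart_dom c \<inter> F -` chart_dom d))"
    by (rule open_chart_image[OF assms(2)])
  show "Ck_on k (chart_map c ` (chart_dom c \<inter> F -` chart_dom d)) (chart_map d \<circ> F \<circ> chart_inv c)"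
    using assms smooth_on_open_iff[OF *, of "chart_map d \<circ> F \<circ> chart_inv c"]
    unfolding smooth_map_def by blast
qed

lemma rep_has_derivative:
  assumes "smooth_map A A F" "c \<in> charts_at A p" "d \<in> charts_at A (F p)"
  shows "((chart_map d \<circ> F \<circ> chart_inv c) has_derivative rep_deriv c d F p) (at (chart_map c p))"
proof -
  have "c \<in> A" "d \<in> A" "chart_map c p \<in> chart_map c ` (chart_dom c \<inter> F -` chart_dom d)"
    using assms(2,3) by (auto simp: charts_at_iff)
  then show ?thesis
    unfolding rep_deriv_def using rep_smooth(2)[OF assms(1), of c d "Suc 0"] Ck_on_has_derivative by blast
qed

lemma rep_deriv_linear:
  assumes "smooth_map A A F" "c \<in> charts_at A p" "d \<in> charts_at A (F p)"
  shows "linear (rep_deriv c d F p)"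
  using rep_has_derivative[OF assms] has_derivative_bounded_linear bounded_linear.linear by blast

text \<open>Here \<open>h\<close> may be a further chart or a real function. Near the point, \<open>h \<circ> F\<close> read in the chart \<open>c\<close>
  factors through any chart \<open>d\<close> around \<open>F p\<close>; away from the overlap of domains the chart maps
  are arbitrary, and therefore only the germ of the composition matters.\<close>

lemma chain_rule_through_chart:
  assumes F: "smooth_map A A F" and c: "c \<in> charts_at A p" and d: "d \<in> charts_at A (F p)"
    and h: "((h \<circ> chart_inv d) has_derivative h') (at (chart_map d (F p)))"
  shows "((h \<circ> F \<circ> chart_inv c) has_derivative (\<lambda>v. h' (rep_deriv c d F p v))) (at (chart_map c p))"
proof -
  have cd: "c \<in> A" "d \<in> A" "p \<in> chart_dom c" "F p \<in> chart_dom d"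
    using c d by (auto simp: charts_at_iff)
  let ?r = "chart_map d \<circ> F \<circ> chart_inv c"
  have r: "?r (chart_map c p) = chart_map d (F p)" by (simp add: chart_inv_map cd)
  have "((\<lambda>z. (h \<circ> chart_inv d) (?r z)) has_derivative (\<lambda>v. h' (rep_deriv c d F p v))) (at (chart_map c p))"
    by (rule has_derivative_compose[OF rep_has_derivative[OF F c d]]) (use h r in \<open>simp only:\<close>)
  then show ?thesis
  proof (rule has_derivative_transform_within_open)
    show "open (chart_map c ` (chart_dom c \<inter> F -` chart_dom d))" by (rule rep_smooth(1)[OF F cd(1,2)])
    show "chart_map c p \<in> chart_map c ` (chart_dom c \<inter> F -` chart_dom d)" using cd by auto
    show "(h \<circ> chart_inv d) (?r z) = (h \<circ> F \<circ> chart_inv c) z"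
      if "z \<in> chart_map c ` (chart_dom c \<inter> F -` chart_dom d)" for z
      using that cd by (auto simp: chart_inv_map)
  qed
qed

lemma rep_deriv_comp:
  assumes F: "smooth_map A A F" and G: "smooth_map A A G"
    and c: "c \<in> charts_at A p" and d: "d \<in> charts_at A (F p)" and e: "e \<in> charts_at A (G (F p))"
  shows "rep_deriv c e (G \<circ> F) p v = rep_deriv d e G (F p) (rep_deriv c d F p v)"
proof -
  have "((chart_map e \<circ> G \<circ> F \<circ> chart_inv c) has_derivative
      (\<lambda>v. rep_deriv d e G (F p) (rep_deriv c d F p v))) (at (chart_map c p))"
    by (rule chain_rule_through_chart[OF F c d rep_has_derivative[OF G d e]])
  from frechet_derivative_at[OF this, symmetric]
  show ?thesis by (simp add: rep_deriv_def comp_assoc)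
qed

lemma rep_deriv_self:
  assumes "c \<in> charts_at A p"
  shows "rep_deriv c c id p v = v"
proof -
  have c: "c \<in> A" "p \<in> chart_dom c" using assms by (auto simp: charts_at_iff)
  have "((chart_map c \<circ> id \<circ> chart_inv c) has_derivative (\<lambda>v. v)) (at (chart_map c p))"
    by (rule has_derivative_transform_within_open[OF has_derivative_ident, of "chart_img c"])
      (use c in \<open>auto simp: chart_open chart_map_in chart_map_inv\<close>)
  from frechet_derivative_at[OF this, symmetric] show ?thesis by (simp add: rep_deriv_def)
qed

lemma tangent_space_iff:
  "v \<in> tangent_space A p \<longleftrightarrow>
    (\<forall>c\<in>charts_at A p. \<forall>d\<in>charts_at A p. v d = rep_deriv c d id p (v c)) \<and>
    (\<forall>c. c \<notin> charts_at A p \<longrightarrow> v c = 0)"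
  unfolding tangent_space_def rep_deriv_def comp_id by simp

lemma coord_vector_eq:
  "coord_vector A c p u = (\<lambda>d. if d \<in> charts_at A p then rep_deriv c d id p u else 0)"
  unfolding coord_vector_def rep_deriv_def comp_id ..

lemma tangent_transition:
  "v \<in> tangent_space A p \<Longrightarrow> c \<in> charts_at A p \<Longrightarrow> d \<in> charts_at A p \<Longrightarrow> v d = rep_deriv c d id p (v c)"
  unfolding tangent_space_iff by blast

lemma tangent_outside: "v \<in> tangent_space A p \<Longrightarrow> d \<notin> charts_at A p \<Longrightarrow> v d = 0"
  unfolding tangent_space_iff by blast

lemma transition_comp:
  assumes "c \<in> charts_at A p" "d \<in> charts_at A p" "e \<in> charts_at A p"
  shows "rep_deriv d e id p (rep_deriv c d id p v) = rep_deriv c e id p v"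
  using rep_deriv_comp[OF smooth_map_id smooth_map_id, of c p d e v] assms by simp

lemma coord_vector_tangent: "c \<in> charts_at A p \<Longrightarrow> coord_vector A c p u \<in> tangent_space A p"
  by (auto simp: tangent_space_iff coord_vector_eq transition_comp)

lemma coord_vector_self: "c \<in> charts_at A p \<Longrightarrow> coord_vector A c p u c = u"
  by (simp add: coord_vector_eq rep_deriv_self)

lemma tangent_eqI:
  assumes "v \<in> tangent_space A p" "w \<in> tangent_space A p" "c \<in> charts_at A p" "v c = w c"
  shows "v = w"
proof
  fix d
  show "v d = w d"
    using assms by (cases "d \<in> charts_at A p") (metis tangent_transition, simp add: tangent_outside)
qed

lemma coord_vector_tangent_self:
  assumes "v \<in> tangent_space A p" "c \<in> charts_at A p"
  shows "coord_vector A c p (v c) = v"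
  using assms by (intro tangent_eqI[of _ p _ c]) (auto simp: coord_vector_tangent coord_vector_self)

lemma tangent_lincomb:
  assumes "u \<in> tangent_space A p" "v \<in> tangent_space A p"
  shows "(\<lambda>c. a *\<^sub>R u c + b *\<^sub>R v c) \<in> tangent_space A p"
proof -
  have "a *\<^sub>R u d + b *\<^sub>R v d = rep_deriv c d id p (a *\<^sub>R u c + b *\<^sub>R v c)"
    if "c \<in> charts_at A p" "d \<in> charts_at A p" for c d
    using rep_deriv_linear[OF smooth_map_id that(1), of d] that tangent_transition[OF _ that] assms
    by (simp add: linear_add linear_scale)
  moreover have "a *\<^sub>R u c + b *\<^sub>R v c = 0" if "c \<notin> charts_at A p" for c
    using that assms by (simp add: tangent_outside)
  ultimately show ?thesis unfolding tangent_space_iff by blast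
qed

lemma coord_vector_lincomb:
  assumes "c \<in> charts_at A p"
  shows "coord_vector A c p (a *\<^sub>R u + b *\<^sub>R v)
    = (\<lambda>d. a *\<^sub>R coord_vector A c p u d + b *\<^sub>R coord_vector A c p v d)"
  by (rule tangent_eqI[OF _ _ assms])
    (simp_all add: coord_vector_tangent tangent_lincomb assms coord_vector_self)

text \<open>Independence of the chart chosen in the definition of \<^const>\<open>map_differential\<close>.\<close>

lemma map_differential_coord:
  assumes F: "smooth_map A A F" and v: "v \<in> tangent_space A p"
    and c: "c \<in> charts_at A p" and d: "d \<in> charts_at A (F p)"
  shows "map_differential A A F p v d = rep_deriv c d F p (v c)"
proof -
  define c0 where "c0 = (SOME c. c \<in> charts_at A p)"
  have c0: "c0 \<in> charts_at A p" unfolding c0_def by (rule some_chart)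
  have "map_differential A A F p v d = rep_deriv c0 d F p (v c0)"
    using d by (simp add: map_differential_def rep_deriv_def c0_def Let_def)
  also have "v c0 = rep_deriv c c0 id p (v c)" by (rule tangent_transition[OF v c c0])
  also have "rep_deriv c0 d F p (rep_deriv c c0 id p (v c)) = rep_deriv c d F p (v c)"
    using rep_deriv_comp[OF smooth_map_id F c, of c0 d] c0 d by simp
  finally show ?thesis .
qed

lemma map_differential_tangent:
  assumes F: "smooth_map A A F" and v: "v \<in> tangent_space A p"
  shows "map_differential A A F p v \<in> tangent_space A (F p)"
proof -
  obtain c where c: "c \<in> charts_at A p" using charts_at_nonempty by blast
  have *: "map_differential A A F p v d2 = rep_deriv d1 d2 id (F p) (map_differential A A F p v d1)"
    if "d1 \<in> charts_at A (F p)" "d2 \<in> charts_at A (F p)" for d1 d2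
    using rep_deriv_comp[OF F smooth_map_id c that(1), of d2] that
    by (simp add: map_differential_coord[OF F v c])
  have "map_differential A A F p v d = 0" if "d \<notin> charts_at A (F p)" for d
    using that by (simp add: map_differential_def)
  with * show ?thesis unfolding tangent_space_iff by blast
qed

lemma map_differential_involution:
  assumes F: "smooth_map A A F" and inv: "F \<circ> F = id" and v: "v \<in> tangent_space A p"
  shows "map_differential A A F (F p) (map_differential A A F p v) = v"
proof -
  obtain c where c: "c \<in> charts_at A p" using charts_at_nonempty by blast
  obtain d where d: "d \<in> charts_at A (F p)" using charts_at_nonempty by blast
  have p: "F (F p) = p" using inv by (metis comp_apply id_apply)
  have t: "map_differential A A F p v \<in> tangent_space A (F p)"
    by (rule map_differential_tangent[OF F v])
  have "map_differential A A F (F p) (map_differential A A F p v) c = v c"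
    using rep_deriv_comp[OF F F c d, of c] c
    by (simp add: map_differential_coord[OF F t d] map_differential_coord[OF F v c d] p inv rep_deriv_self)
  then show ?thesis
    using map_differential_tangent[OF F t] v c p by (intro tangent_eqI[of _ p _ c]) auto
qed

text \<open>The differential of a function is meaningful only if the function is differentiable in the
  charts around the point; this is asked of all charts so that no choice enters.\<close>

definition differentiable_fun :: "('a \<Rightarrow> real) \<Rightarrow> 'a \<Rightarrow> bool" where
  "differentiable_fun f p \<longleftrightarrow>
     (\<forall>c\<in>charts_at A p. (f \<circ> chart_inv c) differentiable (at (chart_map c p)))"

lemma fun_differential_comp:
  assumes F: "smooth_map A A F" and f: "differentiable_fun f (F p)"
  shows "differentiable_fun (f \<circ> F) p"
    and "c \<in> charts_at A p \<Longrightarrow> d \<in> charts_at A (F p) \<Longrightarrow>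
      frechet_derivative (f \<circ> F \<circ> chart_inv c) (at (chart_map c p)) u
      = frechet_derivative (f \<circ> chart_inv d) (at (chart_map d (F p))) (rep_deriv c d F p u)"
proof -
  have *: "((f \<circ> F \<circ> chart_inv c) has_derivative
     (\<lambda>u. frechet_derivative (f \<circ> chart_inv d) (at (chart_map d (F p))) (rep_deriv c d F p u))) (at (chart_map c p))"
    if "c \<in> charts_at A p" "d \<in> charts_at A (F p)" for c d
    by (rule chain_rule_through_chart[OF F that])
      (use f that(2) in \<open>simp only: differentiable_fun_def frechet_derivative_works\<close>)
  show "differentiable_fun (f \<circ> F) p"
    unfolding differentiable_fun_def using * charts_at_nonempty[of "F p"] differentiableI by blast
  show "c \<in> charts_at A p \<Longrightarrow> d \<in> charts_at A (F p) \<Longrightarrow>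
      frechet_derivative (f \<circ> F \<circ> chart_inv c) (at (chart_map c p)) u
      = frechet_derivative (f \<circ> chart_inv d) (at (chart_map d (F p))) (rep_deriv c d F p u)"
    by (simp only: frechet_derivative_at[OF *, of c d, symmetric])
qed

text \<open>Independence of the chart chosen in the definition of \<^const>\<open>fun_differential\<close>.\<close>

lemma fun_differential_coord:
  assumes f: "differentiable_fun f p" and v: "v \<in> tangent_space A p" and c: "c \<in> charts_at A p"
  shows "fun_differential A f p v = frechet_derivative (f \<circ> chart_inv c) (at (chart_map c p)) (v c)"
proof -
  define c0 where "c0 = (SOME c. c \<in> charts_at A p)"
  have c0: "c0 \<in> charts_at A p" unfolding c0_def by (rule some_chart)
  have "fun_differential A f p v = frechet_derivative (f \<circ> chart_inv c0) (at (chart_map c0 p)) (v c0)"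
    by (simp add: fun_differential_def c0_def Let_def)
  also have "v c0 = rep_deriv c c0 id p (v c)" by (rule tangent_transition[OF v c c0])
  also have "frechet_derivative (f \<circ> chart_inv c0) (at (chart_map c0 p)) \<dots>
      = frechet_derivative (f \<circ> chart_inv c) (at (chart_map c p)) (v c)"
    using fun_differential_comp(2)[OF smooth_map_id, of f p c c0 "v c"] f c c0 by simp
  finally show ?thesis .
qed

lemma fun_differential_map:
  assumes F: "smooth_map A A F" and f: "differentiable_fun f (F p)" and v: "v \<in> tangent_space A p"
  shows "fun_differential A (f \<circ> F) p v = fun_differential A f (F p) (map_differential A A F p v)"
proof -
  obtain c where c: "c \<in> charts_at A p" using charts_at_nonempty by blast
  obtain d where d: "d \<in> charts_at A (F p)" using charts_at_nonempty by blast
  show ?thesis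
    by (simp add: fun_differential_coord[OF fun_differential_comp(1)[OF F f] v c]
        fun_differential_coord[OF f map_differential_tangent[OF F v] d]
        map_differential_coord[OF F v c d] fun_differential_comp(2)[OF F f c d])
qed

lemma fun_differential_scale:
  assumes f: "differentiable_fun f p" and v: "v \<in> tangent_space A p"
  shows "differentiable_fun (\<lambda>x. a * f x) p"
    and "fun_differential A (\<lambda>x. a * f x) p v = a * fun_differential A f p v"
proof -
  have *: "(((\<lambda>x. a * f x) \<circ> chart_inv c) has_derivative
     (\<lambda>u. a * frechet_derivative (f \<circ> chart_inv c) (at (chart_map c p)) u)) (at (chart_map c p))"
    if "c \<in> charts_at A p" for c
    using has_derivative_mult_right[of "f \<circ> chart_inv c" _ _ a] f that
    by (auto simp: differentiable_fun_def frechet_derivative_works comp_def)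
  then show d: "differentiable_fun (\<lambda>x. a * f x) p"
    unfolding differentiable_fun_def using differentiableI by blast
  obtain c where c: "c \<in> charts_at A p" using charts_at_nonempty by blast
  show "fun_differential A (\<lambda>x. a * f x) p v = a * fun_differential A f p v"
    using frechet_derivative_at[OF *[OF c]]
    by (simp add: fun_differential_coord[OF f v c] fun_differential_coord[OF d v c] fun_eq_iff)
qed

end

section \<open>Ordinary differential equations on manifolds\<close>

text \<open>Picard iteration on the Banach space of bounded continuous functions on the whole line. To have
  a contraction defined everywhere, time is clamped to \<open>{a..b}\<close> and the space variable is
  retracted to the ball by the closest point map, which does not increase distances. The
  bound \<open>B * (b - a) \<le> r / 2\<close> keeps the fixed point inside the ball, where the retraction is
  the identity. The initial value may be any point of the ball of half the radius, so that the
  length of the time interval is uniform over a neighbourhood of the centre.\<close>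

lemma picard_lindelof:
  fixes f :: "real \<Rightarrow> 'e::euclidean_space \<Rightarrow> 'e"
  assumes ab: "a \<le> b" and r: "0 < r"
    and lip: "L-lipschitz_on ({a..b} \<times> cball z0 r) (\<lambda>(t, z). f t z)"
    and B: "\<And>t z. t \<in> {a..b} \<Longrightarrow> z \<in> cball z0 r \<Longrightarrow> norm (f t z) \<le> B"
    and z1: "z1 \<in> cball z0 (r / 2)" and Bab: "B * (b - a) \<le> r / 2" and Lab: "L * (b - a) < 1"
  shows "\<exists>u. u a = z1 \<and> (\<forall>t\<in>{a..b}. u t \<in> cball z0 r \<and>
    (u has_vector_derivative f t (u t)) (at t within {a..b}))"
proof -
  let ?C = "cball z0 r"
  define F where "F t z = f t (closest_point ?C z)" for t z
  define cl where "cl t = max a (min b t)" for t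
  define I where "I u t = z1 + integral {a..cl t} (\<lambda>s. F s (u s))" for u t
  have cl: "cl t \<in> {a..b}" for t using ab by (auto simp: cl_def)
  have cl_id: "cl t = t" if "t \<in> {a..b}" for t using that by (auto simp: cl_def)
  have C: "convex ?C" "closed ?C" "?C \<noteq> {}" using r by auto
  have cp: "closest_point ?C z \<in> ?C" for z using C by (intro closest_point_in_set)
  have L0: "0 \<le> L" using lip by (rule lipschitz_on_nonneg)
  have FL: "norm (F t x - F t y) \<le> L * norm (x - y)" if "t \<in> {a..b}" for t x y
  proof -
    have "dist (f t (closest_point ?C x)) (f t (closest_point ?C y))
        \<le> L * dist (t, closest_point ?C x) (t, closest_point ?C y)"
      using lipschitz_onD[OF lip, of "(t, closest_point ?C x)" "(t, closest_point ?C y)"] that cp by simp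
    also have "\<dots> \<le> L * dist x y"
      using closest_point_lipschitz[OF C, of x y] L0 by (simp add: dist_Pair_Pair mult_left_mono)
    finally show ?thesis by (simp add: F_def dist_norm)
  qed
  have FB: "norm (F t x) \<le> B" if "t \<in> {a..b}" for t x
    using B[OF that cp] by (simp add: F_def)
  have FC: "continuous_on {a..b} (\<lambda>s. F s (u s))" if "continuous_on UNIV u" for u
  proof -
    have "continuous_on {a..b} (\<lambda>s. (s, closest_point ?C (u s)))"
      by (intro continuous_on_Pair continuous_on_id
          continuous_on_compose2[OF continuous_on_closest_point[OF C, of UNIV]]
          continuous_on_subset[OF that]) auto
    then have "continuous_on {a..b} (\<lambda>s. (\<lambda>(t, z). f t z) (s, closest_point ?C (u s)))"
      by (rule continuous_on_compose2[OF lipschitz_on_continuous_on[OF lip]]) (use cp in auto)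
    then show ?thesis by (simp add: F_def)
  qed
  have contI: "continuous_on {a..b} (\<lambda>t. z1 + integral {a..t} (\<lambda>s. F s (u s)))"
    if "continuous_on UNIV u" for u
    by (intro continuous_on_add continuous_on_const indefinite_integral_continuous_1
        integrable_continuous_real FC that)
  have I_bcont: "I (apply_bcontfun u) \<in> bcontfun" for u
  proof -
    have u: "continuous_on UNIV (apply_bcontfun u)" by simp
    have "continuous_on UNIV cl" unfolding cl_def by (intro continuous_intros)
    then have "continuous_on UNIV (I (apply_bcontfun u))"
      unfolding I_def by (intro continuous_on_compose2[OF contI[OF u]]) (use cl in auto)
    moreover have "range (I (apply_bcontfun u))
        \<subseteq> (\<lambda>t. z1 + integral {a..t} (\<lambda>s. F s (apply_bcontfun u s))) ` {a..b}"
      using cl by (auto simp: I_def)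
    then have "bounded (range (I (apply_bcontfun u)))"
      using compact_imp_bounded[OF compact_continuous_image[OF contI[OF u]]] bounded_subset by blast
    ultimately show ?thesis by (simp add: bcontfun_def)
  qed
  define P where "P u = Bcontfun (I (apply_bcontfun u))" for u :: "real \<Rightarrow>\<^sub>C 'e"
  have P: "apply_bcontfun (P u) = I (apply_bcontfun u)" for u
    unfolding P_def by (rule Bcontfun_inverse[OF I_bcont])
  have "dist (P u) (P v) \<le> (L * (b - a)) * dist u v" for u v
  proof (rule dist_bound)
    fix t
    let ?u = "\<lambda>s. F s (apply_bcontfun u s)" and ?v = "\<lambda>s. F s (apply_bcontfun v s)"
    have sub: "{a..cl t} \<subseteq> {a..b}" and le: "a \<le> cl t" using cl[of t] by auto
    have c: "continuous_on {a..cl t} ?u" "continuous_on {a..cl t} ?v"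
      using FC[of "apply_bcontfun u"] FC[of "apply_bcontfun v"] sub
      by (auto intro: continuous_on_subset)
    have "apply_bcontfun (P u) t - apply_bcontfun (P v) t = integral {a..cl t} (\<lambda>s. ?u s - ?v s)"
      using c by (simp add: P I_def Henstock_Kurzweil_Integration.integral_diff integrable_continuous_real)
    also have "norm \<dots> \<le> (L * dist u v) * (cl t - a)"
    proof (rule integral_bound[OF le])
      show "continuous_on {a..cl t} (\<lambda>s. ?u s - ?v s)" by (intro continuous_on_diff c)
      show "norm (?u s - ?v s) \<le> L * dist u v" if "s \<in> {a..cl t}" for s
      proof -
        have "norm (?u s - ?v s) \<le> L * dist (apply_bcontfun u s) (apply_bcontfun v s)"
          using FL sub that by (auto simp: dist_norm)
        also have "\<dots> \<le> L * dist u v" by (intro mult_left_mono dist_bounded L0)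
        finally show ?thesis .
      qed
    qed
    also have "\<dots> \<le> (L * dist u v) * (b - a)"
      using cl[of t] L0 by (intro mult_left_mono) auto
    finally show "dist (apply_bcontfun (P u) t) (apply_bcontfun (P v) t) \<le> (L * (b - a)) * dist u v"
      by (simp add: dist_norm mult_ac)
  qed
  then obtain u where "P u = u"
    using banach_fix_type[of "L * (b - a)" P] L0 ab Lab by auto
  then have u: "apply_bcontfun u t = I (apply_bcontfun u) t" for t using P by metis
  let ?u = "apply_bcontfun u"
  have uC: "continuous_on {a..b} (\<lambda>s. F s (?u s))" by (rule FC) simp
  have near: "?u t \<in> cball z0 r" if "t \<in> {a..b}" for t
  proof -
    have "norm (integral {a..t} (\<lambda>s. F s (?u s))) \<le> B * (t - a)"
      using that FB by (intro integral_bound continuous_on_subset[OF uC]) auto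
    moreover have "B * (t - a) \<le> B * (b - a)"
      using that order_trans[OF norm_ge_zero FB[OF that, of z0]] by (intro mult_left_mono) auto
    ultimately have "norm (?u t - z1) \<le> r / 2"
      using Bab u[of t] by (simp add: I_def cl_id[OF that])
    then show ?thesis using z1 dist_triangle[of z0 "?u t" z1] by (simp add: dist_norm norm_minus_commute)
  qed
  have der: "(?u has_vector_derivative f t (?u t)) (at t within {a..b})" if t: "t \<in> {a..b}" for t
  proof -
    have "((\<lambda>t. z1 + integral {a..t} (\<lambda>s. F s (?u s))) has_vector_derivative (0 + F t (?u t)))
        (at t within {a..b})"
      by (rule has_vector_derivative_add[OF has_vector_derivative_const
            integral_has_vector_derivative[OF uC t]])
    then have 1: "((\<lambda>t. z1 + integral {a..t} (\<lambda>s. F s (?u s))) has_vector_derivative F t (?u t)) (at t within {a..b})"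
      by (simp only: add_0)
    have 2: "?u s = z1 + integral {a..s} (\<lambda>s. F s (?u s))" if "s \<in> {a..b}" for s
      using u[of s] by (simp only: I_def cl_id[OF that])
    have "(?u has_vector_derivative F t (?u t)) (at t within {a..b})"
      by (rule has_vector_derivative_transform[OF t 2 1])
    then show ?thesis by (simp only: F_def closest_point_self[OF near[OF t]])
  qed
  have "cl a = a" using ab by (intro cl_id) simp
  have "?u a = z1 + integral {a..a} (\<lambda>s. F s (?u s))"
    using u[of a] by (simp only: I_def \<open>cl a = a\<close>)
  also have "\<dots> = z1" by simp
  finally have "?u a = z1" .
  then show ?thesis by (intro exI[of _ ?u] conjI ballI near der)
qed

text \<open>On so short a segment the mean value inequality bounds the maximum of \<open>norm g\<close> by half of
  itself. It is the short time version of a Gronwall estimate,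
  in both time directions at once.\<close>

lemma linear_growth_zero:
  fixes g :: "real \<Rightarrow> 'e::real_normed_vector"
  assumes der: "\<And>t. t \<in> closed_segment a b \<Longrightarrow> (g has_vector_derivative g' t) (at t within closed_segment a b)"
    and bound: "\<And>t. t \<in> closed_segment a b \<Longrightarrow> norm (g' t) \<le> L * norm (g t)"
    and "0 \<le> L" "L * \<bar>b - a\<bar> \<le> 1 / 2" "g a = 0"
  shows "g b = 0"
proof -
  let ?J = "closed_segment a b"
  have "continuous_on ?J g"
    unfolding continuous_on_eq_continuous_within
    by (intro ballI has_vector_derivative_continuous[OF der])
  then have "continuous_on ?J (\<lambda>t. norm (g t))" by (intro continuous_intros)
  moreover have "?J \<noteq> {}" by (metis ends_in_segment(1) empty_iff)
  ultimately have "\<exists>s\<in>?J. \<forall>t\<in>?J. norm (g t) \<le> norm (g s)"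
    by (intro continuous_attains_sup compact_segment)
  then obtain s where s: "s \<in> ?J" "\<And>t. t \<in> ?J \<Longrightarrow> norm (g t) \<le> norm (g s)"
    by blast
  have "norm (g s - g a) \<le> (L * norm (g s)) * norm (s - a)"
  proof (rule differentiable_bound[of ?J g "\<lambda>t h. h *\<^sub>R g' t"])
    show "(g has_derivative (\<lambda>h. h *\<^sub>R g' t)) (at t within ?J)" if "t \<in> ?J" for t
      using der[OF that] by (simp add: has_vector_derivative_def)
    show "onorm (\<lambda>h. h *\<^sub>R g' t) \<le> L * norm (g s)" if "t \<in> ?J" for t
    proof -
      have "norm (g' t) \<le> L * norm (g s)"
        using bound[OF that] s(2)[OF that] \<open>0 \<le> L\<close> by (meson mult_left_mono order_trans)
      then show ?thesis
        by (intro onorm_le) (simp add: mult.commute[of "L * norm (g s)"] mult_left_mono)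
    qed
  qed (use s in auto)
  also have "\<dots> = (L * norm (s - a)) * norm (g s)" by simp
  also have "\<dots> \<le> (1 / 2) * norm (g s)"
  proof (rule mult_right_mono)
    have "norm (s - a) \<le> norm (b - a)" using s(1) segment_bound1 by blast
    then show "L * norm (s - a) \<le> 1 / 2"
      using assms(3,4) by (metis mult_left_mono order_trans real_norm_def)
  qed simp
  finally have "norm (g s) = 0" using assms(5) by simp
  then show ?thesis using s(2)[of b] by simp
qed

context smooth_manifold
begin

lemma map_differential_id: "v \<in> tangent_space A p \<Longrightarrow> map_differential A A id p v = v"
proof -
  assume v: "v \<in> tangent_space A p"
  obtain c where c: "c \<in> charts_at A p" using charts_at_nonempty by blast
  show ?thesis
    using map_differential_tangent[OF smooth_map_id v] v c
      map_differential_coord[OF smooth_map_id v c, of c]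
    by (intro tangent_eqI[of _ p _ c]) (auto simp: rep_deriv_self)
qed

lemma curve_derivative_map:
  assumes F: "smooth_map A A F" and cont: "continuous_on T \<gamma>" and t: "t \<in> T"
    and c: "c \<in> charts_at A (\<gamma> t)" and d: "d \<in> charts_at A (F (\<gamma> t))"
    and v: "v \<in> tangent_space A (\<gamma> t)"
    and der: "((\<lambda>s. chart_map c (\<gamma> s)) has_vector_derivative v c) (at t within T)"
  shows "((\<lambda>s. chart_map d (F (\<gamma> s))) has_vector_derivative map_differential A A F (\<gamma> t) v d) (at t within T)"
proof -
  have cA: "c \<in> A" "\<gamma> t \<in> chart_dom c" using c by (auto simp: charts_at_iff)
  interpret bounded_linear "rep_deriv c d F (\<gamma> t)"
    using rep_has_derivative[OF F c d] by (rule has_derivative_bounded_linear)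
  have "((\<lambda>s. (chart_map d \<circ> F \<circ> chart_inv c) (chart_map c (\<gamma> s))) has_derivative
      (\<lambda>h. rep_deriv c d F (\<gamma> t) (h *\<^sub>R v c))) (at t within T)"
    by (rule has_derivative_compose[OF der[unfolded has_vector_derivative_def] rep_has_derivative[OF F c d]])
  then have *: "((\<lambda>s. (chart_map d \<circ> F \<circ> chart_inv c) (chart_map c (\<gamma> s))) has_vector_derivative
      map_differential A A F (\<gamma> t) v d) (at t within T)"
    by (simp add: has_vector_derivative_def scaleR map_differential_coord[OF F v c d])
  have "\<forall>\<^sub>F s in at t within T. \<gamma> s \<in> chart_dom c"
    using cont t cA chart_open[OF cA(1)] topological_tendstoD
    by (fastforce simp: continuous_on_def)
  then have "\<forall>\<^sub>F s in at t within T. (chart_map d \<circ> F \<circ> chart_inv c) (chart_map c (\<gamma> s)) = chart_map d (F (\<gamma> s))"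
    by (rule eventually_mono) (simp add: chart_inv_map cA)
  with * show ?thesis unfolding has_vector_derivative_def
    by (rule has_derivative_transform_eventually) (use t cA in \<open>simp_all add: chart_inv_map\<close>)
qed

text \<open>Since the field consists of tangent vectors, the equation in one chart implies it in all the
  others.\<close>

lemma solves_odeI:
  assumes "continuous_on T \<gamma>" "\<And>t. t \<in> T \<Longrightarrow> X t (\<gamma> t) \<in> tangent_space A (\<gamma> t)"
    and "\<And>t. t \<in> T \<Longrightarrow> \<exists>c\<in>charts_at A (\<gamma> t).
      ((\<lambda>s. chart_map c (\<gamma> s)) has_vector_derivative X t (\<gamma> t) c) (at t within T)"
  shows "solves_ode A X T \<gamma>"
  unfolding solves_ode_def
proof (intro conjI ballI assms(1))
  fix t d assume t: "t \<in> T" and d: "d \<in> charts_at A (\<gamma> t)"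
  obtain c where c: "c \<in> charts_at A (\<gamma> t)"
    "((\<lambda>s. chart_map c (\<gamma> s)) has_vector_derivative X t (\<gamma> t) c) (at t within T)"
    using assms(3)[OF t] by blast
  show "((\<lambda>s. chart_map d (\<gamma> s)) has_vector_derivative X t (\<gamma> t) d) (at t within T)"
    using curve_derivative_map[OF smooth_map_id assms(1) t c(1) _ assms(2)[OF t] c(2), of d] d
    by (simp add: map_differential_id[OF assms(2)[OF t]])
qed

text \<open>When \<open>F\<close> is the involution, the relation between the two fields expresses that it is
  antisymplectic.\<close>

lemma solves_ode_map:
  assumes F: "smooth_map A A F" and sol: "solves_ode A X T \<gamma>"
    and X: "\<And>t. t \<in> T \<Longrightarrow> X t (\<gamma> t) \<in> tangent_space A (\<gamma> t)"
    and Y: "\<And>t. t \<in> T \<Longrightarrow> Y t (F (\<gamma> t)) = map_differential A A F (\<gamma> t) (X t (\<gamma> t))"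
  shows "solves_ode A Y T (\<lambda>t. F (\<gamma> t))"
  unfolding solves_ode_def
proof (intro conjI ballI)
  have cont: "continuous_on T \<gamma>" using sol by (simp add: solves_ode_def)
  then show "continuous_on T (\<lambda>t. F (\<gamma> t))"
    using F by (auto simp: smooth_map_def intro: continuous_on_compose2)
  fix t d assume t: "t \<in> T" and d: "d \<in> charts_at A (F (\<gamma> t))"
  obtain c where c: "c \<in> charts_at A (\<gamma> t)" using charts_at_nonempty by blast
  show "((\<lambda>s. chart_map d (F (\<gamma> s))) has_vector_derivative Y t (F (\<gamma> t)) d) (at t within T)"
    using curve_derivative_map[OF F cont t c d X[OF t]] sol c t by (simp add: solves_ode_def Y)
qed

end

lemma solves_ode_subset: "solves_ode A X T \<gamma> \<Longrightarrow> S \<subseteq> T \<Longrightarrow> solves_ode A X S \<gamma>"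
  unfolding solves_ode_def
  by (meson continuous_on_subset has_vector_derivative_within_subset subsetD)

lemma solves_ode_cong:
  assumes "solves_ode A X T \<gamma>" "\<And>t. t \<in> T \<Longrightarrow> \<gamma>' t = \<gamma> t" "\<And>t p. t \<in> T \<Longrightarrow> X' t p = X t p"
  shows "solves_ode A X' T \<gamma>'"
  unfolding solves_ode_def
proof (intro conjI ballI)
  show "continuous_on T \<gamma>'"
    using assms(1,2) continuous_on_cong[of T T \<gamma>' \<gamma>] by (simp add: solves_ode_def)
  fix t c assume t: "t \<in> T" and c: "c \<in> charts_at A (\<gamma>' t)"
  have "((\<lambda>s. chart_map c (\<gamma> s)) has_vector_derivative X t (\<gamma> t) c) (at t within T)"
    using assms t c by (simp add: solves_ode_def)
  then show "((\<lambda>s. chart_map c (\<gamma>' s)) has_vector_derivative X' t (\<gamma>' t) c) (at t within T)"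
    by (intro has_vector_derivative_transform[OF t, of "\<lambda>s. chart_map c (\<gamma>' s)" "\<lambda>s. chart_map c (\<gamma> s)"])
      (use assms t in auto)
qed

text \<open>With \<open>\<theta>\<close> a translation, a dilation or a reflection this gives the usual operations on solutions;
  with \<open>\<theta>\<close> a cutoff it slows a solution down to rest.\<close>

lemma solves_ode_reparam:
  assumes sol: "solves_ode A X T \<gamma>" and "\<And>s. s \<in> S \<Longrightarrow> \<theta> s \<in> T"
    and der: "\<And>s. s \<in> S \<Longrightarrow> (\<theta> has_real_derivative \<theta>' s) (at s within S)"
  shows "solves_ode A (\<lambda>s p c. \<theta>' s *\<^sub>R X (\<theta> s) p c) S (\<lambda>s. \<gamma> (\<theta> s))"
  unfolding solves_ode_def
proof (intro conjI ballI)
  have "continuous_on S \<theta>" using der by (rule DERIV_continuous_on)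
  then show "continuous_on S (\<lambda>s. \<gamma> (\<theta> s))"
    using sol assms(2) by (auto simp: solves_ode_def intro: continuous_on_compose2)
  fix s c assume s: "s \<in> S" and c: "c \<in> charts_at A (\<gamma> (\<theta> s))"
  have "((\<lambda>t. chart_map c (\<gamma> t)) has_vector_derivative X (\<theta> s) (\<gamma> (\<theta> s)) c) (at (\<theta> s) within \<theta> ` S)"
    using sol s c assms(2) unfolding solves_ode_def
    by (meson has_vector_derivative_within_subset image_subsetI)
  then show "((\<lambda>s. chart_map c (\<gamma> (\<theta> s))) has_vector_derivative \<theta>' s *\<^sub>R X (\<theta> s) (\<gamma> (\<theta> s)) c) (at s within S)"
    using vector_diff_chain_within[OF der[OF s, unfolded has_real_derivative_iff_has_vector_derivative]]
    by (simp add: comp_def)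
qed

text \<open>Gluing. At a common point the two one-sided derivatives agree because both are the value of
  the field; every other point of the union has a neighbourhood that meets only one of the sets.\<close>

lemma solves_ode_Un:
  assumes "closed S" "closed T" "solves_ode A X S \<gamma>" "solves_ode A X T \<gamma>"
  shows "solves_ode A X (S \<union> T) \<gamma>"
proof -
  have loc: "at t within (S \<union> T) = at t within S" if "closed T" "t \<notin> T" for t S T
    by (rule at_within_nhd[of t "- T"]) (use that in auto)
  have *: "(f has_vector_derivative y) (at t within (S \<union> T))"
    if t: "t \<in> S \<union> T" and "t \<in> S \<Longrightarrow> (f has_vector_derivative y) (at t within S)"
      "t \<in> T \<Longrightarrow> (f has_vector_derivative y) (at t within T)" for f :: "real \<Rightarrow> 'b" and y t
  proof -
    consider "t \<in> S" "t \<in> T" | "t \<in> S" "t \<notin> T" | "t \<notin> S" "t \<in> T" using t by blast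
    then show ?thesis
    proof cases
      case 1
      then show ?thesis using that
        by (auto simp: has_vector_derivative_def has_derivative_within Lim_within_Un)
    next
      case 2
      then show ?thesis using that loc[OF assms(2), of t S] by simp
    next
      case 3
      then show ?thesis using that loc[OF assms(1), of t T] by (simp add: Un_commute)
    qed
  qed
  show ?thesis
    using assms unfolding solves_ode_def by (auto intro!: continuous_on_closed_Un *)
qed

text \<open>The pieces of a symmetric periodic orbit are indexed by the intervals between consecutive
  half-integers; each real number is interior to the union of two neighbouring ones.\<close>

lemma solves_ode_half_intervals:
  assumes "\<And>k::int. solves_ode A X {of_int k / 2..(of_int k + 1) / 2} \<gamma>"
  shows "solves_ode A X UNIV \<gamma>"
proof -
  have ex: "\<exists>U. open U \<and> t \<in> U \<and> solves_ode A X U \<gamma>" for t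
  proof -
    define k where "k = \<lfloor>2 * t\<rfloor>"
    have k: "of_int k \<le> 2 * t" "2 * t < of_int k + 1" unfolding k_def by linarith+
    have "solves_ode A X ({of_int (k - 1) / 2..(of_int (k - 1) + 1) / 2} \<union> {of_int k / 2..(of_int k + 1) / 2}) \<gamma>"
      by (rule solves_ode_Un[OF closed_atLeastAtMost closed_atLeastAtMost assms assms])
    moreover have "{(of_int k - 1) / 2<..<(of_int k + 1) / 2} \<subseteq>
        {of_int (k - 1) / 2..(of_int (k - 1) + 1) / 2} \<union> {of_int k / 2..(of_int k + 1) / (2::real)}"
      by (auto simp: field_simps)
    ultimately have "solves_ode A X {(of_int k - 1) / 2<..<(of_int k + 1) / 2} \<gamma>"
      by (rule solves_ode_subset)
    moreover have "t \<in> {(of_int k - 1) / 2<..<(of_int k + 1) / 2}" using k by simp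
    ultimately show ?thesis using open_greaterThanLessThan by blast
  qed
  show ?thesis
    unfolding solves_ode_def
  proof (intro conjI ballI)
    show "continuous_on UNIV \<gamma>"
      using ex by (intro continuous_at_imp_continuous_on ballI)
        (metis continuous_on_eq_continuous_at solves_ode_def)
    fix t c assume "c \<in> charts_at A (\<gamma> t)"
    then show "((\<lambda>s. chart_map c (\<gamma> s)) has_vector_derivative X t (\<gamma> t) c) (at t)"
      using ex[of t] by (metis at_within_open solves_ode_def)
  qed
qed


text \<open>Joint Lipschitz continuity in time and space, in charts, combines continuity, local boundedness
  and the Lipschitz condition in space, and the field of a smooth Hamiltonian has it. The
  estimate is relative to \<open>T\<close>, so that Hamiltonians given for times in \<open>{0..1}\<close> are included.\<close>

definition locally_lipschitz_field ::
    "('a::topological_space, 'e::euclidean_space) chart set \<Rightarrow> real set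
      \<Rightarrow> (real \<Rightarrow> 'a \<Rightarrow> ('a, 'e) tangent) \<Rightarrow> bool"
where
  "locally_lipschitz_field A T X \<longleftrightarrow>
     (\<forall>t\<in>T. \<forall>p. X t p \<in> tangent_space A p) \<and>
     (\<forall>t0\<in>T. \<forall>p. \<forall>c\<in>charts_at A p. \<exists>e>0. \<exists>L.
        cball (chart_map c p) e \<subseteq> chart_img c \<and>
        L-lipschitz_on ((T \<inter> cball t0 e) \<times> cball (chart_map c p) e) (\<lambda>(t, z). X t (chart_inv c z) c))"

context smooth_manifold
begin

lemma solution_unique_locally:
  assumes X: "locally_lipschitz_field A T X" and S: "S \<subseteq> T" "convex S"
    and sol: "solves_ode A X S \<gamma>" "solves_ode A X S \<eta>"
    and t0: "t0 \<in> S" "\<gamma> t0 = \<eta> t0"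
  shows "\<exists>e>0. \<forall>t\<in>S. dist t t0 < e \<longrightarrow> \<gamma> t = \<eta> t"
proof -
  define p where "p = \<gamma> t0"
  obtain c where c: "c \<in> charts_at A p" using charts_at_nonempty by blast
  then have cA: "c \<in> A" "p \<in> chart_dom c" by (auto simp: charts_at_iff)
  obtain e L where e: "e > 0" and
    L: "L-lipschitz_on ((T \<inter> cball t0 e) \<times> cball (chart_map c p) e) (\<lambda>(t, z). X t (chart_inv c z) c)"
    using X t0(1) S(1) c unfolding locally_lipschitz_field_def by (meson subsetD)
  have L0: "0 \<le> L" using L by (rule lipschitz_on_nonneg)
  define V where "V = chart_dom c \<inter> chart_map c -` ball (chart_map c p) e"
  have "open V"
    unfolding V_def Int_commute[of "chart_dom c"]
    using continuous_on_chart_map[OF cA(1)] chart_open[OF cA(1)]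
    by (metis continuous_on_open_vimage open_ball)
  have pV: "p \<in> V" using cA e by (simp add: V_def)
  have near: "\<exists>\<delta>>0. \<forall>t\<in>S. dist t t0 < \<delta> \<longrightarrow> \<zeta> t \<in> V" if "solves_ode A X S \<zeta>" "\<zeta> t0 = p" for \<zeta>
  proof -
    have "(\<zeta> \<longlongrightarrow> p) (at t0 within S)"
      using that t0(1) by (metis continuous_on_def solves_ode_def)
    then have "\<forall>\<^sub>F t in at t0 within S. \<zeta> t \<in> V"
      using \<open>open V\<close> pV by (rule topological_tendstoD)
    then obtain \<delta> where "\<delta> > 0" "\<And>t. t \<in> S \<Longrightarrow> t \<noteq> t0 \<Longrightarrow> dist t t0 < \<delta> \<Longrightarrow> \<zeta> t \<in> V"
      unfolding eventually_at by blast
    then show ?thesis using that(2) pV by metis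
  qed
  obtain d1 where d1: "d1 > 0" "\<And>t. t \<in> S \<Longrightarrow> dist t t0 < d1 \<Longrightarrow> \<gamma> t \<in> V"
    using near[OF sol(1)] by (auto simp: p_def)
  obtain d2 where d2: "d2 > 0" "\<And>t. t \<in> S \<Longrightarrow> dist t t0 < d2 \<Longrightarrow> \<eta> t \<in> V"
    using near[OF sol(2)] t0(2) by (auto simp: p_def)
  \<comment> \<open>Up to this distance both curves stay in the chart, the estimate for the field holds and the
    segment is short relative to \<open>L\<close>.\<close>
  define d where "d = min (min d1 d2) (min e (1 / (2 * L + 1)))"
  have "d > 0" using d1(1) d2(1) e L0 by (simp add: d_def)
  moreover have "\<gamma> t = \<eta> t" if t: "t \<in> S" "dist t t0 < d" for t
  proof -
    let ?J = "closed_segment t0 t"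
    have J: "?J \<subseteq> S" using S(2) t0(1) t(1) by (simp add: closed_segment_subset)
    have Jd: "dist s t0 < d" if "s \<in> ?J" for s
      using that t(2) segment_bound1[of s t0 t] by (simp add: dist_norm norm_minus_commute)
    have V: "\<gamma> s \<in> V" "\<eta> s \<in> V" if "s \<in> ?J" for s
      using d1(2)[of s] d2(2)[of s] Jd[OF that] J that by (auto simp: d_def)
    have ch: "c \<in> charts_at A (\<gamma> s)" "c \<in> charts_at A (\<eta> s)" if "s \<in> ?J" for s
      using V[OF that] cA by (auto simp: V_def charts_at_iff)
    let ?g = "\<lambda>s. chart_map c (\<gamma> s) - chart_map c (\<eta> s)"
    have "?g t = 0"
    proof (rule linear_growth_zero[of t0 t ?g "\<lambda>s. X s (\<gamma> s) c - X s (\<eta> s) c" L])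
      fix s assume s: "s \<in> ?J"
      have "((\<lambda>s. chart_map c (\<gamma> s)) has_vector_derivative X s (\<gamma> s) c) (at s within S)"
        "((\<lambda>s. chart_map c (\<eta> s)) has_vector_derivative X s (\<eta> s) c) (at s within S)"
        using sol ch[OF s] s J by (auto simp: solves_ode_def)
      then show "(?g has_vector_derivative X s (\<gamma> s) c - X s (\<eta> s) c) (at s within ?J)"
        by (intro has_vector_derivative_diff) (auto intro: has_vector_derivative_within_subset[OF _ J])
      have sT: "s \<in> T \<inter> cball t0 e"
        using s J S(1) Jd[OF s] by (auto simp: d_def dist_commute)
      have "dist (X s (\<gamma> s) c) (X s (\<eta> s) c) \<le> L * dist (s, chart_map c (\<gamma> s)) (s, chart_map c (\<eta> s))"
        using lipschitz_onD[OF L, of "(s, chart_map c (\<gamma> s))" "(s, chart_map c (\<eta> s))"] sT V[OF s] cA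
        by (auto simp: V_def chart_inv_map less_imp_le)
      then show "norm (X s (\<gamma> s) c - X s (\<eta> s) c) \<le> L * norm (?g s)"
        by (simp add: dist_Pair_Pair dist_norm)
    next
      have "L * \<bar>t - t0\<bar> \<le> L * (1 / (2 * L + 1))"
        using t(2) L0 by (intro mult_left_mono) (auto simp: d_def dist_real_def)
      also have "\<dots> \<le> 1 / 2" using L0 by (simp add: field_simps)
      finally show "L * \<bar>t - t0\<bar> \<le> 1 / 2" .
      show "?g t0 = 0" using t0(2) by simp
    qed (rule L0)
    then have eq: "chart_map c (\<gamma> t) = chart_map c (\<eta> t)" by simp
    have "t \<in> ?J" by simp
    then have dom: "\<gamma> t \<in> chart_dom c" "\<eta> t \<in> chart_dom c"
      using V unfolding V_def by blast+
    show ?thesis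
      using arg_cong[OF eq, of "chart_inv c"]
      by (simp only: chart_inv_map[OF cA(1) dom(1)] chart_inv_map[OF cA(1) dom(2)])
  qed
  ultimately show ?thesis by (intro exI[of _ d]) simp
qed

text \<open>The set of times at which the two solutions agree is open by the local statement and closed
  because the manifold is Hausdorff.\<close>

theorem solution_unique:
  assumes X: "locally_lipschitz_field A T X" and S: "S \<subseteq> T" "convex S"
    and sol: "solves_ode A X S \<gamma>" "solves_ode A X S \<eta>"
    and s: "s \<in> S" "\<gamma> s = \<eta> s" and t: "t \<in> S"
  shows "\<gamma> t = \<eta> t"
proof -
  let ?E = "{t \<in> S. \<gamma> t = \<eta> t}"
  have "openin (top_of_set S) ?E"
    unfolding openin_euclidean_subtopology_iff
    using solution_unique_locally[OF X S sol] by auto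
  moreover have "closedin (top_of_set S) ?E"
  proof -
    have "continuous_on S (\<lambda>t. (\<gamma> t, \<eta> t))"
      using sol by (auto simp: solves_ode_def intro: continuous_on_Pair)
    then have "closedin (top_of_set S) (S \<inter> (\<lambda>t. (\<gamma> t, \<eta> t)) -` {y. \<exists>x. y = (x, x)})"
      by (rule continuous_closedin_preimage) (rule closed_diagonal)
    moreover have "S \<inter> (\<lambda>t. (\<gamma> t, \<eta> t)) -` {y. \<exists>x. y = (x, x)} = ?E" by auto
    ultimately show ?thesis by simp
  qed
  moreover have "connected S" using S(2) by (rule convex_connected)
  ultimately have "?E = {} \<or> ?E = S" unfolding connected_clopen by blast
  then show ?thesis using s t by blast
qed

text \<open>The length \<open>\<delta>\<close> of the time interval serves all initial conditions in a neighbourhood; the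
  compactness argument below depends on this.\<close>

lemma solution_exists_locally:
  assumes X: "locally_lipschitz_field A {0..1} X" and t0: "t0 \<in> {0..1}"
  shows "\<exists>W. open W \<and> (t0, p) \<in> W \<and> (\<exists>\<delta>>0. \<forall>a q. (a, q) \<in> W \<longrightarrow> a \<in> {0..1} \<longrightarrow>
    (\<exists>\<gamma>. \<gamma> a = q \<and> solves_ode A X {a..min 1 (a + \<delta>)} \<gamma>))"
proof -
  obtain c where c: "c \<in> charts_at A p" using charts_at_nonempty by blast
  then have cA: "c \<in> A" "p \<in> chart_dom c" by (auto simp: charts_at_iff)
  let ?z0 = "chart_map c p"
  let ?f = "\<lambda>t z. X t (chart_inv c z) c"
  obtain e L where e: "e > 0" "cball ?z0 e \<subseteq> chart_img c" and
    L: "L-lipschitz_on (({0..1} \<inter> cball t0 e) \<times> cball ?z0 e) (\<lambda>(t, z). ?f t z)"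
    using X t0 c unfolding locally_lipschitz_field_def by meson
  have L0: "0 \<le> L" using L by (rule lipschitz_on_nonneg)
  have tan: "X t q \<in> tangent_space A q" if "t \<in> {0..1}" for t q
    using X that by (simp add: locally_lipschitz_field_def)
  \<comment> \<open>A Lipschitz map is bounded on a bounded set; the points considered are at distance at most
    \<open>2 * e\<close> from the centre.\<close>
  define B where "B = norm (?f t0 ?z0) + L * (2 * e)"
  have B0: "0 \<le> B" using L0 e by (simp add: B_def)
  have B: "norm (?f t z) \<le> B" if "t \<in> {0..1} \<inter> cball t0 e" "z \<in> cball ?z0 e" for t z
  proof -
    have "dist (?f t z) (?f t0 ?z0) \<le> L * dist (t, z) (t0, ?z0)"
      using lipschitz_onD[OF L, of "(t, z)" "(t0, ?z0)"] that t0 e by auto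
    also have "dist (t, z) (t0, ?z0) \<le> dist t t0 + dist z ?z0"
      by (simp add: dist_Pair_Pair sqrt_sum_squares_le_sum)
    also have "\<dots> \<le> 2 * e" using that by (simp add: dist_commute)
    finally show ?thesis
      using L0 norm_triangle_sub[of "?f t z" "?f t0 ?z0"]
      by (simp add: B_def dist_norm mult_left_mono)
  qed
  \<comment> \<open>The bounds keep the time interval inside the domain of the estimates, the curve inside the ball
    and the Picard operator contracting.\<close>
  define \<delta> where "\<delta> = min (e / 2) (min (e / (2 * B + 1) / 2) (1 / (L + 1) / 2))"
  have \<delta>: "\<delta> > 0" using e L0 B0 by (simp add: \<delta>_def)
  have \<delta>e: "\<delta> \<le> e / 2" unfolding \<delta>_def by (rule min.cobounded1)
  define W where "W = ball t0 (e / 2) \<times> (chart_map c -` ball ?z0 (e / 2) \<inter> chart_dom c)"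
  have "open (chart_map c -` ball ?z0 (e / 2) \<inter> chart_dom c)"
    using continuous_on_chart_map[OF cA(1)] chart_open[OF cA(1)]
    by (metis continuous_on_open_vimage open_ball)
  then have "open W" unfolding W_def by (intro open_Times open_ball)
  moreover have "(t0, p) \<in> W" using e cA by (simp add: W_def)
  moreover have "\<exists>\<gamma>. \<gamma> a = q \<and> solves_ode A X {a..min 1 (a + \<delta>)} \<gamma>"
    if aq: "(a, q) \<in> W" "a \<in> {0..1}" for a q
  proof -
    let ?b = "min 1 (a + \<delta>)"
    have q: "q \<in> chart_dom c" "chart_map c q \<in> cball ?z0 (e / 2)"
      using aq by (auto simp: W_def)
    have at0: "dist t0 a < e / 2" using aq by (simp add: W_def)
    have J: "{a..?b} \<subseteq> {0..1} \<inter> cball t0 e"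
    proof
      fix s assume s: "s \<in> {a..?b}"
      then have "dist a s \<le> e / 2" using \<delta>e by (auto simp: dist_real_def)
      then have "dist t0 s \<le> e" using at0 dist_triangle[of t0 s a] by linarith
      then show "s \<in> {0..1} \<inter> cball t0 e" using s aq(2) by auto
    qed
    have len: "?b - a \<le> \<delta>" by simp
    have "\<exists>u. u a = chart_map c q \<and> (\<forall>t\<in>{a..?b}. u t \<in> cball ?z0 e \<and>
        (u has_vector_derivative ?f t (u t)) (at t within {a..?b}))"
    proof (rule picard_lindelof[where L = L and B = B])
      show "a \<le> ?b" using aq(2) \<delta> by auto
      show "0 < e" by (rule e)
      show "L-lipschitz_on ({a..?b} \<times> cball ?z0 e) (\<lambda>(t, z). ?f t z)"
        using J by (intro lipschitz_on_subset[OF L]) auto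
      show "norm (?f t z) \<le> B" if "t \<in> {a..?b}" "z \<in> cball ?z0 e" for t z
        using B that J by blast
      show "chart_map c q \<in> cball ?z0 (e / 2)" by (rule q)
      have "B * (?b - a) \<le> B * (e / (2 * B + 1) / 2)"
        using B0 len by (intro mult_left_mono) (auto simp: \<delta>_def)
      also have "\<dots> \<le> e / 2" using B0 e by (simp add: field_simps)
      finally show "B * (?b - a) \<le> e / 2" .
      have "L * (?b - a) \<le> L * (1 / (L + 1) / 2)"
        using L0 len by (intro mult_left_mono) (auto simp: \<delta>_def)
      also have "\<dots> < 1" using L0 by (simp add: field_simps)
      finally show "L * (?b - a) < 1" .
    qed
    then obtain u where u: "u a = chart_map c q" "\<And>t. t \<in> {a..?b} \<Longrightarrow> u t \<in> cball ?z0 e"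
      "\<And>t. t \<in> {a..?b} \<Longrightarrow> (u has_vector_derivative ?f t (u t)) (at t within {a..?b})"
      by blast
    have uimg: "u t \<in> chart_img c" if "t \<in> {a..?b}" for t using u(2)[OF that] e(2) by blast
    have "solves_ode A X {a..?b} (\<lambda>t. chart_inv c (u t))"
    proof (rule solves_odeI)
      have "continuous_on {a..?b} u"
        unfolding continuous_on_eq_continuous_within
        by (intro ballI has_vector_derivative_continuous[OF u(3)])
      then show "continuous_on {a..?b} (\<lambda>t. chart_inv c (u t))"
        by (rule continuous_on_compose2[OF continuous_on_chart_inv[OF cA(1)]]) (use uimg in auto)
      fix t assume t: "t \<in> {a..?b}"
      show "X t (chart_inv c (u t)) \<in> tangent_space A (chart_inv c (u t))"
        using J t by (intro tan) auto
      have der: "((\<lambda>s. chart_map c (chart_inv c (u s))) has_vector_derivative ?f t (u t)) (at t within {a..?b})"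
        by (rule has_vector_derivative_transform[OF t _ u(3)[OF t]])
          (rule chart_map_inv[OF cA(1) uimg])
      have "c \<in> charts_at A (chart_inv c (u t))"
        using chart_inv_in[OF cA(1) uimg[OF t]] cA by (simp add: charts_at_iff)
      with der show "\<exists>d\<in>charts_at A (chart_inv c (u t)).
          ((\<lambda>s. chart_map d (chart_inv c (u s))) has_vector_derivative X t (chart_inv c (u t)) d) (at t within {a..?b})"
        by (rule bexI)
    qed
    then show ?thesis using u(1) q(1) chart_inv_map[OF cA(1)]
      by (intro exI[of _ "\<lambda>t. chart_inv c (u t)"]) simp
  qed
  ultimately show ?thesis using \<delta> by (intro exI[of _ W] conjI exI[of _ \<delta>] allI impI)
qed

text \<open>At a point outside \<open>K\<close> the constant curve is a solution, and over the compact set \<open>{0..1}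
  \<times> K\<close> finitely many of the neighbourhoods above suffice. Hence all solutions can be prolonged by a
  fixed length of time, and finitely many steps reach time 1.\<close>

theorem solution_exists:
  assumes X: "locally_lipschitz_field A {0..1} X" and K: "compact K"
    and vanish: "\<And>t p. t \<in> {0..1} \<Longrightarrow> p \<notin> K \<Longrightarrow> X t p = (\<lambda>c. 0)"
  shows "\<exists>\<gamma>. \<gamma> 0 = p \<and> solves_ode A X {0..1} \<gamma>"
proof -
  have "\<forall>x\<in>{0..1} \<times> K. \<exists>W. open W \<and> x \<in> W \<and> (\<exists>\<delta>>0. \<forall>a q. (a, q) \<in> W \<longrightarrow> a \<in> {0..1} \<longrightarrow>
      (\<exists>\<gamma>. \<gamma> a = q \<and> solves_ode A X {a..min 1 (a + \<delta>)} \<gamma>))"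
    using solution_exists_locally[OF X] by force
  then obtain W where W: "\<forall>x\<in>{0..1} \<times> K. open (W x) \<and> x \<in> W x \<and> (\<exists>\<delta>>0. \<forall>a q. (a, q) \<in> W x \<longrightarrow> a \<in> {0..1} \<longrightarrow>
      (\<exists>\<gamma>. \<gamma> a = q \<and> solves_ode A X {a..min 1 (a + \<delta>)} \<gamma>))"
    by (rule bchoice[THEN exE])
  then obtain \<delta> where \<delta>: "\<forall>x\<in>{0..1} \<times> K. \<delta> x > 0 \<and> (\<forall>a q. (a, q) \<in> W x \<longrightarrow> a \<in> {0..1} \<longrightarrow>
      (\<exists>\<gamma>. \<gamma> a = q \<and> solves_ode A X {a..min 1 (a + \<delta> x)} \<gamma>))"
    using bchoice[of "{0..1} \<times> K"] by metis
  have "compact ({0..1::real} \<times> K)" using K by (intro compact_Times) auto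
  then obtain D where D: "D \<subseteq> {0..1} \<times> K" "finite D" "{0..1} \<times> K \<subseteq> (\<Union>x\<in>D. W x)"
    by (rule compactE_image[of _ "{0..1} \<times> K" W]) (use W in auto)
  define r where "r = Min (insert 1 (\<delta> ` D))"
  have r: "r > 0" using D \<delta> by (auto simp: r_def)
  have step: "\<exists>\<gamma>. \<gamma> a = q \<and> solves_ode A X {a..min 1 (a + r)} \<gamma>" if a: "a \<in> {0..1}" for a q
  proof (cases "q \<in> K")
    case True
    then obtain x where x: "x \<in> D" "(a, q) \<in> W x" using D(3) a by blast
    then obtain \<gamma> where "\<gamma> a = q" "solves_ode A X {a..min 1 (a + \<delta> x)} \<gamma>"
      using \<delta> D(1) a by (metis subsetD)
    moreover have "r \<le> \<delta> x" using x(1) D(2) by (simp add: r_def)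
    then have "{a..min 1 (a + r)} \<subseteq> {a..min 1 (a + \<delta> x)}" by auto
    ultimately show ?thesis using solves_ode_subset by blast
  next
    case False
    have "solves_ode A X {a..min 1 (a + r)} (\<lambda>t. q)"
      unfolding solves_ode_def using vanish[OF _ False] a by auto
    then show ?thesis by (intro exI[of _ "\<lambda>t. q"]) simp
  qed
  have "\<exists>\<gamma>. \<gamma> 0 = p \<and> solves_ode A X {0..min 1 (real (Suc n) * r)} \<gamma>" for n
  proof (induction n)
    case 0
    show ?case using step[of 0 p] by simp
  next
    case (Suc n)
    define a where "a = min 1 (real (Suc n) * r)"
    have a: "a \<in> {0..1}" using r by (auto simp: a_def)
    obtain \<gamma> where \<gamma>: "\<gamma> 0 = p" "solves_ode A X {0..a} \<gamma>" using Suc by (auto simp: a_def)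
    obtain \<eta> where \<eta>: "\<eta> a = \<gamma> a" "solves_ode A X {a..min 1 (a + r)} \<eta>" using step[OF a] by blast
    let ?z = "\<lambda>t. if t \<le> a then \<gamma> t else \<eta> t"
    have "solves_ode A X ({0..a} \<union> {a..min 1 (a + r)}) ?z"
    proof (rule solves_ode_Un)
      show "solves_ode A X {0..a} ?z" by (rule solves_ode_cong[OF \<gamma>(2)]) auto
      show "solves_ode A X {a..min 1 (a + r)} ?z" by (rule solves_ode_cong[OF \<eta>(2)]) (auto simp: \<eta>(1))
    qed auto
    moreover have "{0..min 1 (real (Suc (Suc n)) * r)} \<subseteq> {0..a} \<union> {a..min 1 (a + r)}"
      by (auto simp: a_def min_def algebra_simps)
    ultimately have "solves_ode A X {0..min 1 (real (Suc (Suc n)) * r)} ?z"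
      by (rule solves_ode_subset)
    then show ?case using \<gamma>(1) a by (intro exI[of _ ?z]) auto
  qed
  moreover obtain n where "1 < real n * r" using r reals_Archimedean3 by blast
  then have "min 1 (real (Suc n) * r) = 1" using r by (simp add: algebra_simps)
  ultimately show ?thesis by metis
qed

end

section \<open>Hamiltonian vector fields\<close>

lemma C1_imp_lipschitz_on:
  fixes f :: "'a::euclidean_space \<Rightarrow> 'b::real_normed_vector"
  assumes f: "Ck_on (Suc 0) U f" and S: "compact S" "convex S" "S \<subseteq> U"
  shows "\<exists>L. L-lipschitz_on S f"
proof -
  let ?D = "\<lambda>x. frechet_derivative f (at x)"
  let ?h = "\<lambda>x. \<Sum>b\<in>Basis. norm (?D x b)"
  have "continuous_on S ?h"
    using f S(3) by (intro continuous_on_sum continuous_on_norm) (auto intro: continuous_on_subset)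
  then have "bounded (?h ` S)"
    using S(1) compact_continuous_image compact_imp_bounded by blast
  then obtain B where B: "B > 0" "\<And>x. x \<in> S \<Longrightarrow> norm (?h x) \<le> B"
    unfolding bounded_pos by blast
  have "B-lipschitz_on S f"
  proof (rule bounded_derivative_imp_lipschitz[OF _ S(2)])
    show "(f has_derivative ?D x) (at x within S)" if "x \<in> S" for x
      using Ck_on_has_derivative[OF f, of x] that S(3) has_derivative_at_withinI by blast
    show "onorm (?D x) \<le> B" if x: "x \<in> S" for x
    proof (rule onorm_le)
      fix v
      interpret bounded_linear "?D x"
        using Ck_on_has_derivative[OF f, of x] x S(3) has_derivative_bounded_linear by blast
      have "?D x v = ?D x (\<Sum>b\<in>Basis. (v \<bullet> b) *\<^sub>R b)" by (simp add: euclidean_representation)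
      also have "\<dots> = (\<Sum>b\<in>Basis. (v \<bullet> b) *\<^sub>R ?D x b)" by (simp only: sum scaleR)
      also have "norm \<dots> \<le> (\<Sum>b\<in>Basis. norm ((v \<bullet> b) *\<^sub>R ?D x b))" by (rule norm_sum)
      also have "\<dots> \<le> (\<Sum>b\<in>Basis. norm v * norm (?D x b))"
        by (intro sum_mono) (auto intro: mult_right_mono Basis_le_norm)
      also have "\<dots> = norm v * ?h x" by (simp add: sum_distrib_left)
      also have "\<dots> \<le> norm v * B" using B(2)[OF x] by (intro mult_left_mono) auto
      finally show "norm (?D x v) \<le> B * norm v" by (simp add: mult.commute)
    qed
  qed (use B in simp)
  then show ?thesis ..
qed

text \<open>The point \<open>t0\<close> may be a boundary point of \<open>T\<close>, where smoothness of \<open>F\<close>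
  refers to an extension \<open>g\<close>. The partial derivative in the space direction is read off from
  \<open>g\<close>, so that it depends smoothly on \<open>(t, z)\<close>.\<close>

lemma smooth_on_slice_derivative:
  fixes F :: "'a::euclidean_space \<times> 'b::euclidean_space \<Rightarrow> 'c::real_normed_vector"
  assumes "smooth_on (T \<times> S) F" "open S" "t0 \<in> T" "z0 \<in> S"
  obtains U g where "open U" "(t0, z0) \<in> U" "\<And>k. Ck_on k U g"
    and "\<And>t z. t \<in> T \<Longrightarrow> z \<in> S \<Longrightarrow> (t, z) \<in> U \<Longrightarrow>
      ((\<lambda>z. F (t, z)) has_derivative (\<lambda>w. frechet_derivative g (at (t, z)) (0, w))) (at z)"
proof -
  obtain U g where U: "open U" "(t0, z0) \<in> U" "\<forall>k. Ck_on k U g" "\<forall>y\<in>(T \<times> S) \<inter> U. g y = F y"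
    using smooth_onD[OF assms(1), of "(t0, z0)"] assms(3,4) by blast
  have "((\<lambda>z. F (t, z)) has_derivative (\<lambda>w. frechet_derivative g (at (t, z)) (0, w))) (at z)"
    if t: "t \<in> T" and z: "z \<in> S" and tz: "(t, z) \<in> U" for t z
  proof (rule has_derivative_transform_within_open)
    have "((\<lambda>z. (t, z)) has_derivative (\<lambda>w. (0, w))) (at z)"
      by (intro derivative_intros)
    then show "((\<lambda>z. g (t, z)) has_derivative (\<lambda>w. frechet_derivative g (at (t, z)) (0, w))) (at z)"
      using Ck_on_has_derivative[OF U(3)[rule_format] tz] by (rule has_derivative_compose)
    have "open ((\<lambda>z. (t, z)) -` U)" using U(1) by (intro open_vimage continuous_intros)
    then show "open ((\<lambda>z. (t, z)) -` U \<inter> S)" using assms(2) by blast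
    show "z \<in> (\<lambda>z. (t, z)) -` U \<inter> S" using z tz by simp
    show "g (t, x) = F (t, x)" if "x \<in> (\<lambda>z. (t, z)) -` U \<inter> S" for x
      using U(4) that t by simp
  qed
  with U that show ?thesis by blast
qed

text \<open>The unit sphere is compact, so a continuous family of injective linear maps over a compact set is
  uniformly bounded below.
  In other words, the inverses are uniformly bounded.\<close>

lemma linear_lower_bound_on_compact:
  fixes \<Omega> :: "'z::topological_space \<Rightarrow> 'e::euclidean_space \<Rightarrow> 'e"
  assumes C: "compact C" and cont: "\<And>a. a \<in> Basis \<Longrightarrow> continuous_on C (\<lambda>z. \<Omega> z a)"
    and lin: "\<And>z. z \<in> C \<Longrightarrow> linear (\<Omega> z)"
    and inj: "\<And>z u. z \<in> C \<Longrightarrow> \<Omega> z u = 0 \<Longrightarrow> u = 0"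
  shows "\<exists>m>0. \<forall>z\<in>C. \<forall>u. m * norm u \<le> norm (\<Omega> z u)"
proof (cases "C = {}")
  case True
  then show ?thesis by (intro exI[of _ 1]) simp
next
  case False
  have expand: "\<Omega> z u = (\<Sum>a\<in>Basis. (u \<bullet> a) *\<^sub>R \<Omega> z a)" if "z \<in> C" for z u
  proof -
    have "\<Omega> z (\<Sum>a\<in>Basis. (u \<bullet> a) *\<^sub>R a) = (\<Sum>a\<in>Basis. (u \<bullet> a) *\<^sub>R \<Omega> z a)"
      using lin[OF that] by (simp add: linear_sum linear_scale)
    then show ?thesis by (simp add: euclidean_representation)
  qed
  let ?S = "C \<times> sphere (0::'e) 1"
  have "continuous_on ?S (\<lambda>(z, u). \<Sum>a\<in>Basis. (u \<bullet> a) *\<^sub>R \<Omega> z a)"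
    unfolding case_prod_unfold
    by (intro continuous_on_sum continuous_on_scaleR continuous_intros continuous_on_compose2[OF cont]) auto
  then have "continuous_on ?S (\<lambda>(z, u). \<Omega> z u)"
    by (rule continuous_on_eq) (auto simp: expand)
  then have "continuous_on ?S (\<lambda>x. norm ((\<lambda>(z, u). \<Omega> z u) x))" by (rule continuous_on_norm)
  moreover have "compact ?S" using C by (intro compact_Times) auto
  moreover have "?S \<noteq> {}" using False by (auto simp: ex_in_conv intro: vector_choose_size[of 1])
  ultimately have "\<exists>x\<in>?S. \<forall>y\<in>?S. norm ((\<lambda>(z, u). \<Omega> z u) x) \<le> norm ((\<lambda>(z, u). \<Omega> z u) y)"
    by (intro continuous_attains_inf)
  then obtain x where x: "x \<in> ?S"
    "\<forall>y\<in>?S. norm ((\<lambda>(z, u). \<Omega> z u) x) \<le> norm ((\<lambda>(z, u). \<Omega> z u) y)" by (elim bexE)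
  obtain z1 u1 where zu: "x = (z1, u1)" by (cases x)
  have 1: "z1 \<in> C" "norm u1 = 1" using x(1) by (simp_all add: zu)
  have 2: "norm (\<Omega> z1 u1) \<le> norm (\<Omega> z u)" if "z \<in> C" "norm u = 1" for z u
    using x(2)[rule_format, of "(z, u)"] that by (simp add: zu)
  have "norm (\<Omega> z1 u1) * norm u \<le> norm (\<Omega> z u)" if z: "z \<in> C" for z u
  proof (cases "u = 0")
    case False
    have "norm (\<Omega> z1 u1) \<le> norm (\<Omega> z (u /\<^sub>R norm u))"
      using False by (intro 2 z) simp
    also have "\<Omega> z (u /\<^sub>R norm u) = \<Omega> z u /\<^sub>R norm u"
      by (rule linear_scale[OF lin[OF z]])
    also have "norm (\<Omega> z u /\<^sub>R norm u) = norm (\<Omega> z u) / norm u"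
      by (simp add: divide_inverse_commute)
    finally show ?thesis using False by (simp add: field_simps)
  qed simp
  moreover have "\<Omega> z1 u1 \<noteq> 0" using inj[OF 1(1), of u1] 1(2) by auto
  ultimately show ?thesis by (intro exI[of _ "norm (\<Omega> z1 u1)"]) simp
qed

context symplectic_manifold
begin

lemma form_linear_right:
  assumes "u \<in> tangent_space A p" "v \<in> tangent_space A p" "w \<in> tangent_space A p"
  shows "\<omega> p w (\<lambda>c. a *\<^sub>R u c + b *\<^sub>R v c) = a * \<omega> p w u + b * \<omega> p w v"
  by (simp only: form_skew[OF tangent_lincomb[OF assms(1,2)] assms(3)] form_linear[OF assms]
      form_skew[OF assms(1,3)] form_skew[OF assms(2,3)] minus_add_distrib mult_minus_right)

lemma form_coord:
  assumes "u \<in> tangent_space A p" "v \<in> tangent_space A p" "c \<in> charts_at A p"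
  shows "\<omega> p u v = form_rep A \<omega> c (chart_map c p) (u c) (v c)"
  using assms by (simp add: form_rep_def charts_at_iff[of c] chart_inv_map coord_vector_tangent_self)

lemma form_rep_linear:
  assumes c: "c \<in> A" "z \<in> chart_img c"
  shows "linear (\<lambda>u. form_rep A \<omega> c z u w)" "linear (form_rep A \<omega> c z w)"
proof -
  have p: "c \<in> charts_at A (chart_inv c z)" using c by (simp add: charts_at_iff chart_inv_in)
  note t = coord_vector_tangent[OF p]
  have 1: "form_rep A \<omega> c z (a *\<^sub>R u + b *\<^sub>R v) w = a * form_rep A \<omega> c z u w + b * form_rep A \<omega> c z v w" for a b u v
    by (simp only: form_rep_def coord_vector_lincomb[OF p] form_linear[OF t t t])
  have 2: "form_rep A \<omega> c z w (a *\<^sub>R u + b *\<^sub>R v) = a * form_rep A \<omega> c z w u + b * form_rep A \<omega> c z w v" for a b u v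
    by (simp only: form_rep_def coord_vector_lincomb[OF p] form_linear_right[OF t t t])
  show "linear (\<lambda>u. form_rep A \<omega> c z u w)"
    using 1[of 1 _ 1] 1[of _ _ 0] by (intro linearI) simp_all
  show "linear (form_rep A \<omega> c z w)"
    using 2[of 1 _ 1] 2[of _ _ 0] by (intro linearI) simp_all
qed

text \<open>The symplectic form in a chart as an operator, by means of the Euclidean inner product.\<close>

definition form_op :: "('a, 'e) chart \<Rightarrow> 'e \<Rightarrow> 'e \<Rightarrow> 'e" where
  "form_op c z u = (\<Sum>b\<in>Basis. form_rep A \<omega> c z u b *\<^sub>R b)"

lemma form_op_inner:
  assumes "c \<in> A" "z \<in> chart_img c"
  shows "form_op c z u \<bullet> w = form_rep A \<omega> c z u w"
proof -
  have "form_op c z u \<bullet> w = w \<bullet> form_op c z u" by (rule inner_commute)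
  also have "\<dots> = (\<Sum>b\<in>Basis. (w \<bullet> b) * form_rep A \<omega> c z u b)"
    by (simp add: form_op_def inner_sum_right mult.commute)
  also have "\<dots> = form_rep A \<omega> c z u (\<Sum>b\<in>Basis. (w \<bullet> b) *\<^sub>R b)"
    using form_rep_linear(2)[OF assms, of u] by (simp add: linear_sum linear_scale)
  finally show ?thesis by (simp only: euclidean_representation)
qed

lemma form_op_linear:
  assumes "c \<in> A" "z \<in> chart_img c"
  shows "linear (form_op c z)"
proof (rule linearI)
  note lin = form_rep_linear(1)[OF assms]
  show "form_op c z (u + v) = form_op c z u + form_op c z v" for u v
    by (simp add: form_op_def linear_add[OF lin] scaleR_add_left sum.distrib)
  show "form_op c z (r *\<^sub>R u) = r *\<^sub>R form_op c z u" for r u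
    by (simp add: form_op_def linear_scale[OF lin] scaleR_sum_right)
qed

lemma form_op_injective:
  assumes c: "c \<in> A" "z \<in> chart_img c" and "form_op c z u = 0"
  shows "u = 0"
proof -
  have p: "c \<in> charts_at A (chart_inv c z)" using c by (simp add: charts_at_iff chart_inv_in)
  have "\<omega> (chart_inv c z) (coord_vector A c (chart_inv c z) u) v = 0"
    if "v \<in> tangent_space A (chart_inv c z)" for v
    using form_coord[OF coord_vector_tangent[OF p] that p, of u] form_op_inner[OF c, of u "v c"] assms(3)
    by (simp add: coord_vector_self[OF p] chart_map_inv[OF c])
  then have "coord_vector A c (chart_inv c z) u = (\<lambda>c. 0)"
    by (intro form_nondegenerate[OF coord_vector_tangent[OF p]]) simp
  then show ?thesis using coord_vector_self[OF p, of u] by simp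
qed

text \<open>Nondegeneracy gives uniqueness of the Hamiltonian vector field here and, by equality of
  dimensions, its existence below.\<close>

lemma hamiltonian_vector_unique:
  assumes "v \<in> tangent_space A p" "v' \<in> tangent_space A p"
    and "\<And>w. w \<in> tangent_space A p \<Longrightarrow> \<omega> p v w = \<omega> p v' w"
  shows "v = v'"
proof -
  have "\<omega> p (\<lambda>c. 1 *\<^sub>R v c + (- 1) *\<^sub>R v' c) w = 0" if "w \<in> tangent_space A p" for w
    using form_linear[OF assms(1,2) that, of 1 "- 1"] assms(3)[OF that] by simp
  then have *: "(\<lambda>c. 1 *\<^sub>R v c + (- 1) *\<^sub>R v' c) = (\<lambda>c. 0)"
    by (intro form_nondegenerate[OF tangent_lincomb[OF assms(1,2)]] ballI)
  show ?thesis
  proof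
    show "v c = v' c" for c using fun_cong[OF *, of c] by simp
  qed
qed

lemma hamiltonian_vector_field_eqI:
  assumes "v \<in> tangent_space A p"
    and "\<And>w. w \<in> tangent_space A p \<Longrightarrow> \<omega> p v w = - fun_differential A f p w"
  shows "hamiltonian_vector_field A \<omega> f p = v"
  unfolding hamiltonian_vector_field_def
  by (rule the_equality) (use assms hamiltonian_vector_unique in \<open>auto simp del: split_paired_All\<close>)

lemma hamiltonian_vector_exists:
  assumes f: "differentiable_fun f p"
  shows "\<exists>v\<in>tangent_space A p. \<forall>w\<in>tangent_space A p. \<omega> p v w = - fun_differential A f p w"
proof -
  obtain c where c: "c \<in> charts_at A p" using charts_at_nonempty by blast
  then have cA: "c \<in> A" "chart_map c p \<in> chart_img c" by (auto simp: charts_at_iff chart_map_in)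
  let ?z = "chart_map c p"
  let ?df = "frechet_derivative (f \<circ> chart_inv c) (at ?z)"
  have df: "linear ?df"
    using f c by (intro linear_frechet_derivative) (simp add: differentiable_fun_def)
  note lin = form_op_linear[OF cA]
  have "inj (form_op c ?z)"
    using linear_injective_0[OF lin] form_op_injective[OF cA] by blast
  then have "surj (form_op c ?z)" by (rule linear_injective_imp_surjective[OF lin _ refl])
  then obtain u where "- (\<Sum>b\<in>Basis. ?df b *\<^sub>R b) = form_op c ?z u" by (rule surjE)
  note u = this[symmetric]
  have "\<omega> p (coord_vector A c p u) w = - fun_differential A f p w" if w: "w \<in> tangent_space A p" for w
  proof -
    have "\<omega> p (coord_vector A c p u) w = form_op c ?z u \<bullet> w c"
      by (simp add: form_coord[OF coord_vector_tangent[OF c] w c] coord_vector_self[OF c] form_op_inner[OF cA])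
    also have "\<dots> = w c \<bullet> form_op c ?z u" by (rule inner_commute)
    also have "\<dots> = - ?df (\<Sum>b\<in>Basis. (w c \<bullet> b) *\<^sub>R b)"
      by (simp add: u inner_sum_right linear_sum[OF df] linear_scale[OF df] mult.commute)
    also have "\<dots> = - ?df (w c)" by (simp only: euclidean_representation)
    finally show ?thesis by (simp add: fun_differential_coord[OF f w c])
  qed
  then show ?thesis using coord_vector_tangent[OF c] by blast
qed

lemma
  assumes f: "differentiable_fun f p"
  shows hamiltonian_vector_tangent: "hamiltonian_vector_field A \<omega> f p \<in> tangent_space A p"
    and hamiltonian_vector_pairing:
      "w \<in> tangent_space A p \<Longrightarrow> \<omega> p (hamiltonian_vector_field A \<omega> f p) w = - fun_differential A f p w"
proof -
  obtain v where v: "v \<in> tangent_space A p" "\<forall>w\<in>tangent_space A p. \<omega> p v w = - fun_differential A f p w"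
    using hamiltonian_vector_exists[OF f] by blast
  then have eq: "hamiltonian_vector_field A \<omega> f p = v" by (intro hamiltonian_vector_field_eqI) auto
  show "hamiltonian_vector_field A \<omega> f p \<in> tangent_space A p" by (simp add: eq v)
  show "w \<in> tangent_space A p \<Longrightarrow> \<omega> p (hamiltonian_vector_field A \<omega> f p) w = - fun_differential A f p w"
    by (simp add: eq v)
qed

lemma hamiltonian_vector_coord:
  assumes f: "differentiable_fun f p" and c: "c \<in> charts_at A p"
  shows "form_op c (chart_map c p) (hamiltonian_vector_field A \<omega> f p c)
    = - (\<Sum>b\<in>Basis. frechet_derivative (f \<circ> chart_inv c) (at (chart_map c p)) b *\<^sub>R b)"
proof (rule euclidean_eqI)
  fix b :: 'e assume b: "b \<in> Basis"
  have cA: "c \<in> A" "chart_map c p \<in> chart_img c" using c by (auto simp: charts_at_iff chart_map_in)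
  note t = coord_vector_tangent[OF c, of b]
  have "form_op c (chart_map c p) (hamiltonian_vector_field A \<omega> f p c) \<bullet> b
      = \<omega> p (hamiltonian_vector_field A \<omega> f p) (coord_vector A c p b)"
    by (simp add: form_op_inner[OF cA] form_coord[OF hamiltonian_vector_tangent[OF f] t c] coord_vector_self[OF c])
  also have "\<dots> = - frechet_derivative (f \<circ> chart_inv c) (at (chart_map c p)) b"
    by (simp add: hamiltonian_vector_pairing[OF f t] fun_differential_coord[OF f t c] coord_vector_self[OF c])
  finally show "form_op c (chart_map c p) (hamiltonian_vector_field A \<omega> f p c) \<bullet> b
      = - (\<Sum>b\<in>Basis. frechet_derivative (f \<circ> chart_inv c) (at (chart_map c p)) b *\<^sub>R b) \<bullet> b"
    using b by (simp add: inner_sum_left_Basis)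
qed

lemma hamiltonian_vector_field_scale:
  assumes f: "differentiable_fun f p"
  shows "hamiltonian_vector_field A \<omega> (\<lambda>x. a * f x) p = (\<lambda>c. a *\<^sub>R hamiltonian_vector_field A \<omega> f p c)"
proof (rule hamiltonian_vector_field_eqI)
  note X = hamiltonian_vector_tangent[OF f]
  show "(\<lambda>c. a *\<^sub>R hamiltonian_vector_field A \<omega> f p c) \<in> tangent_space A p"
    using tangent_lincomb[OF X X, of a 0] by simp
  show "\<omega> p (\<lambda>c. a *\<^sub>R hamiltonian_vector_field A \<omega> f p c) w = - fun_differential A (\<lambda>x. a * f x) p w"
    if w: "w \<in> tangent_space A p" for w
    using form_linear[OF X X w, of a 0]
    by (simp add: hamiltonian_vector_pairing[OF f w] fun_differential_scale[OF f w])
qed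

lemma hamiltonian_vector_field_zero:
  assumes "open V" "p \<in> V" "\<And>x. x \<in> V \<Longrightarrow> f x = 0"
  shows "hamiltonian_vector_field A \<omega> f p = (\<lambda>c. 0)"
proof -
  have D: "((f \<circ> chart_inv c) has_derivative (\<lambda>u. 0)) (at (chart_map c p))" if c: "c \<in> charts_at A p" for c
  proof (rule has_derivative_transform_within_open[OF has_derivative_const[of 0]])
    have cA: "c \<in> A" "p \<in> chart_dom c" using c by (auto simp: charts_at_iff)
    show "open (chart_map c ` (chart_dom c \<inter> V))" by (rule open_chart_image[OF cA(1) assms(1)])
    show "chart_map c p \<in> chart_map c ` (chart_dom c \<inter> V)" using cA assms by simp
    show "0 = (f \<circ> chart_inv c) z" if "z \<in> chart_map c ` (chart_dom c \<inter> V)" for z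
      using that assms(3) by (auto simp: chart_inv_map cA)
  qed
  then have f: "differentiable_fun f p" unfolding differentiable_fun_def using differentiableI by blast
  obtain c where c: "c \<in> charts_at A p" using charts_at_nonempty by blast
  have zero: "(\<lambda>c. 0) \<in> tangent_space A p"
    using tangent_lincomb[of "hamiltonian_vector_field A \<omega> f p" p "hamiltonian_vector_field A \<omega> f p" 0 0]
      hamiltonian_vector_tangent[OF f] by simp
  show ?thesis
  proof (rule hamiltonian_vector_field_eqI[OF zero])
    fix w assume w: "w \<in> tangent_space A p"
    have "fun_differential A f p w = 0"
      by (simp add: fun_differential_coord[OF f w c] frechet_derivative_at[OF D[OF c], symmetric])
    then show "\<omega> p (\<lambda>c. 0) w = - fun_differential A f p w"
      using form_linear[OF zero zero w, of 0 0] by simp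
  qed
qed

lemma form_op_Ck: "c \<in> A \<Longrightarrow> Ck_on k (chart_img c) (\<lambda>z. form_op c z a)"
proof -
  assume c: "c \<in> A"
  then have o: "open (chart_img c)" by (simp add: chart_open)
  show ?thesis unfolding form_op_def
  proof (rule Ck_on_sum[OF o])
    fix b :: 'e
    have "Ck_on k (chart_img c) (\<lambda>z. form_rep A \<omega> c z a b)"
      using form_smooth[OF c] by (simp add: smooth_on_open_iff[OF o])
    then show "Ck_on k (chart_img c) (\<lambda>z. form_rep A \<omega> c z a b *\<^sub>R b)"
      by (rule Ck_on_bounded_linear[OF bounded_linear_scaleR_left o])
  qed
qed

lemma smooth_hamiltonian_differentiable:
  assumes H: "smooth_hamiltonian_on A T H" and t: "t \<in> T"
  shows "differentiable_fun (H t) p"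
  unfolding differentiable_fun_def
proof
  fix c assume "c \<in> charts_at A p"
  then have c: "c \<in> A" "chart_map c p \<in> chart_img c" by (auto simp: charts_at_iff chart_map_in)
  have "smooth_on (T \<times> chart_img c) (\<lambda>(t, z). H t (chart_inv c z))"
    using H c by (simp add: smooth_hamiltonian_on_def)
  then obtain U g where "(t, chart_map c p) \<in> U" and D: "\<And>t z. t \<in> T \<Longrightarrow> z \<in> chart_img c \<Longrightarrow> (t, z) \<in> U \<Longrightarrow>
      ((\<lambda>z. (\<lambda>(t, z). H t (chart_inv c z)) (t, z)) has_derivative (\<lambda>w. frechet_derivative g (at (t, z)) (0, w))) (at z)"
    using smooth_on_slice_derivative[of T "chart_img c" "\<lambda>(t, z). H t (chart_inv c z)" t "chart_map c p"]
      chart_open[OF c(1)] t c(2) by metis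
  then show "(H t \<circ> chart_inv c) differentiable (at (chart_map c p))"
    using D[OF t c(2)] by (auto simp: comp_def intro: differentiableI)
qed

text \<open>In a chart the Hamiltonian vector \<open>\<xi>\<close> solves \<open>\<Omega> z \<xi> = - G (t, z)\<close>,
  where \<open>\<Omega>\<close> is the operator of the form and \<open>G\<close> the gradient in the space
  direction; both are continuously differentiable and hence Lipschitz on compact balls. Subtracting two such
  equations gives \<open>\<Omega> z (\<xi> - \<xi>') = G' - G + (\<Omega> z' - \<Omega> z) \<xi>'\<close>, and the
  lower bound for \<open>\<Omega> z\<close> turns this into the Lipschitz estimate for \<open>\<xi>\<close>.\<close>

theorem hamiltonian_field_locally_lipschitz:
  assumes H: "smooth_hamiltonian_on A T H"
  shows "locally_lipschitz_field A T (\<lambda>t. hamiltonian_vector_field A \<omega> (H t))"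
  unfolding locally_lipschitz_field_def
proof (intro conjI ballI allI)
  show "hamiltonian_vector_field A \<omega> (H t) p \<in> tangent_space A p" if "t \<in> T" for t p
    by (rule hamiltonian_vector_tangent[OF smooth_hamiltonian_differentiable[OF H that]])
next
  fix t0 p c assume t0: "t0 \<in> T" and c: "c \<in> charts_at A p"
  define z0 where "z0 = chart_map c p"
  have cA: "c \<in> A" "z0 \<in> chart_img c" using c by (auto simp: z0_def charts_at_iff chart_map_in)
  have o: "open (chart_img c)" using cA by (simp add: chart_open)
  let ?F = "\<lambda>(t, z). H t (chart_inv c z)"
  have "smooth_on (T \<times> chart_img c) ?F"
    using H cA by (simp add: smooth_hamiltonian_on_def)
  then obtain U g where U: "open U" "(t0, z0) \<in> U" "\<And>k. Ck_on k U g"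
    and D: "\<And>t z. t \<in> T \<Longrightarrow> z \<in> chart_img c \<Longrightarrow> (t, z) \<in> U \<Longrightarrow>
      ((\<lambda>z. ?F (t, z)) has_derivative (\<lambda>w. frechet_derivative g (at (t, z)) (0, w))) (at z)"
    by (rule smooth_on_slice_derivative[OF _ o t0 cA(2)]) (use that in blast)
  obtain r where r: "r > 0" "ball (t0, z0) r \<subseteq> U \<inter> (UNIV \<times> chart_img c)"
    using openE[of "U \<inter> (UNIV \<times> chart_img c)" "(t0, z0)"] U(1,2) o cA(2) open_Times[OF open_UNIV o]
    by (metis IntI SigmaI UNIV_I open_Int)
  \<comment> \<open>The distance in the product is at most the sum of the two distances, so two radii of a third of
    \<open>r\<close> stay inside the ball.\<close>
  define e where "e = r / 3"
  have e: "e > 0" using r by (simp add: e_def)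
  let ?S = "cball t0 e \<times> cball z0 e"
  have S: "?S \<subseteq> U \<inter> (UNIV \<times> chart_img c)"
  proof
    fix x assume "x \<in> ?S"
    then obtain t z where x: "x = (t, z)" "dist t0 t \<le> e" "dist z0 z \<le> e" by auto
    have "dist (t0, z0) x \<le> dist t0 t + dist z0 z"
      by (simp add: x dist_Pair_Pair sqrt_sum_squares_le_sum)
    also have "\<dots> < r" using x e by (simp add: e_def)
    finally show "x \<in> U \<inter> (UNIV \<times> chart_img c)" using r(2) by auto
  qed
  have zimg: "cball z0 e \<subseteq> chart_img c"
  proof
    fix z assume "z \<in> cball z0 e"
    then have "(t0, z) \<in> ?S" using e by simp
    then show "z \<in> chart_img c" using S by blast
  qed
  have SU: "?S \<subseteq> U" using S by blast
  have compS: "compact ?S" "convex ?S" by (simp_all add: compact_Times convex_Times)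
  define G where "G x = (\<Sum>b\<in>Basis. frechet_derivative g (at x) (0, b) *\<^sub>R b)" for x
  have GC: "Ck_on k U G" for k
    unfolding G_def
  proof (rule Ck_on_sum[OF U(1)])
    fix b :: 'e
    have "Ck_on k U (\<lambda>x. frechet_derivative g (at x) (0, b))" using U(3)[of "Suc k"] by simp
    then show "Ck_on k U (\<lambda>x. frechet_derivative g (at x) (0, b) *\<^sub>R b)"
      by (rule Ck_on_bounded_linear[OF bounded_linear_scaleR_left U(1)])
  qed
  obtain LG where LG: "LG-lipschitz_on ?S G"
    using C1_imp_lipschitz_on[OF GC compS SU] by (rule exE)
  have "continuous_on ?S G" using GC[of 0] SU by (auto intro: continuous_on_subset)
  then have "bounded (G ` ?S)" by (intro compact_imp_bounded compact_continuous_image compS(1))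
  then obtain BG where BG: "BG > 0" "\<And>x. x \<in> ?S \<Longrightarrow> norm (G x) \<le> BG"
    unfolding bounded_pos by blast
  have "\<exists>L. L-lipschitz_on (cball z0 e) (\<lambda>z. form_op c z a)" for a
    by (rule C1_imp_lipschitz_on[OF form_op_Ck[OF cA(1)] compact_cball convex_cball zimg])
  then obtain La where La: "\<And>a. (La a)-lipschitz_on (cball z0 e) (\<lambda>z. form_op c z a)" by metis
  define LO where "LO = (\<Sum>a\<in>Basis. La a)"
  have lin: "linear (form_op c z)" if "z \<in> cball z0 e" for z
    using form_op_linear[OF cA(1)] zimg that by blast
  have LO: "norm (form_op c z1 u - form_op c z2 u) \<le> norm u * LO * dist z1 z2"
    if z: "z1 \<in> cball z0 e" "z2 \<in> cball z0 e" for z1 z2 u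
  proof -
    have ex: "form_op c z u = (\<Sum>a\<in>Basis. (u \<bullet> a) *\<^sub>R form_op c z a)" if "z \<in> cball z0 e" for z
    proof -
      have "form_op c z (\<Sum>a\<in>Basis. (u \<bullet> a) *\<^sub>R a) = (\<Sum>a\<in>Basis. (u \<bullet> a) *\<^sub>R form_op c z a)"
        using lin[OF that] by (simp add: linear_sum linear_scale)
      then show ?thesis by (simp add: euclidean_representation)
    qed
    have "form_op c z1 u - form_op c z2 u = (\<Sum>a\<in>Basis. (u \<bullet> a) *\<^sub>R (form_op c z1 a - form_op c z2 a))"
      using ex[OF z(1)] ex[OF z(2)] by (simp add: sum_subtractf scaleR_diff_right)
    also have "norm \<dots> \<le> (\<Sum>a\<in>Basis. norm ((u \<bullet> a) *\<^sub>R (form_op c z1 a - form_op c z2 a)))"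
      by (rule norm_sum)
    also have "\<dots> \<le> (\<Sum>a\<in>Basis. norm u * (La a * dist z1 z2))"
      using lipschitz_onD[OF La z]
      by (intro sum_mono) (auto simp: dist_norm intro!: mult_mono Basis_le_norm)
    also have "\<dots> = norm u * LO * dist z1 z2"
      by (simp add: LO_def sum_distrib_left sum_distrib_right mult.assoc)
    finally show ?thesis .
  qed
  have LO0: "0 \<le> LO" unfolding LO_def by (intro sum_nonneg lipschitz_on_nonneg[OF La])
  obtain m where m: "m > 0" "\<And>z u. z \<in> cball z0 e \<Longrightarrow> m * norm u \<le> norm (form_op c z u)"
  proof -
    have "\<exists>m>0. \<forall>z\<in>cball z0 e. \<forall>u. m * norm u \<le> norm (form_op c z u)"
      by (rule linear_lower_bound_on_compact[OF compact_cball lipschitz_on_continuous_on[OF La] lin])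
        (use form_op_injective[OF cA(1)] zimg in blast)+
    then show ?thesis using that by (elim exE conjE) blast
  qed
  define \<xi> where "\<xi> t z = hamiltonian_vector_field A \<omega> (H t) (chart_inv c z) c" for t z
  have \<xi>: "form_op c z (\<xi> t z) = - G (t, z)" if t: "t \<in> T" "(t, z) \<in> ?S" for t z
  proof -
    have z: "z \<in> chart_img c" "(t, z) \<in> U" using subsetD[OF S t(2)] by auto
    have ch: "c \<in> charts_at A (chart_inv c z)" using z cA by (simp add: charts_at_iff chart_inv_in)
    have "((H t \<circ> chart_inv c) has_derivative (\<lambda>w. frechet_derivative g (at (t, z)) (0, w))) (at z)"
      using D[OF t(1) z] by (simp add: comp_def)
    from frechet_derivative_at[OF this, symmetric]
    show ?thesis
      using hamiltonian_vector_coord[OF smooth_hamiltonian_differentiable[OF H t(1)] ch]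
      by (simp add: chart_map_inv[OF cA(1) z(1)] \<xi>_def G_def)
  qed
  have \<xi>B: "norm (\<xi> t z) \<le> BG / m" if t: "t \<in> T" "(t, z) \<in> ?S" for t z
    using m(2)[of z "\<xi> t z"] BG(2)[OF t(2)] t m(1) by (simp add: \<xi>[OF t] field_simps)
  have "((LG + BG / m * LO) / m)-lipschitz_on ((T \<inter> cball t0 e) \<times> cball z0 e) (\<lambda>(t, z). \<xi> t z)"
  proof (rule lipschitz_onI)
    show "0 \<le> (LG + BG / m * LO) / m"
      using m BG(1) LO0 lipschitz_on_nonneg[OF LG] by simp
    fix x y assume "x \<in> (T \<inter> cball t0 e) \<times> cball z0 e" "y \<in> (T \<inter> cball t0 e) \<times> cball z0 e"
    then obtain t z s w where x: "x = (t, z)" "t \<in> T" "(t, z) \<in> ?S" "z \<in> cball z0 e"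
      and y: "y = (s, w)" "s \<in> T" "(s, w) \<in> ?S" "w \<in> cball z0 e" by auto
    have "form_op c z (\<xi> t z - \<xi> s w) = G (s, w) - G (t, z) + (form_op c w (\<xi> s w) - form_op c z (\<xi> s w))"
      by (simp add: linear_diff[OF lin[OF x(4)]] \<xi>[OF x(2,3)] \<xi>[OF y(2,3)])
    then have "m * norm (\<xi> t z - \<xi> s w) \<le> norm (G (s, w) - G (t, z) + (form_op c w (\<xi> s w) - form_op c z (\<xi> s w)))"
      using m(2)[OF x(4), of "\<xi> t z - \<xi> s w"] by simp
    also have "\<dots> \<le> norm (G (s, w) - G (t, z)) + norm (form_op c w (\<xi> s w) - form_op c z (\<xi> s w))"
      by (rule norm_triangle_ineq)
    also have "\<dots> \<le> LG * dist x y + BG / m * LO * dist x y"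
    proof (rule add_mono)
      show "norm (G (s, w) - G (t, z)) \<le> LG * dist x y"
        using lipschitz_onD[OF LG x(3) y(3)]
        unfolding x(1) y(1) dist_norm[of "G (t, z)"] norm_minus_commute[of "G (s, w)"] .
      have "norm (form_op c w (\<xi> s w) - form_op c z (\<xi> s w)) \<le> norm (\<xi> s w) * LO * dist w z"
        by (rule LO[OF y(4) x(4)])
      also have "\<dots> \<le> BG / m * LO * dist x y"
        using \<xi>B[OF y(2,3)] LO0 dist_snd_le[of y x] m(1) BG(1)
        by (intro mult_mono) (auto simp: x y dist_commute)
      finally show "norm (form_op c w (\<xi> s w) - form_op c z (\<xi> s w)) \<le> BG / m * LO * dist x y" .
    qed
    finally show "dist ((\<lambda>(t, z). \<xi> t z) x) ((\<lambda>(t, z). \<xi> t z) y) \<le> (LG + BG / m * LO) / m * dist x y"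
      using m(1) by (simp add: x y dist_norm field_simps)
  qed
  then show "\<exists>e>0. \<exists>L. cball (chart_map c p) e \<subseteq> chart_img c \<and>
      L-lipschitz_on ((T \<inter> cball t0 e) \<times> cball (chart_map c p) e)
        (\<lambda>(t, z). hamiltonian_vector_field A \<omega> (H t) (chart_inv c z) c)"
    unfolding \<xi>_def z0_def[symmetric] using e zimg by blast
qed

end

context real_symplectic_manifold
begin

lemma tau_involutive: "\<tau> (\<tau> x) = x"
  using involution by (metis comp_apply id_apply)

text \<open>An antisymplectic map reverses Hamiltonian vector fields: with \<open>w = d\<tau> w'\<close>,
  \<open>\<omega> (d\<tau> X) (d\<tau> w') = - \<omega> X w' = d (f \<circ> \<tau>) w' = df w\<close>.\<close>

lemma hamiltonian_vector_field_involution: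
  assumes f: "differentiable_fun f (\<tau> p)"
  shows "hamiltonian_vector_field A \<omega> f (\<tau> p)
    = (\<lambda>c. - map_differential A A \<tau> p (hamiltonian_vector_field A \<omega> (f \<circ> \<tau>) p) c)"
proof (rule hamiltonian_vector_field_eqI)
  note ft = fun_differential_comp(1)[OF involution_smooth f]
  let ?X = "hamiltonian_vector_field A \<omega> (f \<circ> \<tau>) p"
  note X = hamiltonian_vector_tangent[OF ft]
  note DX = map_differential_tangent[OF involution_smooth X]
  show "(\<lambda>c. - map_differential A A \<tau> p ?X c) \<in> tangent_space A (\<tau> p)"
    using tangent_lincomb[OF DX DX, of "-1" 0] by simp
  fix w assume w: "w \<in> tangent_space A (\<tau> p)"
  define w' where "w' = map_differential A A \<tau> (\<tau> p) w"
  have w': "w' \<in> tangent_space A p"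
    using map_differential_tangent[OF involution_smooth w] by (simp add: w'_def tau_involutive)
  have ww': "map_differential A A \<tau> p w' = w"
    using map_differential_involution[OF involution_smooth involution w] by (simp add: w'_def tau_involutive)
  have "\<omega> (\<tau> p) (map_differential A A \<tau> p ?X) w = fun_differential A f (\<tau> p) w"
    using involution_antisymplectic[OF X w'] hamiltonian_vector_pairing[OF ft w']
      fun_differential_map[OF involution_smooth f w'] by (simp add: ww')
  then show "\<omega> (\<tau> p) (\<lambda>c. - map_differential A A \<tau> p ?X c) w = - fun_differential A f (\<tau> p) w"
    using form_linear[OF DX DX w, of "-1" 0] by simp
qed

end

section \<open>A symmetric time cutoff\<close>

text \<open>For \<open>n = 0\<close> this is the classical smooth function that is flat at 0. The other exponents make the
  family closed under differentiation.\<close>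

definition flat_exp :: "nat \<Rightarrow> real \<Rightarrow> real" where
  "flat_exp n u = (if 0 < u then exp (- 1 / u) / u ^ n else 0)"

lemma flat_exp_tendsto_0: "(flat_exp n \<longlongrightarrow> 0) (at 0)"
proof (rule filterlim_split_at)
  show "(flat_exp n \<longlongrightarrow> 0) (at_left 0)"
    by (rule Lim_transform_eventually[OF tendsto_const])
      (auto simp: eventually_at_filter flat_exp_def intro!: always_eventually)
  have "((\<lambda>x::real. x ^ n / exp x) \<longlongrightarrow> 0) at_top" by (rule tendsto_power_div_exp_0)
  then have "((\<lambda>x. flat_exp n (inverse x)) \<longlongrightarrow> 0) at_top"
  proof (rule Lim_transform_eventually)
    show "\<forall>\<^sub>F x in at_top. x ^ n / exp x = flat_exp n (inverse x)"
      using eventually_gt_at_top[of 0]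
      by eventually_elim (simp add: flat_exp_def exp_minus divide_simps)
  qed
  then show "(flat_exp n \<longlongrightarrow> 0) (at_right 0)" by (simp add: filterlim_at_right_to_top)
qed

lemma flat_exp_derivative:
  "(flat_exp n has_real_derivative flat_exp (n + 2) u - real n * flat_exp (n + 1) u) (at u)"
proof -
  consider "u < 0" | "u = 0" | "0 < u" by linarith
  then show ?thesis
  proof cases
    case 1
    have "((\<lambda>u. 0) has_real_derivative 0) (at u)" by simp
    then have "(flat_exp n has_real_derivative 0) (at u)"
      by (rule has_field_derivative_transform_within_open[of _ _ _ "{..<0}"])
        (use 1 in \<open>auto simp: flat_exp_def\<close>)
    then show ?thesis using 1 by (simp add: flat_exp_def)
  next
    case 2
    have "(\<lambda>h. (flat_exp n (0 + h) - flat_exp n 0) / h) = flat_exp (n + 1)"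
      by (auto simp: flat_exp_def fun_eq_iff)
    then have "(flat_exp n has_real_derivative 0) (at 0)"
      using flat_exp_tendsto_0[of "n + 1"] by (simp add: DERIV_def)
    then show ?thesis using 2 by (simp add: flat_exp_def)
  next
    case 3
    have "((\<lambda>u. exp (- 1 / u) / u ^ n) has_real_derivative
        ((exp (- 1 / u) * (1 / (u * u))) * u ^ n - exp (- 1 / u) * (real n * u ^ (n - 1))) / (u ^ n * u ^ n)) (at u)"
      using 3 by (auto intro!: derivative_eq_intros)
    also have "((exp (- 1 / u) * (1 / (u * u))) * u ^ n - exp (- 1 / u) * (real n * u ^ (n - 1))) / (u ^ n * u ^ n)
        = flat_exp (n + 2) u - real n * flat_exp (n + 1) u"
      using 3 by (cases n) (simp_all add: flat_exp_def field_simps)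
    finally have "((\<lambda>u. exp (- 1 / u) / u ^ n) has_real_derivative
        flat_exp (n + 2) u - real n * flat_exp (n + 1) u) (at u)" .
    then show ?thesis
      by (rule has_field_derivative_transform_within_open[of _ _ _ "{0<..}"])
        (use 3 in \<open>auto simp: flat_exp_def\<close>)
  qed
qed

lemma Ck_flat_exp: "Ck_on k UNIV (flat_exp n)"
proof (induction k arbitrary: n)
  case 0
  show ?case
    using flat_exp_derivative by (auto intro!: continuous_at_imp_continuous_on DERIV_isCont)
next
  case (Suc k)
  have "Ck_on k UNIV (\<lambda>u. (flat_exp (n + 2) u - real n * flat_exp (n + 1) u) * v)" for v
  proof -
    have "Ck_on k UNIV (\<lambda>u. flat_exp (n + 2) u * v + flat_exp (n + 1) u * (- real n * v))"
      by (intro Ck_on_add open_UNIV Ck_on_bounded_linear[OF bounded_linear_mult_left open_UNIV Suc.IH])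
    then show ?thesis by (simp add: algebra_simps)
  qed
  then show ?case
    by (intro Ck_on_Suc_I[OF open_UNIV flat_exp_derivative[unfolded has_field_derivative_def]])
qed

lemma smooth_flat_exp: "smooth_on UNIV (flat_exp n)"
  by (simp add: smooth_on_open_iff Ck_flat_exp)

text \<open>Combinations with constant coefficients are closed under differentiation, so one induction
  treats sine and cosine together.\<close>

lemma Ck_trig: "Ck_on k UNIV (\<lambda>t::real. a * sin t + b * cos t)"
proof (induction k arbitrary: a b)
  case 0
  show ?case by (auto intro!: continuous_intros)
next
  case (Suc k)
  have D: "((\<lambda>t::real. a * sin t + b * cos t) has_derivative (*) (a * cos t - b * sin t)) (at t)" for t
    unfolding has_field_derivative_def[symmetric] by (auto intro!: derivative_eq_intros)
  have "Ck_on k UNIV (\<lambda>t. (a * cos t - b * sin t) * v)" for v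
    using Suc.IH[of "- b * v" "a * v"] by (simp add: algebra_simps)
  then show ?case by (intro Ck_on_Suc_I[OF open_UNIV D])
qed

text \<open>The clock \<open>\<sigma>\<close> runs from 0 to 1 during the first half of each period and back during the
  second; \<open>\<rho>\<close> is its speed in the first half and vanishes in the second. Both are obtained from
  \<open>P t = flat_exp 0 (sin (2 * pi * t))\<close>, a smooth bump supported in the half periods where the sine
  is positive: \<open>\<sigma>\<close> is a normalised antiderivative of the odd function \<open>P t - P (-
  t)\<close>, whence it is even and periodic. That \<open>\<sigma>\<close> is even on the whole line and never
  leaves \<open>{0..1}\<close> allows a symmetric Hamiltonian to be written by one formula, without gluing in
  time.\<close>

lemma symmetric_time_cutoff:
  obtains \<rho> \<sigma> :: "real \<Rightarrow> real"
  where "smooth_on UNIV \<rho>" "smooth_on UNIV \<sigma>"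
    and "\<And>t. 0 \<le> \<rho> t" "\<And>t. \<rho> (t + 1) = \<rho> t" "\<And>t. t \<in> {0..1 / 2} \<Longrightarrow> \<rho> (- t) = 0"
    and "\<And>t. \<sigma> t \<in> {0..1}" "\<And>t. \<sigma> (t + 1) = \<sigma> t" "\<And>t. \<sigma> (- t) = \<sigma> t"
    and "\<sigma> 0 = 0" "\<sigma> (1 / 2) = 1"
    and "\<And>t. t \<in> {0..1 / 2} \<Longrightarrow> (\<sigma> has_real_derivative \<rho> t) (at t)"
proof -
  define P where "P t = flat_exp 0 (sin (2 * pi * t))" for t
  have Psm: "smooth_on UNIV P"
  proof -
    have s: "smooth_on UNIV (\<lambda>t::real. sin t)"
      using Ck_trig[of _ 1 0] by (simp add: smooth_on_open_iff)
    have "smooth_on UNIV (\<lambda>t::real. sin (2 * pi * t))"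
      by (rule smooth_on_compose[OF smooth_on_bounded_linear[OF bounded_linear_mult_right] s]) simp
    then show ?thesis unfolding P_def
      by (rule smooth_on_compose[OF _ smooth_flat_exp]) simp
  qed
  have P0: "0 \<le> P t" for t by (simp add: P_def flat_exp_def)
  have Pper: "P (t + 1) = P t" for t
    by (simp add: P_def distrib_left sin_add)
  have Pneg: "P (- t) = 0" if "t \<in> {0..1 / 2}" for t
  proof -
    have "0 \<le> sin (2 * pi * t)" using that by (intro sin_ge_zero) auto
    then show ?thesis by (simp add: P_def flat_exp_def)
  qed
  have Ppos: "0 < P t" if "0 < t" "t < 1 / 2" for t
  proof -
    have "0 < sin (2 * pi * t)" using that by (intro sin_gt_zero) auto
    then show ?thesis by (simp add: P_def flat_exp_def)
  qed
  define q where "q t = P t - P (- t)" for t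
  have qsm: "smooth_on UNIV q"
  proof -
    have "smooth_on UNIV (\<lambda>t. P (- t))"
      by (rule smooth_on_compose[OF smooth_on_bounded_linear[OF bounded_linear_minus[OF bounded_linear_ident]] Psm]) simp
    then have "smooth_on UNIV (\<lambda>t. P t + (- 1) * P (- t))"
      by (intro smooth_on_add smooth_on_mult Psm smooth_on_const)
    then show ?thesis by (simp add: q_def[abs_def])
  qed
  have qcont: "isCont q t" for t
    using smooth_on_imp_continuous_on[OF qsm] by (simp add: continuous_on_eq_continuous_at)
  obtain F where F: "\<And>t. (F has_real_derivative q t) (at t)"
    using einterval_antiderivative[of "-\<infinity>" "\<infinity>" q] qcont
    by (auto simp: has_real_derivative_iff_has_vector_derivative)
  have Feven: "F (- t) = F t" for t
  proof -
    have "((\<lambda>t. F t - F (- t)) has_real_derivative 0) (at x)" for x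
    proof -
      have "((\<lambda>t. F (- t)) has_real_derivative q (- x) * (- 1)) (at x)"
        by (rule DERIV_chain2[OF F]) (auto intro!: derivative_eq_intros)
      then have "((\<lambda>t. F t - F (- t)) has_real_derivative q x - q (- x) * (- 1)) (at x)"
        by (intro DERIV_diff F)
      then show ?thesis by (simp add: q_def)
    qed
    then have "(\<lambda>t. F t - F (- t)) t = (\<lambda>t. F t - F (- t)) 0" by (intro DERIV_isconst_all) auto
    then show ?thesis by simp
  qed
  have Fper: "F (t + 1) = F t" for t
  proof -
    have qper: "q (x + 1) = q x" for x
      using Pper[of x] Pper[of "- x - 1"] by (simp add: q_def)
    have "((\<lambda>t. F (t + 1) - F t) has_real_derivative 0) (at x)" for x
    proof -
      have "((\<lambda>t. F (t + 1)) has_real_derivative q (x + 1) * 1) (at x)"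
        by (rule DERIV_chain2[OF F]) (auto intro!: derivative_eq_intros)
      then have "((\<lambda>t. F (t + 1) - F t) has_real_derivative q (x + 1) * 1 - q x) (at x)"
        by (intro DERIV_diff F)
      then show ?thesis by (simp add: qper)
    qed
    \<comment> \<open>The constant is 0: at \<open>- 1 / 2\<close> the two values of the even function
      \<open>F\<close> agree.\<close>
    then have "(\<lambda>t. F (t + 1) - F t) t = (\<lambda>t. F (t + 1) - F t) (- 1 / 2)"
      by (intro DERIV_isconst_all) auto
    then show ?thesis using Feven[of "1 / 2"] by simp
  qed
  have qP: "q t = P t" if "t \<in> {0..1 / 2}" for t using Pneg[OF that] by (simp add: q_def)
  have Fcont: "continuous_on S F" for S
    using F by (intro continuous_at_imp_continuous_on ballI DERIV_isCont) blast
  have Fmono: "F s \<le> F t" if "0 \<le> s" "s \<le> t" "t \<le> 1 / 2" for s t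
    using that F qP P0 by (intro DERIV_nonneg_imp_nondecreasing[OF that(2)]) (auto intro!: exI[of _ "q _"])
  \<comment> \<open>The total height, by which \<open>F\<close> is divided, is positive.\<close>
  have "F 0 < F (1 / 2)"
  proof (rule DERIV_pos_imp_increasing_open[OF _ _ Fcont])
    show "\<exists>y. (F has_real_derivative y) (at x) \<and> 0 < y" if "0 < x" "x < 1 / 2" for x
      using F[of x] qP[of x] Ppos[OF that] that by auto
  qed simp
  define I where "I = F (1 / 2) - F 0"
  have I: "0 < I" using \<open>F 0 < F (1 / 2)\<close> by (simp add: I_def)
  define \<rho> where "\<rho> t = P t / I" for t
  define \<sigma> where "\<sigma> t = (F t - F 0) / I" for t
  have \<sigma>': "(\<sigma> has_real_derivative q t / I) (at t)" for t
    unfolding \<sigma>_def using I by (auto intro!: derivative_eq_intros F)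
  have \<sigma>per: "\<sigma> (t + 1) = \<sigma> t" and \<sigma>even: "\<sigma> (- t) = \<sigma> t" for t
    by (simp_all add: \<sigma>_def Fper Feven)
  have \<sigma>half: "\<sigma> t \<in> {0..1}" if "t \<in> {0..1 / 2}" for t
    using Fmono[of 0 t] Fmono[of t "1 / 2"] that I by (auto simp: \<sigma>_def I_def field_simps)
  have \<sigma>unit: "\<sigma> t \<in> {0..1}" if "t \<in> {0..1}" for t
  proof (cases "t \<le> 1 / 2")
    case False
    have "\<sigma> t = \<sigma> (1 - t)" using \<sigma>per[of "- t"] \<sigma>even[of t] by simp
    then show ?thesis using \<sigma>half[of "1 - t"] that False by simp
  qed (use \<sigma>half that in auto)
  have \<sigma>01: "\<sigma> t \<in> {0..1}" for t
  proof -
    have nat: "\<sigma> (x + real n) = \<sigma> x" for x n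
      by (induction n) (simp_all add: \<sigma>per[of "x + real _", symmetric] add.assoc add.commute[of 1])
    have "\<sigma> (frac t) = \<sigma> t"
    proof (cases "0 \<le> \<lfloor>t\<rfloor>")
      case True
      then show ?thesis using nat[of "frac t" "nat \<lfloor>t\<rfloor>"] by (simp add: frac_def)
    next
      case False
      then show ?thesis using nat[of t "nat (- \<lfloor>t\<rfloor>)"] by (simp add: frac_def)
    qed
    moreover have "frac t \<in> {0..1}" using frac_lt_1[of t] by (simp add: frac_ge_0 less_imp_le)
    ultimately show ?thesis using \<sigma>unit by metis
  qed
  show thesis
  proof
    show "smooth_on UNIV \<rho>"
      using smooth_on_mult[OF Psm smooth_on_const[of UNIV "1 / I"]] by (simp add: \<rho>_def[abs_def])
    have "smooth_on UNIV (\<lambda>t. q t * (1 / I))" by (intro smooth_on_mult qsm smooth_on_const)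
    then have "smooth_on UNIV (\<lambda>t. q t / I)" by simp
    then show "smooth_on UNIV \<sigma>" by (rule smooth_on_realI[OF open_UNIV \<sigma>'])
    show "0 \<le> \<rho> t" for t using P0 I by (simp add: \<rho>_def)
    show "\<rho> (t + 1) = \<rho> t" for t by (simp add: \<rho>_def Pper)
    show "\<rho> (- t) = 0" if "t \<in> {0..1 / 2}" for t by (simp add: \<rho>_def Pneg[OF that])
    show "\<sigma> 0 = 0" by (simp add: \<sigma>_def)
    show "\<sigma> (1 / 2) = 1" using I by (simp add: \<sigma>_def I_def)
    show "(\<sigma> has_real_derivative \<rho> t) (at t)" if "t \<in> {0..1 / 2}" for t
      using \<sigma>'[of t] by (simp add: \<rho>_def qP[OF that])
  qed (fact \<sigma>01 \<sigma>per \<sigma>even)+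
qed

section \<open>The Hofer norm\<close>

definition oscillation :: "('a \<Rightarrow> real) \<Rightarrow> real" where
  "oscillation f = (SUP x. f x) - (INF x. f x)"

lemma hofer_norm_eq: "hofer_norm H = integral {0..1} (\<lambda>t. oscillation (H t))"
  by (simp add: hofer_norm_def oscillation_def)

lemma oscillation_scale:
  assumes "0 \<le> c" "bounded (range f)"
  shows "oscillation (\<lambda>x. c * f x) = c * oscillation f"
proof -
  have mono: "mono (\<lambda>y. c * y)" using assms(1) by (simp add: mono_def mult_left_mono)
  have cont: "continuous (at y within S) (\<lambda>y. c * y)" for y S
    by (intro continuous_intros)
  have "c * Sup (range f) = (SUP y\<in>range f. c * y)"
    by (rule continuous_at_Sup_mono[OF mono cont _ bounded_imp_bdd_above[OF assms(2)]]) simp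
  moreover have "c * Inf (range f) = (INF y\<in>range f. c * y)"
    by (rule continuous_at_Inf_mono[OF mono cont _ bounded_imp_bdd_below[OF assms(2)]]) simp
  ultimately show ?thesis by (simp add: oscillation_def image_image right_diff_distrib)
qed

lemma oscillation_comp_surj:
  assumes "surj g"
  shows "oscillation (\<lambda>x. f (g x)) = oscillation f"
proof -
  have "range (\<lambda>x. f (g x)) = f ` range g" by (simp only: image_image)
  then show ?thesis by (simp add: oscillation_def assms)
qed

lemma oscillation_uniform:
  assumes "bounded (range f)" "bounded (range g)" "\<And>x. \<bar>f x - g x\<bar> \<le> e"
  shows "\<bar>oscillation f - oscillation g\<bar> \<le> 2 * e"
proof -
  have *: "Sup (range f) \<le> Sup (range g) + e \<and> Inf (range f) \<le> Inf (range g) + e"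
    if f: "bounded (range f)" and g: "bounded (range g)" and e: "\<And>x. f x \<le> g x + e" for f g :: "'a \<Rightarrow> real"
  proof
    show "Sup (range f) \<le> Sup (range g) + e"
    proof (rule cSUP_least)
      show "f x \<le> Sup (range g) + e" for x
        using e[of x] cSUP_upper[OF UNIV_I bounded_imp_bdd_above[OF g], of x] by linarith
    qed simp
    have "Inf (range f) - e \<le> Inf (range g)"
    proof (rule cINF_greatest)
      show "Inf (range f) - e \<le> g x" for x
        using e[of x] cINF_lower[OF bounded_imp_bdd_below[OF f] UNIV_I, of x] by linarith
    qed simp
    then show "Inf (range f) \<le> Inf (range g) + e" by simp
  qed
  have "f x \<le> g x + e" "g x \<le> f x + e" for x using assms(3)[of x] by linarith+
  then show ?thesis
    using *[of f g] *[of g f] assms(1,2) unfolding oscillation_def by (auto simp: abs_le_iff)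
qed

text \<open>The time interval is compact, so a compact set in the product may be replaced by the cylinder over
  its projection to the manifold.\<close>

lemma compact_support_iff:
  fixes H :: "real \<Rightarrow> 'a::t2_space \<Rightarrow> real"
  shows "compact_support_01 H \<longleftrightarrow> (\<exists>K. compact K \<and> (\<forall>t\<in>{0..1}. \<forall>x. x \<notin> K \<longrightarrow> H t x = 0))"
proof
  let ?S = "{(t, x). t \<in> {0..1} \<and> H t x \<noteq> 0}"
  assume "compact_support_01 H"
  then have "compact (snd ` closure ?S)"
    unfolding compact_support_01_def by (intro compact_continuous_image continuous_on_snd continuous_on_id)
  moreover have "H t x = 0" if "t \<in> {0..1}" "x \<notin> snd ` closure ?S" for t x
  proof (rule ccontr)
    assume "H t x \<noteq> 0"
    then have "(t, x) \<in> closure ?S" using that(1) closure_subset[of ?S] by auto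
    then show False using that(2) by force
  qed
  ultimately show "\<exists>K. compact K \<and> (\<forall>t\<in>{0..1}. \<forall>x. x \<notin> K \<longrightarrow> H t x = 0)" by blast
next
  let ?S = "{(t, x). t \<in> {0..1} \<and> H t x \<noteq> 0}"
  assume "\<exists>K. compact K \<and> (\<forall>t\<in>{0..1}. \<forall>x. x \<notin> K \<longrightarrow> H t x = 0)"
  then obtain K where K: "compact K" "\<forall>t\<in>{0..1}. \<forall>x. x \<notin> K \<longrightarrow> H t x = 0" by blast
  have c: "compact ({0..1::real} \<times> K)" using K by (intro compact_Times) auto
  have "?S \<subseteq> {0..1} \<times> K" using K(2) by auto
  then have "closure ?S \<subseteq> {0..1} \<times> K" by (rule closure_minimal[OF _ compact_imp_closed[OF c]])
  then have "closure ?S = ({0..1} \<times> K) \<inter> closure ?S" by blast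
  moreover have "compact (({0..1} \<times> K) \<inter> closure ?S)" by (rule compact_Int_closed[OF c closed_closure])
  ultimately show "compact_support_01 H" unfolding compact_support_01_def by simp
qed

text \<open>Over a compact set, continuity in time is uniform in space, by the tube lemma. Continuity of the oscillation
  guarantees that the integral in the Hofer norm is not the default value 0 of a function that fails to be
  integrable.\<close>

lemma
  fixes H :: "real \<Rightarrow> 'a::t2_space \<Rightarrow> real"
  assumes cont: "continuous_on ({0..1} \<times> UNIV) (\<lambda>(t, x). H t x)" and supp: "compact_support_01 H"
  shows bounded_range_compact_support: "t \<in> {0..1} \<Longrightarrow> bounded (range (H t))"
    and continuous_oscillation: "continuous_on {0..1} (\<lambda>t. oscillation (H t))"
proof -
  obtain K where K: "compact K" "\<And>t x. t \<in> {0..1} \<Longrightarrow> x \<notin> K \<Longrightarrow> H t x = 0"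
    using supp unfolding compact_support_iff by blast
  show bdd: "bounded (range (H t))" if t: "t \<in> {0..1}" for t
  proof -
    have "continuous_on K (\<lambda>x. (\<lambda>(t, x). H t x) (t, x))"
      by (rule continuous_on_compose2[OF cont]) (use t in \<open>auto intro!: continuous_intros\<close>)
    then have "compact (H t ` K)" using K(1) by (intro compact_continuous_image) simp_all
    then have "bounded (insert 0 (H t ` K))" by (simp add: compact_imp_bounded)
    moreover have "range (H t) \<subseteq> insert 0 (H t ` K)" using K(2)[OF t] by blast
    ultimately show ?thesis by (rule bounded_subset)
  qed
  show "continuous_on {0..1} (\<lambda>t. oscillation (H t))"
    unfolding continuous_on_iff
  proof (intro ballI allI impI)
    fix t0 e :: real assume t0: "t0 \<in> {0..1}" and e: "0 < e"
    have "continuous_on ({0..1} \<times> K) (\<lambda>(t, x). H t x)" by (rule continuous_on_subset[OF cont]) auto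
    then obtain X0 where X0: "t0 \<in> X0" "open X0"
      "\<forall>t\<in>X0 \<inter> {0..1}. \<forall>x\<in>K. dist ((\<lambda>(t, x). H t x) (t, x)) ((\<lambda>(t, x). H t x) (t0, x)) \<le> e / 3"
      by (rule continuous_on_prod_compactE[OF _ K(1) t0, of _ "e / 3"]) (use e in auto)
    obtain d where d: "d > 0" "ball t0 d \<subseteq> X0" using X0(1,2) openE by blast
    have "dist (oscillation (H t)) (oscillation (H t0)) < e" if t: "t \<in> {0..1}" "dist t t0 < d" for t
    proof -
      have "t \<in> X0 \<inter> {0..1}" using t d by (auto simp: dist_commute)
      then have "\<bar>H t x - H t0 x\<bar> \<le> e / 3" for x
        using X0(3) K(2)[OF t(1)] K(2)[OF t0] e by (cases "x \<in> K") (auto simp: dist_real_def)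
      then have "\<bar>oscillation (H t) - oscillation (H t0)\<bar> \<le> 2 * (e / 3)"
        by (intro oscillation_uniform bdd t t0)
      then show ?thesis using e by (simp add: dist_real_def)
    qed
    then show "\<exists>d>0. \<forall>t\<in>{0..1}. dist t t0 < d \<longrightarrow> dist (oscillation (H t)) (oscillation (H t0)) < e"
      using d(1) by blast
  qed
qed

lemma integral_symmetric_half:
  fixes G :: "real \<Rightarrow> real"
  assumes cont: "continuous_on {0..1} G" and even: "\<And>t. G (- t) = G t" and per: "\<And>t. G (t + 1) = G t"
  shows "integral {0..1} G = 2 * integral {0..1 / 2} G"
proof -
  have "integral {1 / 2..1} G = integral {- (1 / 2)..0} (\<lambda>t. G (t + 1))"
    using integral_shift_real_ivl[of "1 / 2" 1 1 G] by simp
  also have "\<dots> = integral {- (1 / 2)..- 0} (\<lambda>t. G (- t))" by (simp add: per even)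
  also have "\<dots> = integral {0..1 / 2} G" 
    using Henstock_Kurzweil_Integration.integral_reflect_real[of "1 / 2" 0 G] by simp
  finally show ?thesis
    using Henstock_Kurzweil_Integration.integral_combine[of 0 "1 / 2" 1 G] integrable_continuous_real[OF cont] by simp
qed

section \<open>Operations on smooth Hamiltonians\<close>

lemma smooth_hamiltonian_subset:
  "smooth_hamiltonian_on A T H \<Longrightarrow> S \<subseteq> T \<Longrightarrow> smooth_hamiltonian_on A S H"
  unfolding smooth_hamiltonian_on_def by (meson Sigma_mono order_refl smooth_on_subset)

lemma smooth_hamiltonian_mult:
  assumes "smooth_on T \<rho>" "smooth_hamiltonian_on A T H"
  shows "smooth_hamiltonian_on A T (\<lambda>t x. \<rho> t * H t x)"
  unfolding smooth_hamiltonian_on_def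
proof
  fix c assume c: "c \<in> A"
  have "smooth_on (T \<times> chart_img c) (\<lambda>y. \<rho> (fst y))"
    by (rule smooth_on_compose[OF smooth_on_bounded_linear[OF bounded_linear_fst] assms(1)]) auto
  from smooth_on_mult[OF this assms(2)[unfolded smooth_hamiltonian_on_def, rule_format, OF c]]
  show "smooth_on (T \<times> chart_img c) (\<lambda>(t, z). \<rho> t * H t (chart_inv c z))"
    by (simp add: case_prod_unfold)
qed

lemma smooth_hamiltonian_add:
  assumes "smooth_hamiltonian_on A T H" "smooth_hamiltonian_on A T G"
  shows "smooth_hamiltonian_on A T (\<lambda>t x. H t x + G t x)"
  unfolding smooth_hamiltonian_on_def
proof
  fix c assume c: "c \<in> A"
  from smooth_on_add[OF assms[unfolded smooth_hamiltonian_on_def, rule_format, OF c]]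
  show "smooth_on (T \<times> chart_img c) (\<lambda>(t, z). H t (chart_inv c z) + G t (chart_inv c z))"
    by (simp add: case_prod_unfold)
qed

context smooth_manifold
begin

text \<open>Over the preimage of a chart around \<open>F p\<close> the pulled back Hamiltonian is the composition of a
  coordinate expression of \<open>H\<close> with \<open>(t, z) \<mapsto> (\<theta> t, F z)\<close>. The clock
  \<open>\<theta>\<close> may move all real times into a set \<open>T\<close> such as \<open>{0..1}\<close> on
  which alone \<open>H\<close> is smooth.\<close>

lemma smooth_hamiltonian_pullback:
  assumes H: "smooth_hamiltonian_on A T H" and F: "smooth_map A A F"
    and \<theta>: "smooth_on S \<theta>" "\<theta> ` S \<subseteq> T"
  shows "smooth_hamiltonian_on A S (\<lambda>t x. H (\<theta> t) (F x))"
  unfolding smooth_hamiltonian_on_def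
proof (intro ballI smooth_on_local)
  fix c y assume c: "c \<in> A" and y: "y \<in> S \<times> chart_img c"
  obtain d where d: "d \<in> charts_at A (F (chart_inv c (snd y)))" using charts_at_nonempty by blast
  then have dA: "d \<in> A" "F (chart_inv c (snd y)) \<in> chart_dom d" by (auto simp: charts_at_iff)
  let ?W = "chart_map c ` (chart_dom c \<inter> F -` chart_dom d)"
  let ?V = "UNIV \<times> ?W"
  have W: "open ?W" by (rule rep_smooth(1)[OF F c dA(1)])
  have "chart_inv c (snd y) \<in> chart_dom c \<inter> F -` chart_dom d"
    using y dA chart_inv_in[OF c] by auto
  then have "snd y \<in> ?W"
    using y chart_map_inv[OF c] by (metis image_eqI mem_Sigma_iff surjective_pairing)
  then have yV: "y \<in> ?V" by (cases y) simp
  have "smooth_on (S \<times> chart_img c \<inter> ?V) (\<lambda>x. \<theta> (fst x))"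
    by (rule smooth_on_compose[OF smooth_on_bounded_linear[OF bounded_linear_fst] \<theta>(1)]) auto
  moreover have "smooth_on (S \<times> chart_img c \<inter> ?V) (\<lambda>x. (chart_map d \<circ> F \<circ> chart_inv c) (snd x))"
  proof (rule smooth_on_compose[OF smooth_on_bounded_linear[OF bounded_linear_snd]])
    show "smooth_on ?W (chart_map d \<circ> F \<circ> chart_inv c)"
      using F c dA(1) by (simp add: smooth_map_def)
  qed auto
  ultimately have "smooth_on (S \<times> chart_img c \<inter> ?V) (\<lambda>x. (\<theta> (fst x), (chart_map d \<circ> F \<circ> chart_inv c) (snd x)))"
    by (rule smooth_on_Pair)
  moreover have "smooth_on (T \<times> chart_img d) (\<lambda>(t, w). H t (chart_inv d w))"
    using H dA(1) by (simp add: smooth_hamiltonian_on_def)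
  moreover have "(\<lambda>x. (\<theta> (fst x), (chart_map d \<circ> F \<circ> chart_inv c) (snd x))) ` (S \<times> chart_img c \<inter> ?V) \<subseteq> T \<times> chart_img d"
    using \<theta>(2) by (auto simp: chart_inv_map[OF c] chart_map_in)
  ultimately have "smooth_on (S \<times> chart_img c \<inter> ?V)
      (\<lambda>x. (\<lambda>(t, w). H t (chart_inv d w)) (\<theta> (fst x), (chart_map d \<circ> F \<circ> chart_inv c) (snd x)))"
    by (rule smooth_on_compose)
  then have "smooth_on (S \<times> chart_img c \<inter> ?V) (\<lambda>(t, z). H (\<theta> t) (F (chart_inv c z)))"
    by (rule smooth_on_cong[rotated]) (auto simp: chart_inv_map[OF c] chart_inv_map[OF dA(1)])
  then show "\<exists>V. open V \<and> y \<in> V \<and> smooth_on (S \<times> chart_img c \<inter> V) (\<lambda>(t, z). H (\<theta> t) (F (chart_inv c z)))"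
    using yV open_Times[OF open_UNIV W] by blast
qed

lemma smooth_hamiltonian_continuous:
  assumes H: "smooth_hamiltonian_on A T H"
  shows "continuous_on (T \<times> UNIV) (\<lambda>(t, x). H t x)"
  unfolding continuous_on_eq_continuous_within
proof
  fix y :: "real \<times> 'a" assume y: "y \<in> T \<times> UNIV"
  obtain c where "c \<in> charts_at A (snd y)" using charts_at_nonempty by blast
  then have c: "c \<in> A" "snd y \<in> chart_dom c" by (auto simp: charts_at_iff)
  let ?V = "UNIV \<times> chart_dom c"
  have V: "open ?V" "y \<in> ?V" using c chart_open[OF c(1)] by (auto intro: open_Times simp: mem_Times_iff)
  have "continuous_on (T \<times> chart_img c) (\<lambda>(t, z). H t (chart_inv c z))"
    using H c(1) by (intro smooth_on_imp_continuous_on) (simp add: smooth_hamiltonian_on_def)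
  moreover have "continuous_on (T \<times> UNIV \<inter> ?V) (\<lambda>x. (fst x, chart_map c (snd x)))"
    by (intro continuous_on_Pair continuous_on_fst continuous_on_id
        continuous_on_compose2[OF continuous_on_chart_map[OF c(1)]] continuous_on_snd) auto
  ultimately have "continuous_on (T \<times> UNIV \<inter> ?V)
      (\<lambda>x. (\<lambda>(t, z). H t (chart_inv c z)) (fst x, chart_map c (snd x)))"
    by (rule continuous_on_compose2) (auto simp: chart_map_in)
  then have "continuous_on (T \<times> UNIV \<inter> ?V) (\<lambda>(t, x). H t x)"
    by (rule continuous_on_eq) (auto simp: chart_inv_map[OF c(1)])
  then have "continuous (at y within (T \<times> UNIV \<inter> ?V)) (\<lambda>(t, x). H t x)"
    using y V by (auto simp: continuous_on_eq_continuous_within)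
  moreover have "at y within (T \<times> UNIV \<inter> ?V) = at y within (T \<times> UNIV)"
    by (rule at_within_nhd[OF V(2,1)]) auto
  ultimately show "continuous (at y within T \<times> UNIV) (\<lambda>(t, x). H t x)" by (simp only:)
qed

lemma map_differential_minus:
  assumes F: "smooth_map A A F" and v: "v \<in> tangent_space A p"
  shows "map_differential A A F p (\<lambda>c. - v c) = (\<lambda>d. - map_differential A A F p v d)"
proof
  fix d
  have mv: "(\<lambda>c. - v c) \<in> tangent_space A p" using tangent_lincomb[OF v v, of "-1" 0] by simp
  obtain c where c: "c \<in> charts_at A p" using charts_at_nonempty by blast
  show "map_differential A A F p (\<lambda>c. - v c) d = - map_differential A A F p v d"
  proof (cases "d \<in> charts_at A (F p)")
    case True
    show ?thesis
      unfolding map_differential_coord[OF F mv c True] map_differential_coord[OF F v c True]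
      by (rule linear_neg[OF rep_deriv_linear[OF F c True]])
  next
    case False
    then show ?thesis by (simp add: map_differential_def)
  qed
qed

end

section \<open>Intersection points and symmetric orbits\<close>

lemma ecard_mono_inj:
  assumes "inj_on f S" "f ` S \<subseteq> T"
  shows "ecard S \<le> ecard T"
  unfolding ecard_def
  using assms card_inj_on_le[OF assms] finite_imageD[of f S] finite_subset[of "f ` S" T] by auto

lemma ecard_mono_image:
  assumes "T \<subseteq> f ` S"
  shows "ecard T \<le> ecard S"
  unfolding ecard_def
  using assms surj_card_le[OF _ assms] finite_surj[OF _ assms] by auto

context symplectic_manifold
begin

text \<open>Running time through the clock \<open>\<theta>\<close> multiplies the velocity, and hence the Hamiltonian, by the
  speed of the clock.\<close>

lemma hamiltonian_solution_reparam:
  assumes H: "smooth_hamiltonian_on A T H" and sol: "solves_ode A (\<lambda>t. hamiltonian_vector_field A \<omega> (H t)) T \<gamma>"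
    and \<theta>: "\<And>s. s \<in> S \<Longrightarrow> \<theta> s \<in> T" "\<And>s. s \<in> S \<Longrightarrow> (\<theta> has_real_derivative \<theta>' s) (at s within S)"
    and K: "\<And>s x. s \<in> S \<Longrightarrow> K s x = \<theta>' s * H (\<theta> s) x"
  shows "solves_ode A (\<lambda>s. hamiltonian_vector_field A \<omega> (K s)) S (\<lambda>s. \<gamma> (\<theta> s))"
proof (rule solves_ode_cong[OF solves_ode_reparam[OF sol \<theta>]])
  fix s p assume s: "s \<in> S"
  have "K s = (\<lambda>x. \<theta>' s * H (\<theta> s) x)" using K[OF s] by auto
  then show "hamiltonian_vector_field A \<omega> (K s) p
      = (\<lambda>c. \<theta>' s *\<^sub>R hamiltonian_vector_field A \<omega> (H (\<theta> s)) p c)"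
    using hamiltonian_vector_field_scale[OF smooth_hamiltonian_differentiable[OF H \<theta>(1)[OF s]]] by simp
qed auto

theorem hamiltonian_flow_exists:
  assumes H: "H \<in> C0_infinity_interval A"
  shows "\<exists>\<Phi>. hamiltonian_flow A \<omega> H \<Phi>"
proof -
  let ?X = "\<lambda>t. hamiltonian_vector_field A \<omega> (H t)"
  have sm: "smooth_hamiltonian_on A {0..1} H" and supp: "compact_support_01 H"
    using H by (auto simp: C0_infinity_interval_def)
  obtain K where K: "compact K" "\<And>t x. t \<in> {0..1} \<Longrightarrow> x \<notin> K \<Longrightarrow> H t x = 0"
    using supp unfolding compact_support_iff by blast
  have vanish: "?X t p = (\<lambda>c. 0)" if "t \<in> {0..1}" "p \<notin> K" for t p
    by (rule hamiltonian_vector_field_zero[of "- K"])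
      (use that K(2) compact_imp_closed[OF K(1)] in auto)
  have "\<exists>\<gamma>. \<gamma> 0 = p \<and> solves_ode A ?X {0..1} \<gamma>" for p
    by (rule solution_exists[OF hamiltonian_field_locally_lipschitz[OF sm] K(1) vanish])
  then obtain \<Gamma> where \<Gamma>: "\<And>p. \<Gamma> p 0 = p" "\<And>p. solves_ode A ?X {0..1} (\<Gamma> p)" by metis
  have "hamiltonian_flow A \<omega> H (\<lambda>t p. \<Gamma> p t)"
    unfolding hamiltonian_flow_def using \<Gamma> by auto
  then show ?thesis by (rule exI[of _ "\<lambda>t p. \<Gamma> p t"])
qed

end

context real_symplectic_manifold
begin

lemma surj_tau: "surj \<tau>"
  by (rule surjI[of _ \<tau>]) (rule tau_involutive)

text \<open>The sign from the reversal of time cancels the sign from the antisymplectic involution.\<close>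

lemma hamiltonian_solution_reflect:
  assumes H: "smooth_hamiltonian_on A UNIV H" and sym: "\<And>t x. H t x = H (- t) (\<tau> x)"
    and sol: "solves_ode A (\<lambda>t. hamiltonian_vector_field A \<omega> (H t)) T \<gamma>"
  shows "solves_ode A (\<lambda>t. hamiltonian_vector_field A \<omega> (H t)) (uminus ` T) (\<lambda>t. \<tau> (\<gamma> (- t)))"
proof -
  let ?X = "\<lambda>t. hamiltonian_vector_field A \<omega> (H t)"
  have tan: "?X t p \<in> tangent_space A p" for t p
    by (rule hamiltonian_vector_tangent[OF smooth_hamiltonian_differentiable[OF H UNIV_I]])
  have "solves_ode A (\<lambda>s p c. (- 1) *\<^sub>R ?X (- s) p c) (uminus ` T) (\<lambda>s. \<gamma> (- s))"
    by (rule solves_ode_reparam[OF sol]) (auto intro!: derivative_eq_intros)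
  then have sol': "solves_ode A (\<lambda>s p c. - ?X (- s) p c) (uminus ` T) (\<lambda>s. \<gamma> (- s))" by simp
  show ?thesis
  proof (rule solves_ode_map[OF involution_smooth sol'])
    fix t
    let ?p = "\<gamma> (- t)"
    show "(\<lambda>c. - ?X (- t) ?p c) \<in> tangent_space A ?p"
      using tangent_lincomb[OF tan tan, of "-1" "- t" ?p 0 "- t"] by simp
    have "H t \<circ> \<tau> = H (- t)" using sym[of "- t"] by (auto simp: fun_eq_iff)
    then show "?X t (\<tau> ?p) = map_differential A A \<tau> ?p (\<lambda>c. - ?X (- t) ?p c)"
      using hamiltonian_vector_field_involution[OF smooth_hamiltonian_differentiable[OF H UNIV_I], of t ?p]
      by (simp only: map_differential_minus[OF involution_smooth tan])
  qed
qed

text \<open>A solution over half a period with both ends in the fixed set is continued by reflection and then periodically.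
  The end conditions make the pieces match at all half-integers. Such a curve is \<open>\<gamma> (t - j)\<close>
  on \<open>{j..j + 1 / 2}\<close> and \<open>\<tau> (\<gamma> (j - t))\<close> on \<open>{j - 1 / 2..j}\<close>,
  for integers \<open>j\<close>.\<close>

lemma symmetric_orbit_from_half:
  assumes H: "smooth_hamiltonian_on A UNIV H" and sym: "periodic_symmetric \<tau> H"
    and sol: "solves_ode A (\<lambda>t. hamiltonian_vector_field A \<omega> (H t)) {0..1 / 2} \<gamma>"
    and ends: "\<tau> (\<gamma> 0) = \<gamma> 0" "\<tau> (\<gamma> (1 / 2)) = \<gamma> (1 / 2)"
  shows "\<exists>x\<in>symmetric_orbits A \<omega> H \<tau>. x (1 / 2) = \<gamma> (1 / 2)"
proof -
  let ?X = "\<lambda>t. hamiltonian_vector_field A \<omega> (H t)"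
  have per: "H (t + 1) x = H t x" and refl: "H t x = H (- t) (\<tau> x)" for t x
    using sym unfolding periodic_symmetric_def by blast+
  have nat: "H (t + real n) x = H t x" for t n x
    by (induction n) (simp_all add: per[of "t + real _", symmetric] add.assoc add.commute[of 1])
  have int: "H (t - of_int j) x = H t x" for t j x
  proof (cases "0 \<le> j")
    case True
    then show ?thesis using nat[of "t - of_int j" "nat j" x] by simp
  next
    case False
    then show ?thesis using nat[of t "nat (- j)" x] by simp
  qed
  define x where "x t = (if frac t \<le> 1 / 2 then \<gamma> (frac t) else \<tau> (\<gamma> (1 - frac t)))" for t :: real
  have left: "x t = \<gamma> (t - of_int j)" if "t - of_int j \<in> {0..1 / 2}" for t j
  proof -
    have "frac t = t - of_int j" using that by (subst frac_unique_iff) auto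
    then show ?thesis using that by (simp add: x_def)
  qed
  have right: "x t = \<tau> (\<gamma> (of_int j - t))" if "of_int j - t \<in> {0..1 / 2}" for t j
  proof (cases "t = of_int j")
    case True
    then show ?thesis using left[of t j] ends by simp
  next
    case False
    then have f: "frac t = t - (of_int j - 1)"
      using that by (subst frac_unique_iff) auto
    show ?thesis
    proof (cases "of_int j - t = 1 / 2")
      case True
      then have "frac t = 1 / 2" using f by linarith
      then have "x t = \<gamma> (1 / 2)" by (simp only: x_def order_refl if_True)
      then show ?thesis using ends(2) by (simp only: True)
    next
      case False
      then have "1 / 2 < frac t" using f that by auto
      then show ?thesis using f by (simp add: x_def)
    qed
  qed
  have shift: "solves_ode A ?X S (\<lambda>t. \<eta> (t - of_int j))"
    if "solves_ode A ?X T \<eta>" "\<And>t. t \<in> S \<Longrightarrow> t - of_int j \<in> T" for S T \<eta> j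
    by (rule hamiltonian_solution_reparam[OF smooth_hamiltonian_subset[OF H subset_UNIV] that(1), of _ _ "\<lambda>_. 1"])
      (use that(2) in \<open>auto intro!: derivative_eq_intros simp: int\<close>)
  have "solves_ode A ?X UNIV x"
  proof (rule solves_ode_half_intervals)
    fix k :: int
    let ?I = "{of_int k / 2..(of_int k + 1) / (2::real)}"
    show "solves_ode A ?X ?I x"
    proof (cases "even k")
      case True
      then obtain j where j: "k = 2 * j" by blast
      have in_half: "t - of_int j \<in> {0..1 / 2}" if "t \<in> ?I" for t using that by (auto simp: j)
      have "solves_ode A ?X ?I (\<lambda>t. \<gamma> (t - of_int j))" by (rule shift[OF sol in_half])
      then show ?thesis by (rule solves_ode_cong) (use left in_half in auto)
    next
      case False
      then obtain j where "k = 2 * j + 1" by (rule oddE)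
      then have in_half: "of_int (j + 1) - t \<in> {0..1 / 2}" if "t \<in> ?I" for t using that by auto
      have mem: "t - of_int (j + 1) \<in> uminus ` {0..1 / 2}" if "t \<in> ?I" for t
        by (rule image_eqI[OF _ in_half[OF that]]) simp
      have eq: "x t = \<tau> (\<gamma> (- (t - of_int (j + 1))))" if "t \<in> ?I" for t
        using right[OF in_half[OF that]] by simp
      have "solves_ode A ?X ?I (\<lambda>t. \<tau> (\<gamma> (- (t - of_int (j + 1)))))"
        by (rule shift[OF hamiltonian_solution_reflect[OF H refl sol] mem])
      then show ?thesis by (rule solves_ode_cong[OF _ eq HOL.refl])
    qed
  qed
  moreover have "x (t + 1) = x t" for t by (simp add: x_def frac_1_eq)
  moreover have "x (- t) = \<tau> (x t)" for t
  proof -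
    have eq: "of_int \<lfloor>t\<rfloor> + frac t = t" by (simp add: frac_def)
    have f: "0 \<le> frac t" "frac t < 1" by (simp_all add: frac_ge_0 frac_lt_1)
    show ?thesis
    proof (cases "frac t \<le> 1 / 2")
      case True
      have "x (- t) = \<tau> (\<gamma> (of_int (- \<lfloor>t\<rfloor>) - (- t)))"
        by (rule right) (use eq f True in auto)
      moreover have "x t = \<gamma> (t - of_int \<lfloor>t\<rfloor>)"
        by (rule left) (use eq f True in auto)
      ultimately show ?thesis by simp
    next
      case False
      have "x (- t) = \<gamma> (- t - of_int (- \<lfloor>t\<rfloor> - 1))"
        by (rule left) (use eq f False in auto)
      moreover have "x t = \<tau> (\<gamma> (of_int (\<lfloor>t\<rfloor> + 1) - t))"
        by (rule right) (use eq f False in auto)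
      ultimately show ?thesis by (simp add: tau_involutive algebra_simps)
    qed
  qed
  ultimately have "x \<in> symmetric_orbits A \<omega> H \<tau>" by (simp add: symmetric_orbits_def)
  moreover have "x (1 / 2) = \<gamma> (1 / 2)" using left[of "1 / 2" 0] by simp
  ultimately show ?thesis by blast
qed

lemma oscillation_properties:
  assumes H: "H \<in> C0_infinity_interval A"
  shows "t \<in> {0..1} \<Longrightarrow> bounded (range (H t))" "continuous_on {0..1} (\<lambda>t. oscillation (H t))"
  using assms bounded_range_compact_support[of H t] continuous_oscillation[of H] smooth_hamiltonian_continuous[of "{0..1}" H]
  by (auto simp: C0_infinity_interval_def)

lemma circle_imp_interval:
  assumes "H \<in> C0_infinity_circle A"
  shows "H \<in> C0_infinity_interval A"
  using assms smooth_hamiltonian_subset[of A UNIV H "{0..1}"]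
  by (auto simp: C0_infinity_circle_def C0_infinity_interval_def)

text \<open>The involution is a bijection and preserves oscillations, so both halves of the period contribute
  equally.\<close>

lemma hofer_norm_symmetric:
  assumes H: "H \<in> C0_infinity_circle A" and sym: "periodic_symmetric \<tau> H"
  shows "hofer_norm H = 2 * integral {0..1 / 2} (\<lambda>t. oscillation (H t))"
  unfolding hofer_norm_eq
proof (rule integral_symmetric_half)
  show "continuous_on {0..1} (\<lambda>t. oscillation (H t))"
    by (rule oscillation_properties[OF circle_imp_interval[OF H]])
  have "H (t + 1) = H t" for t using sym by (auto simp: periodic_symmetric_def)
  then show "oscillation (H (t + 1)) = oscillation (H t)" for t by (rule arg_cong)
  fix t
  have "H t = (\<lambda>x. H (- t) (\<tau> x))"
    using sym unfolding periodic_symmetric_def by (intro ext) blast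
  then have "oscillation (H t) = oscillation (\<lambda>x. H (- t) (\<tau> x))" by (rule arg_cong)
  also have "\<dots> = oscillation (H (- t))" by (rule oscillation_comp_surj[OF surj_tau])
  finally show "oscillation (H (- t)) = oscillation (H t)" ..
qed

text \<open>The Hamiltonian \<open>K t = 1 / 2 * H (t / 2)\<close> generates at time 1 the time-1/2 map of \<open>H\<close>. A
  point \<open>\<phi> p\<close> of the intersection is the value at time 1/2 of the symmetric orbit through \<open>p\<close>, so
  there are at least as many orbits as intersection points.
  Existence of the flow makes the hypothesis on generated diffeomorphisms applicable.\<close>

proposition symmetric_orbits_from_intersections:
  assumes H: "H \<in> C0_infinity_circle A" and sym: "periodic_symmetric \<tau> H"
  shows "\<exists>K \<phi>. K \<in> C0_infinity_interval A \<and> hofer_norm H = 2 * hofer_norm K \<and> generated_by A \<omega> K \<phi> \<and>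
    ecard (fixed_set \<tau> \<inter> \<phi> ` fixed_set \<tau>) \<le> ecard (symmetric_orbits A \<omega> H \<tau>)"
proof -
  have sm: "smooth_hamiltonian_on A UNIV H" and supp: "compact_support_01 H"
    using H by (auto simp: C0_infinity_circle_def)
  define K where "K t x = 1 / 2 * H (t / 2) x" for t x
  have lin: "smooth_on {0..1} (\<lambda>t::real. t / 2)"
    by (rule smooth_on_bounded_linear) (rule bounded_linear_divide)
  have smK: "smooth_hamiltonian_on A {0..1} K"
    unfolding K_def[abs_def]
    using smooth_hamiltonian_pullback[OF sm smooth_map_id lin]
    by (intro smooth_hamiltonian_mult smooth_on_const) simp
  obtain C where C: "compact C" "\<And>t x. t \<in> {0..1} \<Longrightarrow> x \<notin> C \<Longrightarrow> H t x = 0"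
    using supp unfolding compact_support_iff by blast
  have "compact_support_01 K"
    unfolding compact_support_iff using C by (intro exI[of _ C]) (simp add: K_def)
  with smK have K: "K \<in> C0_infinity_interval A" by (simp add: C0_infinity_interval_def)
  note osc = oscillation_properties[OF circle_imp_interval[OF H]]
  have "hofer_norm K = integral {0..1} (\<lambda>t. (1 / 2) *\<^sub>R oscillation (H (t / 2)))"
    unfolding hofer_norm_eq
  proof (rule integral_cong)
    fix t :: real assume "t \<in> {0..1}"
    then have "bounded (range (H (t / 2)))" by (intro osc) auto
    then show "oscillation (K t) = (1 / 2) *\<^sub>R oscillation (H (t / 2))"
      unfolding K_def[abs_def] by (subst oscillation_scale) auto
  qed
  also have "\<dots> = integral {0..1 / 2} (\<lambda>t. oscillation (H t))"
  proof -
    have "((\<lambda>t. (1 / 2) *\<^sub>R oscillation (H (t / 2))) has_integral integral {0 / 2..1 / 2} (\<lambda>t. oscillation (H t))) {0..1}"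
      by (rule has_integral_substitution[OF _ _ _ osc(2)]) (auto intro!: derivative_eq_intros)
    from integral_unique[OF this] show ?thesis by (simp only: div_0)
  qed
  finally have norm: "hofer_norm H = 2 * hofer_norm K"
    by (simp add: hofer_norm_symmetric[OF H sym])
  obtain \<Phi> where \<Phi>: "hamiltonian_flow A \<omega> K \<Phi>" using hamiltonian_flow_exists[OF K] by blast
  then have gen: "generated_by A \<omega> K (\<Phi> 1)" by (auto simp: generated_by_def)
  have "fixed_set \<tau> \<inter> \<Phi> 1 ` fixed_set \<tau> \<subseteq> (\<lambda>x. x (1 / 2)) ` symmetric_orbits A \<omega> H \<tau>"
  proof
    fix q assume "q \<in> fixed_set \<tau> \<inter> \<Phi> 1 ` fixed_set \<tau>"
    then obtain p where p: "\<tau> p = p" "q = \<Phi> 1 p" "\<tau> q = q" by (auto simp: fixed_set_def)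
    let ?\<gamma> = "\<lambda>t. \<Phi> (2 * t) p"
    have "solves_ode A (\<lambda>t. hamiltonian_vector_field A \<omega> (K t)) {0..1} (\<lambda>t. \<Phi> t p)"
      using \<Phi> by (simp add: hamiltonian_flow_def)
    then have "solves_ode A (\<lambda>t. hamiltonian_vector_field A \<omega> (H t)) {0..1 / 2} ?\<gamma>"
      by (rule hamiltonian_solution_reparam[OF smK, of _ _ _ "\<lambda>_. 2"])
        (auto intro!: derivative_eq_intros simp: K_def)
    moreover have "\<tau> (?\<gamma> 0) = ?\<gamma> 0" "\<tau> (?\<gamma> (1 / 2)) = ?\<gamma> (1 / 2)"
      using \<Phi> p by (simp_all add: hamiltonian_flow_def)
    ultimately have "\<exists>x\<in>symmetric_orbits A \<omega> H \<tau>. x (1 / 2) = ?\<gamma> (1 / 2)"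
      by (rule symmetric_orbit_from_half[OF sm sym])
    then obtain x where "x \<in> symmetric_orbits A \<omega> H \<tau>" "x (1 / 2) = q" using p(2) by auto
    then show "q \<in> (\<lambda>x. x (1 / 2)) ` symmetric_orbits A \<omega> H \<tau>" by blast
  qed
  then have "ecard (fixed_set \<tau> \<inter> \<Phi> 1 ` fixed_set \<tau>) \<le> ecard (symmetric_orbits A \<omega> H \<tau>)"
    by (rule ecard_mono_image)
  with K norm gen show ?thesis by (intro exI conjI)
qed

text \<open>The flow of \<open>H\<close> is compressed into the first half of the period and switched off smoothly at its
  ends; the second half is prescribed by the symmetry. A symmetric orbit has \<open>x 0\<close> and \<open>x (1 /
  2)\<close> in the fixed set, and by uniqueness of solutions \<open>x (1 / 2) = \<phi> (x 0)\<close> and the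
  orbit is determined by \<open>x (1 / 2)\<close>.\<close>

proposition intersections_from_symmetric_orbits:
  assumes H: "H \<in> C0_infinity_interval A" and gen: "generated_by A \<omega> H \<phi>"
  shows "\<exists>K. K \<in> C0_infinity_circle A \<and> periodic_symmetric \<tau> K \<and> hofer_norm K = 2 * hofer_norm H \<and>
    ecard (symmetric_orbits A \<omega> K \<tau>) \<le> ecard (fixed_set \<tau> \<inter> \<phi> ` fixed_set \<tau>)"
proof -
  have sm: "smooth_hamiltonian_on A {0..1} H" and supp: "compact_support_01 H"
    using H by (auto simp: C0_infinity_interval_def)
  obtain \<rho> \<sigma> :: "real \<Rightarrow> real" where smooth: "smooth_on UNIV \<rho>" "smooth_on UNIV \<sigma>"
    and \<rho>: "\<And>t. 0 \<le> \<rho> t" "\<And>t. \<rho> (t + 1) = \<rho> t" "\<And>t. t \<in> {0..1 / 2} \<Longrightarrow> \<rho> (- t) = 0"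
    and \<sigma>: "\<And>t. \<sigma> t \<in> {0..1}" "\<And>t. \<sigma> (t + 1) = \<sigma> t" "\<And>t. \<sigma> (- t) = \<sigma> t" "\<sigma> 0 = 0" "\<sigma> (1 / 2) = 1"
    and \<sigma>': "\<And>t. t \<in> {0..1 / 2} \<Longrightarrow> (\<sigma> has_real_derivative \<rho> t) (at t)"
    by (rule symmetric_time_cutoff) blast
  define K where "K t x = \<rho> t * H (\<sigma> t) x + \<rho> (- t) * H (\<sigma> t) (\<tau> x)" for t x
  have K_half: "K t = (\<lambda>x. \<rho> t * H (\<sigma> t) x)" if "t \<in> {0..1 / 2}" for t
    using \<rho>(3)[OF that] by (simp add: K_def fun_eq_iff)
  have \<rho>per: "\<rho> (- (t + 1)) = \<rho> (- t)" for t using \<rho>(2)[of "- t - 1"] by simp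
  have sym: "periodic_symmetric \<tau> K"
    unfolding periodic_symmetric_def K_def by (simp only: \<rho>(2) \<rho>per \<sigma>(2,3) tau_involutive minus_minus) simp
  have smK: "smooth_hamiltonian_on A UNIV K"
  proof -
    have im: "range \<sigma> \<subseteq> {0..1}" using \<sigma>(1) by blast
    have "smooth_on UNIV (\<lambda>t. \<rho> (- t))"
      by (rule smooth_on_compose[OF smooth_on_bounded_linear[OF bounded_linear_minus[OF bounded_linear_ident]] smooth(1)]) simp
    moreover have "smooth_hamiltonian_on A UNIV (\<lambda>t x. H (\<sigma> t) x)"
      using smooth_hamiltonian_pullback[OF sm smooth_map_id smooth(2) im] by simp
    moreover have "smooth_hamiltonian_on A UNIV (\<lambda>t x. H (\<sigma> t) (\<tau> x))"
      by (rule smooth_hamiltonian_pullback[OF sm involution_smooth smooth(2) im])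
    ultimately show ?thesis
      unfolding K_def[abs_def] using smooth(1)
      by (intro smooth_hamiltonian_add smooth_hamiltonian_mult)
  qed
  obtain C where C: "compact C" "\<And>t x. t \<in> {0..1} \<Longrightarrow> x \<notin> C \<Longrightarrow> H t x = 0"
    using supp unfolding compact_support_iff by blast
  have "compact_support_01 K"
    unfolding compact_support_iff
  proof (intro exI[of _ "C \<union> \<tau> ` C"] conjI ballI allI impI)
    show "compact (C \<union> \<tau> ` C)"
      using C(1) involution_smooth
      by (auto simp: smooth_map_def intro!: compact_Un compact_continuous_image intro: continuous_on_subset)
    fix t x assume x: "x \<notin> C \<union> \<tau> ` C"
    then have "\<tau> x \<notin> C" using tau_involutive[of x] by (metis UnI2 image_eqI)
    then show "K t x = 0" using x C(2)[OF \<sigma>(1)] by (simp add: K_def)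
  qed
  with smK sym have K: "K \<in> C0_infinity_circle A"
    by (simp add: C0_infinity_circle_def periodic_symmetric_def)
  note osc = oscillation_properties[OF H]
  have "integral {0..1 / 2} (\<lambda>t. oscillation (K t)) = integral {0..1 / 2} (\<lambda>t. \<rho> t *\<^sub>R oscillation (H (\<sigma> t)))"
    by (rule integral_cong) (simp add: K_half oscillation_scale \<rho>(1) osc(1)[OF \<sigma>(1)])
  also have "\<dots> = integral {\<sigma> 0..\<sigma> (1 / 2)} (\<lambda>t. oscillation (H t))"
    by (rule integral_unique, rule has_integral_substitution[OF _ _ _ osc(2)])
      (use \<sigma>(1,4,5) in \<open>auto intro: has_field_derivative_at_within[OF \<sigma>']\<close>)
  finally have norm: "hofer_norm K = 2 * hofer_norm H"
    by (simp add: hofer_norm_symmetric[OF K sym] hofer_norm_eq[of H] \<sigma>)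
  let ?X = "\<lambda>t. hamiltonian_vector_field A \<omega> (K t)"
  note lip = hamiltonian_field_locally_lipschitz[OF smK]
  obtain \<Phi> where \<Phi>: "hamiltonian_flow A \<omega> H \<Phi>" "\<phi> = \<Phi> 1" using gen by (auto simp: generated_by_def)
  let ?O = "symmetric_orbits A \<omega> K \<tau>"
  have "inj_on (\<lambda>x. x (1 / 2)) ?O"
  proof (rule inj_onI)
    fix x y assume "x \<in> ?O" "y \<in> ?O" and eq: "x (1 / 2) = y (1 / 2)"
    then have sol: "solves_ode A ?X UNIV x" "solves_ode A ?X UNIV y" by (simp_all add: symmetric_orbits_def)
    have "x t = y t" for t
      by (rule solution_unique[where s = "1 / 2", OF lip subset_UNIV convex_UNIV sol UNIV_I eq UNIV_I])
    then show "x = y" by (rule ext)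
  qed
  moreover have "(\<lambda>x. x (1 / 2)) ` ?O \<subseteq> fixed_set \<tau> \<inter> \<phi> ` fixed_set \<tau>"
  proof
    fix q assume "q \<in> (\<lambda>x. x (1 / 2)) ` ?O"
    then obtain x where q: "q = x (1 / 2)" and sol: "solves_ode A ?X UNIV x"
      and x: "\<And>t. x (t + 1) = x t" "\<And>t. x (- t) = \<tau> (x t)" by (auto simp: symmetric_orbits_def)
    have fix0: "\<tau> (x 0) = x 0" using x(2)[of 0] by simp
    have "\<tau> (x (1 / 2)) = x (1 / 2)" using x(2)[of "1 / 2"] x(1)[of "- 1 / 2"] by simp
    have "solves_ode A (\<lambda>t. hamiltonian_vector_field A \<omega> (H t)) {0..1} (\<lambda>t. \<Phi> t (x 0))"
      using \<Phi>(1) by (simp add: hamiltonian_flow_def)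
    then have "solves_ode A ?X {0..1 / 2} (\<lambda>t. \<Phi> (\<sigma> t) (x 0))"
      by (rule hamiltonian_solution_reparam[OF sm, of _ _ _ \<rho>])
        (use \<sigma>(1) K_half in \<open>auto intro: has_field_derivative_at_within[OF \<sigma>']\<close>)
    moreover have "solves_ode A ?X {0..1 / 2} x" by (rule solves_ode_subset[OF sol]) simp
    ultimately have "\<Phi> (\<sigma> (1 / 2)) (x 0) = x (1 / 2)"
      by (rule solution_unique[OF lip subset_UNIV convex_real_interval(5), of _ _ _ _ 0])
        (use \<Phi>(1) in \<open>auto simp: \<sigma> hamiltonian_flow_def\<close>)
    then have "q = \<phi> (x 0)" by (simp add: q \<sigma> \<Phi>(2))
    then show "q \<in> fixed_set \<tau> \<inter> \<phi> ` fixed_set \<tau>"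
      using fix0 \<open>\<tau> (x (1 / 2)) = x (1 / 2)\<close> by (simp add: fixed_set_def q)
  qed
  ultimately have "ecard ?O \<le> ecard (fixed_set \<tau> \<inter> \<phi> ` fixed_set \<tau>)"
    by (rule ecard_mono_inj)
  with K sym norm show ?thesis by (intro exI conjI)
qed

end

section \<open>The equivalence\<close>

theorem theorem1p1:
  fixes A :: "('a::{t2_space,second_countable_topology}, 'e::euclidean_space) chart set"
    and \<omega> :: "('a, 'e) two_form"
    and \<tau> :: "'a \<Rightarrow> 'a"
    and n m :: nat
    and \<Lambda> :: ereal
  assumes "real_symplectic_manifold A \<omega> \<tau>"
    and "DIM('e) = 2 * n"
    and "fixed_set \<tau> \<noteq> {}"
    and "0 < \<Lambda>"
  shows "(\<forall>\<phi> H. H \<in> C0_infinity_interval A \<and> ereal (hofer_norm H) < \<Lambda> \<and> generated_by A \<omega> H \<phi>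
            \<longrightarrow> enat m \<le> ecard (fixed_set \<tau> \<inter> \<phi> ` fixed_set \<tau>))
     \<longleftrightarrow> (\<forall>H. H \<in> C0_infinity_circle A \<and> periodic_symmetric \<tau> H \<and> ereal (hofer_norm H) < 2 * \<Lambda>
            \<longrightarrow> enat m \<le> ecard (symmetric_orbits A \<omega> H \<tau>))"
proof -
  interpret real_symplectic_manifold A \<omega> \<tau> by (rule assms(1))
  have double: "ereal (2 * r) < 2 * \<Lambda> \<longleftrightarrow> ereal r < \<Lambda>" for r
    using assms(4) by (cases \<Lambda>) auto
  show ?thesis
  proof (intro iffI allI impI; elim conjE)
    fix H
    assume i: "\<forall>\<phi> H. H \<in> C0_infinity_interval A \<and> ereal (hofer_norm H) < \<Lambda> \<and> generated_by A \<omega> H \<phi>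
        \<longrightarrow> enat m \<le> ecard (fixed_set \<tau> \<inter> \<phi> ` fixed_set \<tau>)"
      and H: "H \<in> C0_infinity_circle A" "periodic_symmetric \<tau> H" "ereal (hofer_norm H) < 2 * \<Lambda>"
    obtain K \<phi> where "K \<in> C0_infinity_interval A" "hofer_norm H = 2 * hofer_norm K" "generated_by A \<omega> K \<phi>"
      and le: "ecard (fixed_set \<tau> \<inter> \<phi> ` fixed_set \<tau>) \<le> ecard (symmetric_orbits A \<omega> H \<tau>)"
      using symmetric_orbits_from_intersections[OF H(1,2)] by blast
    then have "enat m \<le> ecard (fixed_set \<tau> \<inter> \<phi> ` fixed_set \<tau>)"
      by (intro i[rule_format, of K] conjI) (use H(3) double in \<open>simp_all only:\<close>)
    then show "enat m \<le> ecard (symmetric_orbits A \<omega> H \<tau>)" using le by (rule order_trans)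
  next
    fix \<phi> H
    assume ii: "\<forall>H. H \<in> C0_infinity_circle A \<and> periodic_symmetric \<tau> H \<and> ereal (hofer_norm H) < 2 * \<Lambda>
        \<longrightarrow> enat m \<le> ecard (symmetric_orbits A \<omega> H \<tau>)"
      and H: "H \<in> C0_infinity_interval A" "ereal (hofer_norm H) < \<Lambda>" "generated_by A \<omega> H \<phi>"
    obtain K where "K \<in> C0_infinity_circle A" "periodic_symmetric \<tau> K" "hofer_norm K = 2 * hofer_norm H"
      and le: "ecard (symmetric_orbits A \<omega> K \<tau>) \<le> ecard (fixed_set \<tau> \<inter> \<phi> ` fixed_set \<tau>)"
      using intersections_from_symmetric_orbits[OF H(1,3)] by blast
    then have "enat m \<le> ecard (symmetric_orbits A \<omega> K \<tau>)" by (intro ii[rule_format] conjI) (use H(2) double in \<open>simp_all only:\<close>)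
    then show "enat m \<le> ecard (fixed_set \<tau> \<inter> \<phi> ` fixed_set \<tau>)" using le by (rule order_trans)
  qed
qed

end
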